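(* Let $d\in\{1,2\}$, let $L^d$ be a symmetric link function satisfying Property B, suppose the input variables satisfy Assumption I, and for $t\ge 0$ let $A_n(t)=n^{-1/2}((S^{(n)}_{L^d(i,j)}(t)))_{1\le i,j\le n}$. Assume that the limits $$\lim_{n\to\infty}\frac{\#\Pi(w)}{n^{1+m}}$$ exist for all $w\in\mathcal P_2(2m)$ and all $m\ge 1$. Then for every $t\ge0$ and $l\ge 1$, $$\mu^{(l)}(t):=\lim_{n\to\infty}\frac{\mathbb E\,\mathrm{Trace}(A_n(t))^l}{n^{1+l/2}}=\begin{cases}0,& l=2m-1,\ m\ge1,\\[4pt] \displaystyle t^m\sum_{w\in\mathcal P_2(2m)}\lim_{n\to\infty}\frac{\#\Pi(w)}{n^{1+m}},& l=2m,\ m\ge 1.\end{cases}$$ Thus the expected empirical spectral distribution of $n^{-1/2}A_n(t)$ converges weakly to the unique probability law whose $l$th moment equals $\mu^{(l)}(t)$ for each $l\ge1$. As a consequence, the self-adjoint element $n^{-1/2}A_n(t)$ of the non-commutative probability space $(\mathcal M_n(\mathcal A_{\mathbb P}),\tau_n=n^{-1}\mathbb E\,\mathrm{Trace})$ converges to an element $A(t)$ of the $*$-algebra generated by $A(t)$ (self-adjoint) with state $\tau$ defined by $\tau(A^l(t))=\mu^{(l)}(t)$ for all $l\ge 1$, i.e. $\tau_n((n^{-1/2}A_n(t))^l)\to\tau(A^l(t))$ for all $l\geq 1$.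
   Context: All random variables live on a probability space $(\Omega,\mathcal F,\mathbb P)$; $\mathcal A_{\mathbb P}=\cap_{1\le p<\infty}L^p(\mathbb P)$ and $\mathcal M_n(\mathcal A_{\mathbb P})$ is the algebra of $n\times n$ matrices with entries in $\mathcal A_{\mathbb P}$. $[x]$ is the greatest integer $\le x$. Assumption I: $\{X_{i,j,k},X_{i,k}: i,j\ge0,\ k\ge1\}$ are independent real random variables with mean zero and variance one, and for each $l\ge3$, $\sup_{i,j,k}\mathbb E[|X_{i,j,k}|^l+|X_{i,k}|^l]<\infty$. Random walks: $S^{(n)}_{i,j}(t)=\sum_{k=1}^{[nt]}X_{i,j,k}$ and $S^{(n)}_i(t)=\sum_{k=1}^{[nt]}X_{i,k}$ (empty sums are $0$). Link function: for $d\in\{1,2\}$, a sequence of functions $L^d=L^d_n:\{1,\dots,n\}^2\to\mathbb Z^d$ (with values in the index set of the input variables). It is symmetric if $L^d(i,j)=L^d(j,i)$ for all $i,j$. Property B: $\sup_n\sup_{r\in\mathbb Z_+^d}\sup_{1\le i\le n}\#\{j:1\le j\le n,\ L^d(i,j)=r\}<\infty$. The matrix uses the walks $S^{(n)}_{i,j}$ if $d=2$ and $S^{(n)}_i$ if $d=1$. Circuits and words: a circuit of length $l$ is a function $\pi:\{0,1,\dots,l\}\to\{1,\dots,n\}$ with $\pi(0)=\pi(l)$. A word of length $l$ is a sequence of $l$ letters whose first occurrences are in alphabetical order (equivalently a partition of $\{1,\dots,l\}$); $w(i)$ is its $i$th letter. $\Pi(w)$ (depending on $n$) is the set of circuits $\pi$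 of length $l$ such that $w(i)=w(j)$ if and only if $L^d(\pi(i-1),\pi(i))=L^d(\pi(j-1),\pi(j))$. A word is pair-matched if each letter appears exactly twice; $\mathcal P_2(2m)$ is the set of pair-matched words of length $2m$. The empirical spectral distribution (ESD) of a real symmetric $n\times n$ matrix with eigenvalues $\lambda_1,\dots,\lambda_n$ is $F(x)=n^{-1}\sum_{k}\mathbb I(\lambda_k\le x)$; the expected ESD is $\mathbb E F(x)$. *)

theory Defs
  imports
    "HOL-Probability.Probability"
    "HOL-Library.Function_Algebras"
    "Jordan_Normal_Form.Char_Poly"
    "Jordan_Normal_Form.VS_Connect"
begin

section \<open>Input variables, link functions and the random matrix\<close>

text \<open>
  A point of \<open>\<int>\<^sub>+\<^sup>d\<close> is a list of \<open>d\<close> natural numbers. The two families of input variables are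
  one family \<open>X\<close> indexed by such lists: \<open>X\<^sub>i\<^sub>,\<^sub>j\<^sub>,\<^sub>k\<close> is \<open>X [i, j] k\<close> and \<open>X\<^sub>i\<^sub>,\<^sub>k\<close> is \<open>X [i] k\<close>, for
  \<open>k \<ge> 1\<close>. Values of \<open>X\<close> at other arguments play no role.
\<close>

definition lattice_points :: "nat \<Rightarrow> nat list set" where
  "lattice_points d = {r. length r = d}"

definition input_index :: "(nat list \<times> nat) set" where
  "input_index = (lattice_points 1 \<union> lattice_points 2) \<times> {1..}"

definition assumption_I :: "'w measure \<Rightarrow> (nat list \<Rightarrow> nat \<Rightarrow> 'w \<Rightarrow> real) \<Rightarrow> bool" where
  "assumption_I P X \<longleftrightarrow>
     prob_space.indep_vars P (\<lambda>_. borel) (\<lambda>(r, k). X r k) input_index \<and>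
     (\<forall>(r, k) \<in> input_index.
        integrable P (X r k) \<and>
        prob_space.expectation P (X r k) = 0 \<and>
        prob_space.variance P (X r k) = 1) \<and>
     (\<forall>l\<ge>3. (SUP (i, j, k) \<in> UNIV \<times> UNIV \<times> {1..}.
        \<integral>\<^sup>+ \<omega>. ennreal (\<bar>X [i, j] k \<omega>\<bar> ^ l + \<bar>X [i] k \<omega>\<bar> ^ l) \<partial>P) < \<infinity>)"

definition walk :: "(nat list \<Rightarrow> nat \<Rightarrow> 'w \<Rightarrow> real) \<Rightarrow> nat \<Rightarrow> nat list \<Rightarrow> real \<Rightarrow> 'w \<Rightarrow> real" where
  "walk X n r t \<omega> = (\<Sum>k = 1..nat \<lfloor>real n * t\<rfloor>. X r k \<omega>)"

definition link_function :: "nat \<Rightarrow> (nat \<Rightarrow> nat \<Rightarrow> nat \<Rightarrow> nat list) \<Rightarrow> bool" where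
  "link_function d L \<longleftrightarrow> (\<forall>n. \<forall>i\<in>{1..n}. \<forall>j\<in>{1..n}. L n i j \<in> lattice_points d)"

definition symmetric_link :: "(nat \<Rightarrow> nat \<Rightarrow> nat \<Rightarrow> nat list) \<Rightarrow> bool" where
  "symmetric_link L \<longleftrightarrow> (\<forall>n. \<forall>i\<in>{1..n}. \<forall>j\<in>{1..n}. L n i j = L n j i)"

definition property_B :: "nat \<Rightarrow> (nat \<Rightarrow> nat \<Rightarrow> nat \<Rightarrow> nat list) \<Rightarrow> bool" where
  "property_B d L \<longleftrightarrow>
     (\<exists>K. \<forall>n. \<forall>r\<in>lattice_points d. \<forall>i\<in>{1..n}. card {j\<in>{1..n}. L n i j = r} \<le> K)"

text \<open>The rows and columns \<open>1, \<dots>, n\<close> are numbered from \<open>0\<close> in the library's matrices.\<close>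

definition A_mat ::
  "(nat list \<Rightarrow> nat \<Rightarrow> 'w \<Rightarrow> real) \<Rightarrow> (nat \<Rightarrow> nat \<Rightarrow> nat \<Rightarrow> nat list) \<Rightarrow> nat \<Rightarrow> real \<Rightarrow> 'w \<Rightarrow> real mat"
where
  "A_mat X L n t \<omega> =
     (1 / sqrt (real n)) \<cdot>\<^sub>m Matrix.mat n n (\<lambda>(i, j). walk X n (L n (Suc i) (Suc j)) t \<omega>)"

definition mat_trace :: "'a::comm_monoid_add mat \<Rightarrow> 'a" where
  "mat_trace B = (\<Sum>i<dim_row B. B $$ (i, i))"

section \<open>Circuits and words\<close>

definition circuits :: "nat \<Rightarrow> nat \<Rightarrow> (nat \<Rightarrow> nat) set" where
  "circuits n l = {\<pi> \<in> {0..l} \<rightarrow>\<^sub>E {1..n}. \<pi> 0 = \<pi> l}"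

text \<open>
  The letters are the natural numbers in their usual order: a letter that occurs for the first time
  is the least one not used before.
\<close>

definition is_word :: "nat list \<Rightarrow> bool" where
  "is_word w \<longleftrightarrow>
     (\<forall>i<length w. w ! i \<notin> set (take i w) \<longrightarrow> w ! i = card (set (take i w)))"

definition pair_matched :: "nat list \<Rightarrow> bool" where
  "pair_matched w \<longleftrightarrow> (\<forall>a\<in>set w. count_list w a = 2)"

definition pair_words :: "nat \<Rightarrow> nat list set" where
  "pair_words l = {w. is_word w \<and> length w = l \<and> pair_matched w}"

definition word_circuits :: "(nat \<Rightarrow> nat \<Rightarrow> nat \<Rightarrow> nat list) \<Rightarrow> nat \<Rightarrow> nat list \<Rightarrow> (nat \<Rightarrow> nat) set" where
  "word_circuits L n w =
     {\<pi> \<in> circuits n (length w).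
        \<forall>i\<in>{1..length w}. \<forall>j\<in>{1..length w}.
          w ! (i - 1) = w ! (j - 1) \<longleftrightarrow> L n (\<pi> (i - 1)) (\<pi> i) = L n (\<pi> (j - 1)) (\<pi> j)}"

section \<open>Moments and the expected empirical spectral distribution\<close>

definition scaled_trace_moment ::
  "'w measure \<Rightarrow> (nat list \<Rightarrow> nat \<Rightarrow> 'w \<Rightarrow> real) \<Rightarrow> (nat \<Rightarrow> nat \<Rightarrow> nat \<Rightarrow> nat list) \<Rightarrow>
     nat \<Rightarrow> real \<Rightarrow> nat \<Rightarrow> real"
where
  "scaled_trace_moment P X L l t n =
     prob_space.expectation P (\<lambda>\<omega>. mat_trace (A_mat X L n t \<omega> ^\<^sub>m l)) / real n powr (1 + real l / 2)"

definition mu ::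
  "'w measure \<Rightarrow> (nat list \<Rightarrow> nat \<Rightarrow> 'w \<Rightarrow> real) \<Rightarrow> (nat \<Rightarrow> nat \<Rightarrow> nat \<Rightarrow> nat list) \<Rightarrow> nat \<Rightarrow> real \<Rightarrow> real"
where
  "mu P X L l t = lim (scaled_trace_moment P X L l t)"

text \<open>
  The eigenvalues are counted with multiplicity: they are the real roots of the characteristic
  polynomial, and for a symmetric matrix these are all its roots.
\<close>

definition ESD :: "real mat \<Rightarrow> real \<Rightarrow> real" where
  "ESD B x = real (size (filter_mset (\<lambda>e. e \<le> x) (proots (char_poly B)))) / real (dim_row B)"

definition expected_ESD :: "'w measure \<Rightarrow> ('w \<Rightarrow> real mat) \<Rightarrow> real \<Rightarrow> real" where
  "expected_ESD P B x = prob_space.expectation P (\<lambda>\<omega>. ESD (B \<omega>) x)"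

definition law_with_moments :: "(nat \<Rightarrow> real) \<Rightarrow> real measure \<Rightarrow> bool" where
  "law_with_moments m \<nu> \<longleftrightarrow> real_distribution \<nu> \<and>
     (\<forall>l\<ge>1. integrable \<nu> (\<lambda>x. x ^ l) \<and> (\<integral>x. x ^ l \<partial>\<nu>) = m l)"

section \<open>Non-commutative probability spaces\<close>

text \<open>
  Unital complex \<open>*\<close>-algebras with a state, that is, a positive linear functional of value \<open>1\<close> at
  the unit. The library's \<open>algebra\<close> locale is restricted to commutative algebras.
\<close>

record 'a star_prob = "(complex, 'a) module" +
  star :: "'a \<Rightarrow> 'a"
  state :: "'a \<Rightarrow> complex"

locale star_prob_space =
  module "class_ring :: complex ring" A + ring A for A :: "'a star_prob" (structure) +
  assumes smult_mult_left:
      "\<lbrakk>x \<in> carrier A; y \<in> carrier A\<rbrakk> \<Longrightarrow> (c \<odot>\<^bsub>A\<^esub> x) \<otimes>\<^bsub>A\<^esub> y = c \<odot>\<^bsub>A\<^esub> (x \<otimes>\<^bsub>A\<^esub> y)"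
    and smult_mult_right:
      "\<lbrakk>x \<in> carrier A; y \<in> carrier A\<rbrakk> \<Longrightarrow> x \<otimes>\<^bsub>A\<^esub> (c \<odot>\<^bsub>A\<^esub> y) = c \<odot>\<^bsub>A\<^esub> (x \<otimes>\<^bsub>A\<^esub> y)"
    and star_closed: "x \<in> carrier A \<Longrightarrow> star A x \<in> carrier A"
    and star_star: "x \<in> carrier A \<Longrightarrow> star A (star A x) = x"
    and star_add:
      "\<lbrakk>x \<in> carrier A; y \<in> carrier A\<rbrakk> \<Longrightarrow> star A (x \<oplus>\<^bsub>A\<^esub> y) = star A x \<oplus>\<^bsub>A\<^esub> star A y"
    and star_smult: "x \<in> carrier A \<Longrightarrow> star A (c \<odot>\<^bsub>A\<^esub> x) = cnj c \<odot>\<^bsub>A\<^esub> star A x"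
    and star_mult:
      "\<lbrakk>x \<in> carrier A; y \<in> carrier A\<rbrakk> \<Longrightarrow> star A (x \<otimes>\<^bsub>A\<^esub> y) = star A y \<otimes>\<^bsub>A\<^esub> star A x"
    and state_add:
      "\<lbrakk>x \<in> carrier A; y \<in> carrier A\<rbrakk> \<Longrightarrow> state A (x \<oplus>\<^bsub>A\<^esub> y) = state A x + state A y"
    and state_smult: "x \<in> carrier A \<Longrightarrow> state A (c \<odot>\<^bsub>A\<^esub> x) = c * state A x"
    and state_one: "state A \<one>\<^bsub>A\<^esub> = 1"
    and state_pos: "x \<in> carrier A \<Longrightarrow> state A (star A x \<otimes>\<^bsub>A\<^esub> x) \<in> \<real>\<^sub>\<ge>\<^sub>0"

definition self_adjoint :: "'a star_prob \<Rightarrow> 'a \<Rightarrow> bool" where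
  "self_adjoint A a \<longleftrightarrow> a \<in> carrier A \<and> star A a = a"

inductive_set star_generated :: "'a star_prob \<Rightarrow> 'a \<Rightarrow> 'a set" for A a where
  gen: "a \<in> star_generated A a"
| one: "\<one>\<^bsub>A\<^esub> \<in> star_generated A a"
| add: "\<lbrakk>x \<in> star_generated A a; y \<in> star_generated A a\<rbrakk> \<Longrightarrow> x \<oplus>\<^bsub>A\<^esub> y \<in> star_generated A a"
| mult: "\<lbrakk>x \<in> star_generated A a; y \<in> star_generated A a\<rbrakk> \<Longrightarrow> x \<otimes>\<^bsub>A\<^esub> y \<in> star_generated A a"
| smult: "x \<in> star_generated A a \<Longrightarrow> c \<odot>\<^bsub>A\<^esub> x \<in> star_generated A a"
| star: "x \<in> star_generated A a \<Longrightarrow> star A x \<in> star_generated A a"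

text \<open>
  Complex random variables with finite moments of all orders, as functions: almost surely equal
  functions are not identified.
\<close>

definition all_moments :: "'w measure \<Rightarrow> ('w \<Rightarrow> complex) set" where
  "all_moments P =
     {f \<in> borel_measurable P. \<forall>p::real. p \<ge> 1 \<longrightarrow> integrable P (\<lambda>\<omega>. norm (f \<omega>) powr p)}"

text \<open>The matrix entries are functions, with the pointwise ring operations of Function_Algebras.\<close>

definition random_matrix_space :: "'w measure \<Rightarrow> nat \<Rightarrow> ('w \<Rightarrow> complex) mat star_prob" where
  "random_matrix_space P n =
     \<lparr> carrier = {B \<in> carrier_mat n n. \<forall>i<n. \<forall>j<n. B $$ (i, j) \<in> all_moments P},
       mult = (*), one = 1\<^sub>m n, zero = 0\<^sub>m n n, add = (+),
       smult = (\<lambda>c B. (\<lambda>_. c) \<cdot>\<^sub>m B),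
       star = (\<lambda>B. Matrix.mat n n (\<lambda>(i, j). \<lambda>\<omega>. cnj ((B $$ (j, i)) \<omega>))),
       state = (\<lambda>B. (\<integral>\<omega>. mat_trace B \<omega> \<partial>P) / of_nat n) \<rparr>"

definition scaled_A ::
  "(nat list \<Rightarrow> nat \<Rightarrow> 'w \<Rightarrow> real) \<Rightarrow> (nat \<Rightarrow> nat \<Rightarrow> nat \<Rightarrow> nat list) \<Rightarrow> nat \<Rightarrow> real \<Rightarrow> 'w \<Rightarrow> real mat"
where
  "scaled_A X L n t \<omega> = (1 / sqrt (real n)) \<cdot>\<^sub>m A_mat X L n t \<omega>"

definition matrix_element :: "nat \<Rightarrow> ('w \<Rightarrow> real mat) \<Rightarrow> ('w \<Rightarrow> complex) mat" where
  "matrix_element n B = Matrix.mat n n (\<lambda>(i, j). \<lambda>\<omega>. complex_of_real (B \<omega> $$ (i, j)))"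

end

theory Submission
  imports Defs "Jordan_Normal_Form.Schur_Decomposition"
begin

text \<open>
  Expanding the trace over circuits and grouping the circuits by their words, the independence of
  the walks factorises every term into moments of single walks. A walk of \<open>N\<close> steps has mean \<open>0\<close>,
  variance \<open>N\<close> and \<open>p\<close>th moment of order \<open>N\<close> to the power \<open>p div 2\<close>, while Property B bounds the
  number of circuits of a word with \<open>b\<close> letters by a multiple of \<open>n\<close> to the power \<open>1 + b\<close>. Hence
  words with a single letter contribute nothing, words with every letter repeated but some letter
  used more than twice are negligible, and the pair-matched words give the limit. There are at most
  \<open>(2m)! / m!\<close> pair-matched words of length \<open>2m\<close>, so the even limit moments grow slowly enough for the
  characteristic function, and with it the law, to be determined by the moments; tightness then
  turns convergence of moments into weak convergence. The limit element is the variable of the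
  polynomial algebra, with integration against the limit law as its state.
\<close>

section \<open>The method of moments\<close>

text \<open>One inequality ranks the words. A word of length l is divided by n^(1 + l) in total;
  with b letters it has at most a constant times n^(1 + b) circuits, and its walks contribute at
  most a constant times n^e, where e is the sum of q div 2 over the multiplicities q. If every q is
  at least 2, then 1 + q div 2 <= q with equality only at q = 2, so b + e reaches l exactly for the
  pair-matched words. The moments determine the law because the (2m)! in the count of words cancels
  the one in the Taylor remainder of the characteristic function and leaves a term x^m / m!. The
  obstacle on the spectral side is that the multiset of eigenvalues does not come as a measurable
  object, and that the expected spectral distribution is not by definition the distribution function
  of a law. Only the traces of powers are known to be integrable, so measurability, the law and its
  moments are all recovered from power sums.\<close>

lemma law_with_moments_char_bound:
  assumes "law_with_moments c \<nu>" "c 0 = 1"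
  shows "cmod (char \<nu> t - (\<Sum>k \<le> 2 * m. ((\<i> * t)^k / fact k) * c k)) \<le> (2*\<bar>t\<bar>^(2 * m) / fact (2 * m)) * c (2 * m)"
proof -
  interpret real_distribution \<nu> using assms unfolding law_with_moments_def by auto
  have int: "integrable \<nu> (\<lambda>x. x ^ k)" for k
    using assms(1) unfolding law_with_moments_def by (cases k) auto
  have mom: "(\<integral>x. x ^ k \<partial>\<nu>) = c k" for k
    using assms prob_space unfolding law_with_moments_def by (cases k) auto
  \<comment> \<open>The Taylor remainder involves an absolute moment; the even order makes it an
    ordinary one, so only the prescribed numbers enter.\<close>
  have "(\<integral>x. \<bar>x\<bar> ^ (2 * m) \<partial>\<nu>) = c (2 * m)"
    using mom[of "2 * m"] by (simp add: power_mult)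
  then show ?thesis
    using char_approx1[of "2 * m" t] int mom by simp
qed

text \<open>Both characteristic functions lie within the same Taylor remainder of the same
  polynomial, and \<open>growth\<close> with h = |t| sends this remainder to 0 at every t. The value
  \<open>c 0\<close> is a separate hypothesis since \<open>law_with_moments\<close> prescribes
  moments from order 1 on.\<close>

lemma law_with_moments_unique:
  assumes law: "law_with_moments c \<nu>" "law_with_moments c \<nu>'" and c0: "c 0 = 1"
    and growth: "\<And>h. (\<lambda>m. h ^ (2 * m) / fact (2 * m) * c (2 * m)) \<longlonglongrightarrow> 0"
  shows "\<nu>' = \<nu>"
proof (rule Levy_uniqueness)
  show "real_distribution \<nu>" "real_distribution \<nu>'"
    using law unfolding law_with_moments_def by auto
  show "char \<nu>' = char \<nu>"
  proof
    fix t :: real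
    \<comment> \<open>Two remainders, each with the factor 2 of the Taylor bound.\<close>
    let ?b = "\<lambda>m. 4 * (\<bar>t\<bar> ^ (2 * m) / fact (2 * m) * c (2 * m))"
    have "cmod (char \<nu>' t - char \<nu> t) \<le> ?b m" for m
      using norm_triangle_ineq4[of "char \<nu>' t - (\<Sum>k \<le> 2 * m. ((\<i> * t)^k / fact k) * c k)"
          "char \<nu> t - (\<Sum>k \<le> 2 * m. ((\<i> * t)^k / fact k) * c k)"]
        law_with_moments_char_bound[OF law(1) c0, of t m]
        law_with_moments_char_bound[OF law(2) c0, of t m]
      by simp
    moreover have "?b \<longlonglongrightarrow> 4 * 0"
      by (intro tendsto_mult tendsto_const growth)
    ultimately have "cmod (char \<nu>' t - char \<nu> t) \<le> 4 * 0"
      by (intro LIMSEQ_le_const) auto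
    then show "char \<nu>' t = char \<nu> t" by simp
  qed
qed

section \<open>Moments of weak limits by truncation\<close>

definition clamp_real :: "real \<Rightarrow> real \<Rightarrow> real" where
  "clamp_real B x = max (- B) (min B x)"

lemma clamp_real_measurable [measurable]: "clamp_real B \<in> borel_measurable borel"
  unfolding clamp_real_def[abs_def] by measurable

lemma isCont_clamp_real: "isCont (\<lambda>x. clamp_real B x ^ l) x"
  unfolding clamp_real_def[abs_def] by (intro continuous_intros)

lemma abs_clamp_real_le: "B \<ge> 0 \<Longrightarrow> \<bar>clamp_real B x\<bar> \<le> B" "B \<ge> 0 \<Longrightarrow> \<bar>clamp_real B x\<bar> \<le> \<bar>x\<bar>"
  unfolding clamp_real_def by auto

text \<open>Inside [-B, B] the difference vanishes; outside, |x| / B exceeds 1, so its l-th power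
  can be inserted as a factor. This pays with a second copy of |x|^l for decay in B, uniformly over
  all laws with a common bound on the moment of order 2l.\<close>

lemma clamp_real_power_diff:
  assumes B: "B > 0"
  shows "\<bar>x ^ l - clamp_real B x ^ l\<bar> \<le> 2 * x ^ (2 * l) / B ^ l"
proof (cases "\<bar>x\<bar> \<le> B")
  case True
  then have "clamp_real B x = x" unfolding clamp_real_def by auto
  then show ?thesis using B by (auto intro!: divide_nonneg_pos)
next
  case False
  have "\<bar>x ^ l - clamp_real B x ^ l\<bar> \<le> \<bar>x ^ l\<bar> + \<bar>clamp_real B x ^ l\<bar>" by simp
  also have "\<dots> \<le> 2 * \<bar>x\<bar> ^ l"
    using power_mono[OF abs_clamp_real_le(2)[of B x], of l] B by (simp add: power_abs)
  also have "\<dots> \<le> 2 * \<bar>x\<bar> ^ l * (\<bar>x\<bar> / B) ^ l"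
  proof -
    have "1 \<le> (\<bar>x\<bar> / B) ^ l" using False B by (intro one_le_power) simp
    then show ?thesis using mult_left_mono[of 1 "(\<bar>x\<bar> / B) ^ l" "2 * \<bar>x\<bar> ^ l"] by simp
  qed
  also have "\<dots> = 2 * x ^ (2 * l) / B ^ l"
  proof -
    have "\<bar>x\<bar> ^ l * \<bar>x\<bar> ^ l = x ^ (2 * l)"
      by (simp add: power_mult power2_eq_square flip: power_mult_distrib)
    then show ?thesis by (simp add: power_divide)
  qed
  finally show ?thesis .
qed

lemma (in prob_space) clamp_integrable:
  assumes [measurable]: "random_variable borel f" and "B \<ge> 0"
  shows "integrable M (\<lambda>x. clamp_real B (f x) ^ l)"
  using assms by (intro integrable_const_bound[where B = "B ^ l"])
     (auto simp: power_abs intro!: power_mono abs_clamp_real_le)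

lemma (in real_distribution) clamp_expectation_diff:
  assumes "integrable M (\<lambda>x. x ^ l)" "integrable M (\<lambda>x. x ^ (2 * l))" 
    and C: "(\<integral>x. x ^ (2 * l) \<partial>M) \<le> C" and B: "B > 0"
  shows "\<bar>(\<integral>x. x ^ l \<partial>M) - (\<integral>x. clamp_real B x ^ l \<partial>M)\<bar> \<le> 2 * C / B ^ l"
proof -
  have i: "integrable M (\<lambda>x. clamp_real B x ^ l)"
    using B by (intro clamp_integrable) auto
  have "\<bar>(\<integral>x. x ^ l \<partial>M) - (\<integral>x. clamp_real B x ^ l \<partial>M)\<bar> = \<bar>\<integral>x. x ^ l - clamp_real B x ^ l \<partial>M\<bar>"
    using assms i by simp
  also have "\<dots> \<le> (\<integral>x. \<bar>x ^ l - clamp_real B x ^ l\<bar> \<partial>M)"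
    by (rule integral_abs_bound)
  also have "\<dots> \<le> (\<integral>x. 2 * x ^ (2 * l) / B ^ l \<partial>M)"
    using assms i by (intro integral_mono clamp_real_power_diff) auto
  also have "\<dots> \<le> 2 * C / B ^ l"
    using C B by (simp add: divide_right_mono)
  finally show ?thesis .
qed

text \<open>Weak convergence controls bounded continuous integrands, hence the detour through
  clamped powers. The clamping error is uniform in n because the moments of order 2l are bounded in
  n, so n goes to infinity at fixed B and B afterwards.\<close>

lemma weak_limit_law_with_moments:
  assumes rd: "\<And>n. real_distribution (M n)" "real_distribution \<nu>"
    and wc: "weak_conv_m M \<nu>"
    and int: "\<And>n k. integrable (M n) (\<lambda>x. x ^ k)"
    and lim: "\<And>k. (\<lambda>n. \<integral>x. x ^ k \<partial>M n) \<longlonglongrightarrow> c k"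
  shows "law_with_moments c \<nu>"
proof -
  interpret \<nu>: real_distribution \<nu> by fact
  interpret M: real_distribution "M n" for n by fact
  have clamp_lim: "(\<lambda>n. \<integral>x. clamp_real B x ^ l \<partial>M n) \<longlonglongrightarrow> (\<integral>x. clamp_real B x ^ l \<partial>\<nu>)"
    if "B \<ge> 0" for B l
    using rd wc isCont_clamp_real that
    by (intro weak_conv_imp_integral_bdd_continuous_conv[where B = "B ^ l"])
       (auto simp: power_abs intro!: power_mono abs_clamp_real_le)
  have "\<exists>C. \<forall>n. (\<integral>x. x ^ k \<partial>M n) \<le> C" for k
  proof -
    obtain C where "\<And>n. norm (\<integral>x. x ^ k \<partial>M n) \<le> C"
      using convergent_imp_Bseq[OF convergentI[OF lim[of k]]] unfolding Bseq_def by metis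
    then show ?thesis by (intro exI[of _ C]) (auto simp: abs_le_iff)
  qed
  then obtain C where C: "\<And>k n. (\<integral>x. x ^ k \<partial>M n) \<le> C k" by metis
  have bd: "(\<integral>\<^sup>+x. ennreal (clamp_real (real B) x ^ (2 * p)) \<partial>\<nu>) \<le> ennreal (C (2 * p))" for B :: nat and p
  proof -
    have "(\<integral>x. clamp_real B x ^ (2 * p) \<partial>\<nu>) \<le> C (2 * p)"
    proof (rule LIMSEQ_le_const2[OF clamp_lim])
      have "(\<integral>x. clamp_real B x ^ (2 * p) \<partial>M n) \<le> (\<integral>x. x ^ (2 * p) \<partial>M n)" for n
      proof (rule integral_mono[OF M.clamp_integrable int])
        fix x show "clamp_real B x ^ (2 * p) \<le> x ^ (2 * p)"
          using power_mono[OF abs_clamp_real_le(2)[of B x], of "2 * p"] by (simp add: power_mult)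
      qed auto
      then show "\<exists>N. \<forall>n\<ge>N. (\<integral>x. clamp_real (real B) x ^ (2 * p) \<partial>M n) \<le> C (2 * p)"
        using C order_trans by blast
    qed auto
    then show ?thesis
      by (subst nn_integral_eq_integral) (auto intro!: \<nu>.clamp_integrable ennreal_leI)
  qed
  \<comment> \<open>Fatou along B = 0, 1, 2, ...: at each x the clamped power is eventually equal to
    x^(2p), and its integrals stay below C (2p). Even powers keep the integrand nonnegative.\<close>
  have int\<nu>2: "integrable \<nu> (\<lambda>x. x ^ (2 * p))" for p
  proof (rule integrableI_bounded)
    have "(\<integral>\<^sup>+x. ennreal (norm (x ^ (2 * p))) \<partial>\<nu>)
       = (\<integral>\<^sup>+x. liminf (\<lambda>B. ennreal (clamp_real (real B) x ^ (2 * p))) \<partial>\<nu>)"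
    proof (rule nn_integral_cong)
      fix x :: real
      have "\<forall>\<^sub>F B in sequentially. ennreal (clamp_real (real B) x ^ (2 * p)) = ennreal (x ^ (2 * p))"
        unfolding eventually_sequentially
        by (rule exI[of _ "nat \<lceil>\<bar>x\<bar>\<rceil>"]) (auto simp: clamp_real_def min_def max_def; linarith)
      then have "(\<lambda>B. ennreal (clamp_real (real B) x ^ (2 * p))) \<longlonglongrightarrow> ennreal (x ^ (2 * p))"
        by (rule tendsto_eventually)
      from lim_imp_Liminf[OF _ this]
      show "ennreal (norm (x ^ (2 * p))) = liminf (\<lambda>B. ennreal (clamp_real (real B) x ^ (2 * p)))"
        by (simp add: power_mult)
    qed
    also have "\<dots> \<le> liminf (\<lambda>B. \<integral>\<^sup>+x. ennreal (clamp_real (real B) x ^ (2 * p)) \<partial>\<nu>)"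
      by (rule nn_integral_liminf) auto
    also have "\<dots> \<le> ennreal (C (2 * p))"
      using Liminf_le[of sequentially "\<lambda>B. \<integral>\<^sup>+x. ennreal (clamp_real (real B) x ^ (2 * p)) \<partial>\<nu>" "ennreal (C (2 * p))"] bd
      by simp
    finally show "(\<integral>\<^sup>+x. ennreal (norm (x ^ (2 * p))) \<partial>\<nu>) < \<infinity>"
      using ennreal_less_top infinity_ennreal_def le_less_trans by metis
  qed auto
  \<comment> \<open>Completing the square gives |y| <= y^2 + 1/4, so even moments control the odd
    ones.\<close>
  have aux: "\<bar>x ^ k\<bar> \<le> 1 + x ^ (2 * k)" for x :: real and k
  proof -
    have "0 \<le> (\<bar>x ^ k\<bar> - 1 / 2)\<^sup>2" by simp
    also have "\<dots> = x ^ (2 * k) - \<bar>x ^ k\<bar> + 1 / 4"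
      by (simp add: power2_diff field_simps) (simp add: power_mult)
    finally show ?thesis by simp
  qed
  have int\<nu>: "integrable \<nu> (\<lambda>x. x ^ k)" for k
    by (rule Bochner_Integration.integrable_bound[OF Bochner_Integration.integrable_add[OF \<nu>.integrable_const[of 1] int\<nu>2[of k]]])
       (use aux in \<open>auto intro!: AE_I2\<close>)
  have mom\<nu>: "(\<integral>x. x ^ l \<partial>\<nu>) = c l" if l: "l \<ge> 1" for l
  proof -
    \<comment> \<open>One bound for the moments of order 2l of every \<open>M n\<close> and of the
      limit, so that the same clamping error 2 D / B^l applies on both sides.\<close>
    define D where "D = max (C (2 * l)) (\<integral>x. x ^ (2 * l) \<partial>\<nu>)"
    have bd: "\<bar>(\<integral>x. x ^ l \<partial>\<nu>) - c l\<bar> \<le> 4 * D / B ^ l" if B: "B > 0" for B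
    proof -
      have 1: "\<bar>(\<integral>x. x ^ l \<partial>\<nu>) - (\<integral>x. clamp_real B x ^ l \<partial>\<nu>)\<bar> \<le> 2 * D / B ^ l"
        using int\<nu> B by (intro \<nu>.clamp_expectation_diff) (auto simp: D_def)
      have 2: "\<bar>(\<integral>x. x ^ l \<partial>M n) - (\<integral>x. clamp_real B x ^ l \<partial>M n)\<bar> \<le> 2 * D / B ^ l" for n
        using int B C[of n "2 * l"] by (intro M.clamp_expectation_diff) (auto simp: D_def)
      have "\<bar>c l - (\<integral>x. clamp_real B x ^ l \<partial>\<nu>)\<bar> \<le> 2 * D / B ^ l"
        by (rule LIMSEQ_le_const2[OF tendsto_rabs[OF tendsto_diff[OF lim clamp_lim]]])
           (use 2 B in auto)
      with 1 show ?thesis by linarith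
    qed
    have "(\<lambda>B. 4 * D / real (Suc B) ^ l) \<longlonglongrightarrow> 0"
    proof -
      have "(\<lambda>B. 4 * D * inverse (real (Suc B)) ^ l) \<longlonglongrightarrow> 4 * D * 0 ^ l"
        by (intro tendsto_intros LIMSEQ_inverse_real_of_nat)
      then show ?thesis using l by (simp add: field_simps power_inverse zero_power)
    qed
    then have "\<bar>(\<integral>x. x ^ l \<partial>\<nu>) - c l\<bar> \<le> 0"
      by (rule LIMSEQ_le_const) (use bd in auto)
    then show ?thesis by simp
  qed
  show ?thesis unfolding law_with_moments_def using rd int\<nu> mom\<nu> by auto
qed

lemma tight_second_moment:
  assumes rd: "\<And>n. real_distribution (M n)"
    and int: "\<And>n. integrable (M n) (\<lambda>x. x ^ 2)"
    and C: "\<And>n. (\<integral>x. x ^ 2 \<partial>M n) \<le> C"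
  shows "tight M"
  unfolding tight_def
proof (intro conjI allI impI rd)
  fix \<epsilon> :: real assume \<epsilon>: "\<epsilon> > 0"
  interpret M: real_distribution "M n" for n by fact
  \<comment> \<open>Adding 1 keeps \<open>a\<close> positive for C = 0 and makes C / a^2 strictly
    smaller than \<epsilon>.\<close>
  define a where "a = sqrt ((\<bar>C\<bar> + 1) / \<epsilon>)"
  have a: "a > 0" "a ^ 2 = (\<bar>C\<bar> + 1) / \<epsilon>" unfolding a_def using \<epsilon>
    by (auto intro!: divide_pos_pos divide_nonneg_pos add_nonneg_pos)
  have a2: "0 < a\<^sup>2" using a(1) by simp
  have "measure (M n) {-a<..a} > 1 - \<epsilon>" for n
  proof -
    have "measure (M n) {x \<in> space (M n). x ^ 2 \<ge> a ^ 2} \<le> (\<integral>x. x ^ 2 \<partial>M n) / a ^ 2"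
      using a2 int by (intro integral_Markov_inequality_measure[where A = "{}"]) auto
    also have "\<dots> \<le> C / a ^ 2" using C by (intro divide_right_mono) auto
    also have "\<dots> < \<epsilon>"
    proof -
      have "\<epsilon> * C < \<epsilon> * (\<bar>C\<bar> + 1)" using \<epsilon> by (intro mult_strict_left_mono) auto
      moreover have "\<epsilon> * a\<^sup>2 = \<bar>C\<bar> + 1" unfolding a(2) using \<epsilon> by simp
      ultimately show ?thesis using \<epsilon> a2 by (simp add: divide_less_eq)
    qed
    finally have "measure (M n) {x \<in> space (M n). x ^ 2 \<ge> a ^ 2} < \<epsilon>" .
    moreover have "measure (M n) (UNIV - {-a<..a}) \<le> measure (M n) {x \<in> space (M n). x ^ 2 \<ge> a ^ 2}"
    proof (rule M.finite_measure_mono)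
      show "UNIV - {- a<..a} \<subseteq> {x \<in> space (M n). a\<^sup>2 \<le> x\<^sup>2}"
        using a(1) by (auto simp flip: abs_le_square_iff)
    qed auto
    ultimately show ?thesis
      using M.prob_compl[of "{-a<..a}" n] by simp
  qed
  then show "\<exists>a b. a < b \<and> (\<forall>n. 1 - \<epsilon> < measure (M n) {a<..b})"
    using a(1) by (intro exI[of _ "-a"] exI[of _ a]) auto
qed

text \<open>No limit law is presupposed: tightness, from bounded second moments, yields one along a
  subsequence. Every weakly convergent subsequence has a limit with moments \<open>c\<close>, hence
  the same limit, and a tight sequence with a single subsequential limit converges.\<close>

theorem method_of_moments:
  assumes rd: "\<And>n. real_distribution (M n)"
    and int: "\<And>n k. integrable (M n) (\<lambda>x. x ^ k)"
    and lim: "\<And>k. (\<lambda>n. \<integral>x. x ^ k \<partial>M n) \<longlonglongrightarrow> c k" 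
    and growth: "\<And>h. (\<lambda>m. h ^ (2 * m) / fact (2 * m) * c (2 * m)) \<longlonglongrightarrow> 0"
  obtains \<nu> where "law_with_moments c \<nu>" "\<And>\<nu>'. law_with_moments c \<nu>' \<Longrightarrow> \<nu>' = \<nu>" "weak_conv_m M \<nu>"
proof -
  interpret M: real_distribution "M n" for n by fact
  have c0: "c 0 = 1"
    using LIMSEQ_unique[OF lim[of 0]] M.prob_space by simp
  obtain K :: real where "\<And>n. norm (\<integral>x. x ^ 2 \<partial>M n) \<le> K"
    using BseqE[OF convergent_imp_Bseq[OF convergentI[OF lim[of 2]]]] by blast
  then have tight: "tight M"
    using int by (intro tight_second_moment[where C = K, OF rd]) (auto simp: abs_le_iff)
  have sub: "law_with_moments c \<nu>" if "strict_mono s" "real_distribution \<nu>" "weak_conv_m (M \<circ> s) \<nu>" for s \<nu>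
    using that rd int LIMSEQ_subseq_LIMSEQ[OF lim that(1)]
    by (intro weak_limit_law_with_moments[of "M \<circ> s"]) (auto simp: o_def)
  obtain r \<nu> where r: "strict_mono r" "real_distribution \<nu>" "weak_conv_m (M \<circ> r) \<nu>"
    using tight_imp_convergent_subsubsequence[OF tight strict_mono_id] by auto
  have law: "law_with_moments c \<nu>" using sub r .
  have uniq: "\<nu>' = \<nu>" if "law_with_moments c \<nu>'" for \<nu>'
    using law_with_moments_unique[OF law that c0 growth] .
  have "weak_conv_m M \<nu>"
    using sub uniq by (intro tight_subseq_weak_converge[OF rd r(2) tight]) blast
  then show thesis using that law uniq by blast
qed

section \<open>Words and their circuits\<close>

definition words :: "nat \<Rightarrow> nat list set" where
  "words l = {w. is_word w \<and> length w = l}"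

text \<open>A fresh letter equals the number of letters already used. If these form an initial
  segment of the naturals, that number is the least one missing, so the next prefix again uses an
  initial segment.\<close>

lemma is_word_set_take:
  assumes "is_word w" "k \<le> length w"
  shows "set (take k w) = {..<card (set (take k w))}"
  using assms(2)
proof (induction k)
  case (Suc k)
  then have IH: "set (take k w) = {..<card (set (take k w))}" by simp
  have S: "set (take (Suc k) w) = insert (w ! k) (set (take k w))"
    using Suc.prems by (simp add: take_Suc_conv_app_nth)
  show ?case
  proof (cases "w ! k \<in> set (take k w)")
    case True
    then have "set (take (Suc k) w) = set (take k w)" using S by auto
    then show ?thesis using IH by metis
  next
    case False
    then have "w ! k = card (set (take k w))"
      using assms(1) Suc.prems unfolding is_word_def by auto
    then have "set (take (Suc k) w) = {..<Suc (card (set (take k w)))}"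
      using S IH by (auto simp: lessThan_Suc)
    then show ?thesis by simp
  qed
qed simp

lemma is_word_set: "is_word w \<Longrightarrow> set w = {..<card (set w)}"
  using is_word_set_take[of w "length w"] by simp

lemma finite_words: "finite (words l)"
proof (rule finite_subset)
  show "words l \<subseteq> {w. set w \<subseteq> {..l} \<and> length w = l}"
  proof
    fix w assume "w \<in> words l"
    then have w: "is_word w" "length w = l" unfolding words_def by auto
    have "a < card (set w)" if "a \<in> set w" for a
      using that by (subst (asm) is_word_set[OF w(1)]) simp
    moreover have "card (set w) \<le> l" using card_length[of w] w by simp
    ultimately show "w \<in> {w. set w \<subseteq> {..l} \<and> length w = l}" using w by force
  qed
  show "finite {w. set w \<subseteq> {..l} \<and> length w = l}"
    by (intro finite_lists_length_eq) auto
qed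

lemma pair_words_eq: "pair_words l = {w \<in> words l. pair_matched w}"
  unfolding pair_words_def words_def by auto

text \<open>Both lists induce the same partition of the positions into classes of equal entries. The
  types may differ, so that a word can be compared with the list of lattice points along a
  circuit.\<close>

definition same_pattern :: "'a list \<Rightarrow> 'b list \<Rightarrow> bool" where
  "same_pattern v w \<longleftrightarrow> length v = length w \<and>
     (\<forall>i<length w. \<forall>j<length w. v ! i = v ! j \<longleftrightarrow> w ! i = w ! j)"

text \<open>Words are normal forms of patterns: at each position the pattern decides whether the
  letter repeats an earlier one, and the prefix then fixes which letter stands there.\<close>

lemma is_word_unique:
  assumes "is_word v" "is_word w" "same_pattern v w"
  shows "v = w"
proof -
  have len: "length v = length w" using assms(3) unfolding same_pattern_def by simp
  have "take k v = take k w" if "k \<le> length w" for k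
    using that
  proof (induction k)
    case (Suc k)
    then have IH: "take k v = take k w" and k: "k < length w" by auto
    have mem: "v ! k \<in> set (take k v) \<longleftrightarrow> (\<exists>j<k. v ! k = v ! j)" "w ! k \<in> set (take k w) \<longleftrightarrow> (\<exists>j<k. w ! k = w ! j)"
      using k len by (auto simp: in_set_conv_nth)
    have "v ! k = w ! k"
    proof (cases "\<exists>j<k. w ! k = w ! j")
      case True
      then obtain j where j: "j < k" "w ! k = w ! j" by auto
      then have "v ! k = v ! j" using assms(3) k unfolding same_pattern_def by auto
      moreover have "v ! j = w ! j" using IH j(1) by (metis nth_take)
      ultimately show ?thesis using j by simp
    next
      case False
      then have "\<not> (\<exists>j<k. v ! k = v ! j)" using assms(3) k unfolding same_pattern_def by auto
      then show ?thesis using False mem assms(1,2) k len IH unfolding is_word_def by metis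
    qed
    then show ?case using IH k len by (simp add: take_Suc_conv_app_nth)
  qed simp
  from this[of "length w"] show ?thesis using len by simp
qed

text \<open>An entry is renamed to the number of distinct entries before its first occurrence; this
  is the normal form of the pattern of \<open>xs\<close>.\<close>

definition word_of :: "'a list \<Rightarrow> nat list" where
  "word_of xs = map (\<lambda>x. card (set (takeWhile (\<lambda>y. y \<noteq> x) xs))) xs"

text \<open>The sets of entries before two first occurrences are nested, and strictly so if the
  positions differ, since the larger set contains the entry that occurs first. Equal cardinality
  thus forces equal first positions.\<close>

lemma takeWhile_card_inj:
  assumes "x \<in> set xs" "y \<in> set xs"
    "card (set (takeWhile (\<lambda>z. z \<noteq> x) xs)) = card (set (takeWhile (\<lambda>z. z \<noteq> y) xs))"
  shows "x = y"
proof (rule ccontr)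
  assume xy: "x \<noteq> y"
  have aux: False if "length (takeWhile (\<lambda>z. z \<noteq> x) xs) < length (takeWhile (\<lambda>z. z \<noteq> y) xs)"
    "x \<in> set xs" "y \<in> set xs" 
    "card (set (takeWhile (\<lambda>z. z \<noteq> x) xs)) = card (set (takeWhile (\<lambda>z. z \<noteq> y) xs))" for x y :: 'a
  proof -
    let ?p = "length (takeWhile (\<lambda>z. z \<noteq> x) xs)" and ?q = "length (takeWhile (\<lambda>z. z \<noteq> y) xs)"
    have P: "takeWhile (\<lambda>z. z \<noteq> x) xs = take ?p xs" "takeWhile (\<lambda>z. z \<noteq> y) xs = take ?q xs"
      by (simp_all flip: takeWhile_eq_take)
    have "?p < length xs" using that(1) length_takeWhile_le[of "\<lambda>z. z \<noteq> y" xs] by linarith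
    then have "xs ! ?p = x" using nth_length_takeWhile by fastforce
    then have "x \<in> set (take ?q xs)" using that(1) \<open>?p < length xs\<close> by (force simp: in_set_conv_nth)
    moreover have "x \<notin> set (take ?p xs)" using P(1) set_takeWhileD[of x "\<lambda>z. z \<noteq> x" xs] by metis
    moreover have "set (take ?p xs) \<subseteq> set (take ?q xs)"
      using that(1) by (intro set_take_subset_set_take) auto
    ultimately have "set (take ?p xs) \<subset> set (take ?q xs)" by auto
    then have "card (set (take ?p xs)) < card (set (take ?q xs))" by (intro psubset_card_mono) auto
    then show False using that(4) P by simp
  qed
  have len_tw: "x \<in> set xs \<Longrightarrow> length (takeWhile (\<lambda>z. z \<noteq> x) xs) < length xs" for x :: 'a
    by (induction xs) auto
  show False
  proof (cases "length (takeWhile (\<lambda>z. z \<noteq> x) xs)" "length (takeWhile (\<lambda>z. z \<noteq> y) xs)" rule: linorder_cases)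
    case equal
    have "xs ! length (takeWhile (\<lambda>z. z \<noteq> x) xs) = x"
      using nth_length_takeWhile[OF len_tw[OF assms(1)]] by simp
    moreover have "xs ! length (takeWhile (\<lambda>z. z \<noteq> y) xs) = y"
      using nth_length_takeWhile[OF len_tw[OF assms(2)]] by simp
    ultimately show False using equal xy by simp
  qed (use aux[of x y] aux[of y x] assms in auto)
qed

lemma word_of_same_pattern: "same_pattern (word_of xs) xs"
  unfolding same_pattern_def
proof (intro conjI allI impI)
  show "length (word_of xs) = length xs" by (simp add: word_of_def)
  fix i j assume ij: "i < length xs" "j < length xs"
  have nth: "word_of xs ! i = card (set (takeWhile (\<lambda>z. z \<noteq> xs ! i) xs))"
    "word_of xs ! j = card (set (takeWhile (\<lambda>z. z \<noteq> xs ! j) xs))"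
    using ij by (simp_all add: word_of_def)
  show "word_of xs ! i = word_of xs ! j \<longleftrightarrow> xs ! i = xs ! j"
  proof
    assume "word_of xs ! i = word_of xs ! j"
    then show "xs ! i = xs ! j"
      unfolding nth by (rule takeWhile_card_inj[OF nth_mem[OF ij(1)] nth_mem[OF ij(2)]])
  qed (simp add: nth)
qed

text \<open>Positions mediate a bijection between the two sets of entries; \<open>SOME\<close> picks
  any position of an entry, and the common pattern makes the choice immaterial.\<close>

lemma card_set_take_same_pattern:
  assumes "same_pattern v w"
  shows "card (set (take k v)) = card (set (take k w))"
proof -
  define k' where "k' = min k (length w)"
  have eq: "take k v = take k' v" "take k w = take k' w" and k': "k' \<le> length w"
    using assms unfolding k'_def same_pattern_def by (auto simp: min_def)
  have sets: "set (take k' v) = (\<lambda>i. v ! i) ` {..<k'}" "set (take k' w) = (\<lambda>i. w ! i) ` {..<k'}"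
    using k' assms unfolding same_pattern_def
    by (auto simp: nth_image[symmetric] lessThan_atLeast0)
  have "bij_betw (\<lambda>x. w ! (SOME i. i < k' \<and> v ! i = x)) (set (take k' v)) (set (take k' w))"
    unfolding sets
  proof (rule bij_betw_imageI)
    have S: "(SOME j. j < k' \<and> v ! j = v ! i) < k'" "v ! (SOME j. j < k' \<and> v ! j = v ! i) = v ! i" if "i < k'" for i
      using someI[of "\<lambda>j. j < k' \<and> v ! j = v ! i" i] that by auto
    have W: "w ! (SOME j. j < k' \<and> v ! j = v ! i) = w ! i" if "i < k'" for i
      using S[OF that] assms k' that unfolding same_pattern_def by (meson order_less_le_trans)
    show "inj_on (\<lambda>x. w ! (SOME i. i < k' \<and> v ! i = x)) ((!) v ` {..<k'})"
    proof (rule inj_onI, clarify)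
      fix i j assume ij: "i < k'" "j < k'"
        and "w ! (SOME ia. ia < k' \<and> v ! ia = v ! i) = w ! (SOME i. i < k' \<and> v ! i = v ! j)"
      then have "w ! i = w ! j" using W by simp
      then show "v ! i = v ! j" using ij assms k' unfolding same_pattern_def by auto
    qed
    show "(\<lambda>x. w ! (SOME i. i < k' \<and> v ! i = x)) ` (!) v ` {..<k'} = (!) w ` {..<k'}"
      unfolding image_image by (rule image_cong) (use W in auto)
  qed
  then show ?thesis using eq bij_betw_same_card by metis
qed

text \<open>A letter not seen before sits at the first occurrence of its entry, where
  \<open>takeWhile\<close> returns exactly the first i entries.\<close>

lemma is_word_word_of: "is_word (word_of xs)"
  unfolding is_word_def
proof (intro allI impI)
  fix i assume i: "i < length (word_of xs)" "word_of xs ! i \<notin> set (take i (word_of xs))"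
  have i': "i < length xs" using i(1) by (simp add: word_of_def)
  have "xs ! j \<noteq> xs ! i" if "j < i" for j
  proof
    assume "xs ! j = xs ! i"
    then have "word_of xs ! j = word_of xs ! i"
      using that i' by (simp add: word_of_def)
    then show False using i that by (auto simp: in_set_conv_nth)
  qed
  then have "takeWhile (\<lambda>y. y \<noteq> xs ! i) xs = take i xs"
    using i' by (intro takeWhile_eq_take_P_nth) auto
  then have "word_of xs ! i = card (set (take i xs))"
    using i' by (simp add: word_of_def)
  then show "word_of xs ! i = card (set (take i (word_of xs)))"
    using card_set_take_same_pattern[OF word_of_same_pattern[of xs]] by simp
qed

section \<open>Circuits sorted by their words\<close>

definition link_seq :: "(nat \<Rightarrow> nat \<Rightarrow> nat \<Rightarrow> nat list) \<Rightarrow> nat \<Rightarrow> nat \<Rightarrow> (nat \<Rightarrow> nat) \<Rightarrow> nat list list" where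
  "link_seq L n l \<pi> = map (\<lambda>i. L n (\<pi> i) (\<pi> (Suc i))) [0..<l]"

text \<open>Renumbering the steps from 0 to l - 1 turns the condition on a circuit into equality of
  patterns, to which the normal form of words applies.\<close>

lemma word_circuits_altdef:
  "word_circuits L n w = {\<pi> \<in> circuits n (length w). same_pattern w (link_seq L n (length w) \<pi>)}"
proof -
  have "(\<forall>i\<in>{1..l}. \<forall>j\<in>{1..l}. P (i - 1) (j - 1) i j) \<longleftrightarrow> (\<forall>i<l. \<forall>j<l. P i j (Suc i) (Suc j))" 
    for P :: "nat \<Rightarrow> nat \<Rightarrow> nat \<Rightarrow> nat \<Rightarrow> bool" and l
  proof
    assume A: "\<forall>i\<in>{1..l}. \<forall>j\<in>{1..l}. P (i - 1) (j - 1) i j"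
    show "\<forall>i<l. \<forall>j<l. P i j (Suc i) (Suc j)"
      using A by (auto dest!: bspec[of _ _ "Suc _"])
  next
    assume A: "\<forall>i<l. \<forall>j<l. P i j (Suc i) (Suc j)"
    show "\<forall>i\<in>{1..l}. \<forall>j\<in>{1..l}. P (i - 1) (j - 1) i j"
    proof (intro ballI)
      fix i j assume "i \<in> {1..l}" "j \<in> {1..l}"
      then show "P (i - 1) (j - 1) i j" using A[rule_format, of "i - 1" "j - 1"] by auto
    qed
  qed
  then have "(\<forall>i\<in>{1..length w}. \<forall>j\<in>{1..length w}.
          w ! (i - 1) = w ! (j - 1) \<longleftrightarrow> L n (\<pi> (i - 1)) (\<pi> i) = L n (\<pi> (j - 1)) (\<pi> j))
     \<longleftrightarrow> same_pattern w (link_seq L n (length w) \<pi>)" for \<pi>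
    unfolding same_pattern_def link_seq_def by simp
  then show ?thesis unfolding word_circuits_def by simp
qed

lemma finite_circuits: "finite (circuits n l)"
proof (rule finite_subset)
  show "circuits n l \<subseteq> {0..l} \<rightarrow>\<^sub>E {1..n}" unfolding circuits_def by auto
qed (intro finite_PiE; simp)

lemma finite_word_circuits: "finite (word_circuits L n w)"
  unfolding word_circuits_def using finite_circuits by auto

lemma circuits_partition: "circuits n l = (\<Union>w\<in>words l. word_circuits L n w)"
proof
  show "circuits n l \<subseteq> (\<Union>w\<in>words l. word_circuits L n w)"
  proof
    fix \<pi> assume "\<pi> \<in> circuits n l"
    then show "\<pi> \<in> (\<Union>w\<in>words l. word_circuits L n w)"
      using is_word_word_of[of "link_seq L n l \<pi>"] word_of_same_pattern[of "link_seq L n l \<pi>"]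
      by (intro UN_I[of "word_of (link_seq L n l \<pi>)"])
         (auto simp: words_def word_circuits_altdef word_of_def link_seq_def)
  qed
qed (auto simp: words_def word_circuits_def)

lemma same_pattern_sym: "same_pattern v w \<Longrightarrow> same_pattern w v"
  unfolding same_pattern_def by auto

lemma same_pattern_trans: "same_pattern u v \<Longrightarrow> same_pattern v w \<Longrightarrow> same_pattern u w"
  unfolding same_pattern_def by auto

text \<open>The classes are disjoint because a circuit has one pattern and a pattern has one
  word.\<close>

lemma sum_circuits_by_word:
  fixes f :: "(nat \<Rightarrow> nat) \<Rightarrow> 'b::comm_monoid_add"
  shows "(\<Sum>\<pi>\<in>circuits n l. f \<pi>) = (\<Sum>w\<in>words l. \<Sum>\<pi>\<in>word_circuits L n w. f \<pi>)"
  unfolding circuits_partition[of n l L]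
proof (rule sum.UNION_disjoint[OF finite_words])
  show "\<forall>w\<in>words l. finite (word_circuits L n w)" by (simp add: finite_word_circuits)
  show "\<forall>v\<in>words l. \<forall>w\<in>words l. v \<noteq> w \<longrightarrow> word_circuits L n v \<inter> word_circuits L n w = {}"
  proof (intro ballI impI equals0I)
    fix v w \<pi> assume A: "v \<in> words l" "w \<in> words l" "v \<noteq> w" "\<pi> \<in> word_circuits L n v \<inter> word_circuits L n w"
    have len: "length v = l" "length w = l" and word: "is_word v" "is_word w"
      using A(1,2) unfolding words_def by auto
    have "same_pattern v (link_seq L n l \<pi>)" "same_pattern w (link_seq L n l \<pi>)"
      using A(4) len unfolding word_circuits_altdef by auto
    then have "same_pattern v w"
      by (meson same_pattern_trans same_pattern_sym)
    then show False using A(3) is_word_unique[OF word] by simp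
  qed
qed

text \<open>Along a circuit, a step that repeats a letter leaves at most \<open>K\<close> choices for the next vertex,
  a step with a new letter at most \<open>n\<close>.\<close>

lemma card_word_circuits_le:
  assumes link: "link_function d L" and
    K: "\<And>n r i. r \<in> lattice_points d \<Longrightarrow> i \<in> {1..n} \<Longrightarrow> card {j\<in>{1..n}. L n i j = r} \<le> K"
    and K1: "K \<ge> 1"
  shows "card (word_circuits L n w) \<le> n ^ (1 + card (set w)) * K ^ length w"
proof -
  \<comment> \<open>Closedness is dropped and only the forward half of the pattern condition is
    kept. The resulting larger family is stable under removal of the last vertex, which the
    induction on the number of steps requires.\<close>
  define paths where "paths k = {p. length p = Suc k \<and> set p \<subseteq> {1..n} \<and>
     (\<forall>i<k. \<forall>j<k. w ! i = w ! j \<longrightarrow> L n (p ! i) (p ! Suc i) = L n (p ! j) (p ! Suc j))}" for k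
  have fin: "finite (paths k)" for k
    by (rule finite_subset[OF _ finite_lists_length_eq[of "{1..n}" "Suc k"]]) (auto simp: paths_def)
  have paths_le: "card (paths k) \<le> n ^ (1 + card (set (take k w))) * K ^ k" if "k \<le> length w" for k
    using that
  proof (induction k)
    case 0
    have "paths 0 = (\<lambda>x. [x]) ` {1..n}" 
      unfolding paths_def by (auto simp: length_Suc_conv)
    then show ?case by (simp add: card_image inj_on_def)
  next
    case (Suc k)
    define ext where "ext p = {x. p @ [x] \<in> paths (Suc k)}" for p
    have ext_sub: "ext p \<subseteq> {1..n}" for p unfolding ext_def paths_def by auto
    have cover: "paths (Suc k) \<subseteq> (\<lambda>(p, x). p @ [x]) ` (SIGMA p:paths k. ext p)"
    proof
      fix q assume q: "q \<in> paths (Suc k)"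
      then have "length q = Suc (Suc k)" unfolding paths_def by blast
      then have "q \<noteq> []" by auto
      then obtain p x where px: "q = p @ [x]" by (metis rev_exhaust)
      have "L n (p ! i) (p ! Suc i) = L n (p ! j) (p ! Suc j)" if "i < k" "j < k" "w ! i = w ! j" for i j
      proof -
        have "\<forall>i<Suc k. \<forall>j<Suc k. w ! i = w ! j \<longrightarrow> L n (q ! i) (q ! Suc i) = L n (q ! j) (q ! Suc j)"
          using q unfolding paths_def by blast
        then have "L n (q ! i) (q ! Suc i) = L n (q ! j) (q ! Suc j)"
          using that by (meson less_SucI)
        moreover have "length q = Suc (Suc k)" using q unfolding paths_def by blast
        then have "length p = Suc k" using px by simp
        ultimately show ?thesis using that px by (simp add: nth_append)
      qed
      moreover have "length q = Suc (Suc k)" "set q \<subseteq> {1..n}" using q unfolding paths_def by blast+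
      then have "length p = Suc k" "set p \<subseteq> {1..n}" using px by auto
      ultimately have "p \<in> paths k" unfolding paths_def by blast
      moreover have "x \<in> ext p" using q px unfolding ext_def by simp
      ultimately show "q \<in> (\<lambda>(p, x). p @ [x]) ` (SIGMA p:paths k. ext p)"
        unfolding px by (intro image_eqI[of _ _ "(p, x)"]) auto
    qed
    have "card (paths (Suc k)) \<le> card (SIGMA p:paths k. ext p)"
      using fin ext_sub finite_subset[OF ext_sub]
      by (intro surj_card_le[OF _ cover]) auto
    also have "\<dots> = (\<Sum>p\<in>paths k. card (ext p))"
      using fin finite_subset[OF ext_sub] by (intro card_SigmaI) auto
    finally have le: "card (paths (Suc k)) \<le> (\<Sum>p\<in>paths k. card (ext p))" .
    have S: "set (take (Suc k) w) = insert (w ! k) (set (take k w))"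
      using Suc.prems by (simp add: take_Suc_conv_app_nth)
    show ?case
    proof (cases "w ! k \<in> set (take k w)")
      case True
      then obtain j where j: "j < k" "w ! k = w ! j" by (auto simp: in_set_conv_nth)
      have "card (ext p) \<le> K" if p: "p \<in> paths k" for p
      proof -
        have len: "length p = Suc k" and sub: "set p \<subseteq> {1..n}" using p unfolding paths_def by blast+
        then have mem: "p ! i \<in> {1..n}" if "i \<le> k" for i 
          using that nth_mem[of i p] by (intro subsetD[OF sub]) simp
        \<comment> \<open>As j < k, the earlier step ends at a vertex of p, so its link value is
          fixed before x is chosen and Property B applies at the current vertex
          \<open>p ! k\<close>.\<close>
        have "ext p \<subseteq> {x\<in>{1..n}. L n (p ! k) x = L n (p ! j) (p ! Suc j)}"
        proof
          fix x assume x: "x \<in> ext p"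
          then have "\<forall>i<Suc k. \<forall>j<Suc k. w ! i = w ! j \<longrightarrow>
              L n ((p @ [x]) ! i) ((p @ [x]) ! Suc i) = L n ((p @ [x]) ! j) ((p @ [x]) ! Suc j)"
            unfolding ext_def paths_def by blast
          then have "L n ((p @ [x]) ! k) ((p @ [x]) ! Suc k) = L n ((p @ [x]) ! j) ((p @ [x]) ! Suc j)"
            using j by (meson less_Suc_eq)
          then have "L n (p ! k) x = L n (p ! j) (p ! Suc j)"
            using len j by (simp add: nth_append)
          then show "x \<in> {x\<in>{1..n}. L n (p ! k) x = L n (p ! j) (p ! Suc j)}"
            using x subsetD[OF ext_sub x] by simp
        qed
        then have "card (ext p) \<le> card {x\<in>{1..n}. L n (p ! k) x = L n (p ! j) (p ! Suc j)}"
          by (intro card_mono) auto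
        also have "\<dots> \<le> K"
          using mem j link by (intro K) (auto simp: link_function_def)
        finally show ?thesis .
      qed
      then have "(\<Sum>p\<in>paths k. card (ext p)) \<le> card (paths k) * K"
        using sum_bounded_above[of "paths k" "\<lambda>p. card (ext p)" K] by simp
      also have "\<dots> \<le> n ^ (1 + card (set (take k w))) * K ^ k * K"
        using Suc by (intro mult_right_mono) auto
      also have "\<dots> = n ^ (1 + card (set (take (Suc k) w))) * K ^ Suc k"
        using S True by (simp add: insert_absorb mult_ac)
      finally show ?thesis using le by linarith
    next
      case False
      have "card (ext p) \<le> n" for p using card_mono[OF _ ext_sub[of p]] by simp
      then have "(\<Sum>p\<in>paths k. card (ext p)) \<le> card (paths k) * n"
        using sum_bounded_above[of "paths k" "\<lambda>p. card (ext p)" n] by simp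
      also have "\<dots> \<le> n ^ (1 + card (set (take k w))) * K ^ k * n"
        using Suc by (intro mult_right_mono) auto
      also have "\<dots> = n ^ (1 + card (set (take (Suc k) w))) * K ^ k"
        using S False by simp
      \<comment> \<open>A new letter produces no factor K; inserting one by K >= 1 keeps the
        exponent equal to the number of steps.\<close>
      also have "\<dots> \<le> n ^ (1 + card (set (take (Suc k) w))) * K ^ Suc k"
        using K1 by (intro mult_left_mono power_increasing) auto
      finally show ?thesis using le by linarith
    qed
  qed
  define l where "l = length w"
  have "card (word_circuits L n w) \<le> card (paths l)"
  proof (rule card_inj_on_le[OF _ _ fin])
    show "inj_on (\<lambda>\<pi>. map \<pi> [0..<Suc l]) (word_circuits L n w)"
    proof (rule inj_onI)
      fix \<pi> \<sigma> assume A: "\<pi> \<in> word_circuits L n w" "\<sigma> \<in> word_circuits L n w"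
        "map \<pi> [0..<Suc l] = map \<sigma> [0..<Suc l]"
      then have "\<pi> \<in> {0..l} \<rightarrow>\<^sub>E {1..n}" "\<sigma> \<in> {0..l} \<rightarrow>\<^sub>E {1..n}"
        unfolding word_circuits_def circuits_def l_def by auto
      then show "\<pi> = \<sigma>"
      proof (rule PiE_ext)
        fix i assume "i \<in> {0..l}"
        then show "\<pi> i = \<sigma> i" using A(3) by (simp del: upt_Suc)
      qed
    qed
    show "(\<lambda>\<pi>. map \<pi> [0..<Suc l]) ` word_circuits L n w \<subseteq> paths l"
    proof
      fix q assume "q \<in> (\<lambda>\<pi>. map \<pi> [0..<Suc l]) ` word_circuits L n w"
      then obtain \<pi> where q: "q = map \<pi> [0..<Suc l]" and \<pi>: "\<pi> \<in> word_circuits L n w" by auto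
      have "\<pi> \<in> {0..l} \<rightarrow>\<^sub>E {1..n}" using \<pi> unfolding word_circuits_def circuits_def l_def by auto
      then have "set q \<subseteq> {1..n}" unfolding q by (auto simp del: upt_Suc simp: PiE_iff less_Suc_eq_le)
      moreover have "L n (q ! i) (q ! Suc i) = L n (q ! j) (q ! Suc j)" if "i < l" "j < l" "w ! i = w ! j" for i j
      proof -
        have "same_pattern w (link_seq L n l \<pi>)" using \<pi> unfolding word_circuits_altdef l_def by simp
        then have "link_seq L n l \<pi> ! i = link_seq L n l \<pi> ! j" using that
          unfolding same_pattern_def l_def link_seq_def by auto
        then show ?thesis using that unfolding q link_seq_def by (simp del: upt_Suc)
      qed
      moreover have "length q = Suc l" unfolding q by simp
      ultimately show "q \<in> paths l" unfolding paths_def by blast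
    qed
  qed
  also have "\<dots> \<le> n ^ (1 + card (set (take l w))) * K ^ l"
    by (rule paths_le) (simp add: l_def)
  finally show ?thesis by (simp add: l_def)
qed

lemma pair_matched_length: "pair_matched w \<Longrightarrow> length w = 2 * card (set w)"
  using sum_count_set[of w "set w"] unfolding pair_matched_def by simp

text \<open>Renaming the letters of a pair-matched word in all \<open>m!\<close> ways gives distinct rearrangements of
  one multiset of \<open>2 m\<close> letters.\<close>

lemma card_pair_words_le: "card (pair_words (2 * m)) * fact m \<le> fact (2 * m)"
proof -
  let ?M = "mset ([0..<m] @ [0..<m])"
  have W: "is_word w" "length w = 2 * m" "set w = {..<m}" "\<And>a. a < m \<Longrightarrow> count_list w a = 2"
    if "w \<in> pair_words (2 * m)" for w
  proof -
    show w: "is_word w" "length w = 2 * m" using that unfolding pair_words_def by auto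
    have pm: "pair_matched w" using that unfolding pair_words_def by auto
    then have "card (set w) = m" using pair_matched_length w(2) by fastforce
    then show s: "set w = {..<m}" using is_word_set[OF w(1)] by simp
    show "count_list w a = 2" if "a < m" for a using pm s that unfolding pair_matched_def by auto
  qed
  have "card (pair_words (2 * m) \<times> {\<sigma>. \<sigma> permutes {..<m}}) \<le> card (permutations_of_multiset ?M)"
  proof (rule card_inj_on_le)
    show "inj_on (\<lambda>(w, \<sigma>). map \<sigma> w) (pair_words (2 * m) \<times> {\<sigma>. \<sigma> permutes {..<m}})"
    proof (rule inj_onI, clarify)
      fix v \<sigma> w \<tau>
      assume A: "v \<in> pair_words (2 * m)" "w \<in> pair_words (2 * m)" 
        "\<sigma> permutes {..<m}" "\<tau> permutes {..<m}" "map \<sigma> v = map \<tau> w"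
      have nth: "\<sigma> (v ! i) = \<tau> (w ! i)" if "i < 2 * m" for i
        using A(5) W(2)[OF A(1)] W(2)[OF A(2)] that by (metis nth_map)
      \<comment> \<open>Injective renamings do not change the pattern, so the image list determines
        the word. The renaming is then read off on the letters, all of which occur.\<close>
      have "same_pattern v w"
        unfolding same_pattern_def W(2)[OF A(1)] W(2)[OF A(2)]
        using nth permutes_inj[OF A(3)] permutes_inj[OF A(4)] by (metis injD)
      then have vw: "v = w" using is_word_unique W(1) A by blast
      have "\<sigma> x = \<tau> x" for x
      proof (cases "x < m")
        case True
        then have "x \<in> set w" using W(3)[OF A(2)] by simp
        then obtain i where "i < length w" "x = w ! i" by (metis in_set_conv_nth)
        then show ?thesis using nth[of i] vw W(2)[OF A(2)] by simp
      next
        case False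
        then show ?thesis using A(3,4) by (auto simp: permutes_def)
      qed
      then show "v = w \<and> \<sigma> = \<tau>" using vw by auto
    qed
    show "(\<lambda>(w, \<sigma>). map \<sigma> w) ` (pair_words (2 * m) \<times> {\<sigma>. \<sigma> permutes {..<m}}) \<subseteq> permutations_of_multiset ?M"
    proof clarify
      fix w \<sigma> assume A: "w \<in> pair_words (2 * m)" "\<sigma> permutes {..<m}"
      have "mset w = ?M"
      proof (rule multiset_eqI)
        fix a show "count (mset w) a = count ?M a"
        proof (cases "a < m")
          case True
          then have "count (mset [0..<m]) a = 1"
            by (intro distinct_count_atmost_1[THEN iffD1, THEN spec, THEN trans]) auto
          then show ?thesis using W(4)[OF A(1) True] by (simp add: count_mset)
        next
          case False
          then have "a \<notin># mset w" "a \<notin># ?M" using W(3)[OF A(1)] by auto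
          then show ?thesis by (metis not_in_iff)
        qed
      qed
      moreover have "image_mset \<sigma> (mset [0..<m]) = mset [0..<m]"
        using permutes_image_mset[of \<sigma> "{..<m}"] A(2)
        by (simp add: mset_upt atLeast0LessThan)
      ultimately show "map \<sigma> w \<in> permutations_of_multiset ?M"
        by (simp add: permutations_of_multiset_def)
    qed
  qed simp
  \<comment> \<open>The exact number is (2m)! / 2^m; the geometric factor is given away, as the
    later growth estimate lives on the m! alone.\<close>
  moreover have "card (permutations_of_multiset ?M) \<le> fact (2 * m)"
    by (subst card_permutations_of_multiset) (simp add: mult_2)
  moreover have "card {\<sigma>. \<sigma> permutes {..<m}} = fact m"
    by (subst card_permutations[of _ m]) auto
  ultimately show ?thesis by (simp add: card_cartesian_product)
qed

section \<open>Moments of walks\<close>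

text \<open>Norm moments of all natural orders; \<open>all_moments_eq\<close> compares them with
  real exponents. The type is general so that the real walks and the complex matrix entries share
  the closure lemmas.\<close>

definition has_moments :: "'w measure \<Rightarrow> ('w \<Rightarrow> 'b::{real_normed_field, second_countable_topology, banach}) \<Rightarrow> bool" where
  "has_moments P f \<longleftrightarrow> f \<in> borel_measurable P \<and> (\<forall>p::nat. integrable P (\<lambda>\<omega>. norm (f \<omega>) ^ p))"

lemma has_moments_measurable [measurable_dest]: "has_moments P f \<Longrightarrow> f \<in> borel_measurable P"
  unfolding has_moments_def by simp

lemma has_momentsI:
  assumes "f \<in> borel_measurable P" "\<And>p. integrable P (g p)" "\<And>p \<omega>. norm (f \<omega>) ^ p \<le> g p \<omega>"
  shows "has_moments P f"
  unfolding has_moments_def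
proof (intro conjI allI)
  fix p
  show "integrable P (\<lambda>\<omega>. norm (f \<omega>) ^ p)"
  proof (rule Bochner_Integration.integrable_bound[OF assms(2)[of p]])
    show "AE \<omega> in P. norm (norm (f \<omega>) ^ p) \<le> norm (g p \<omega>)"
      using assms(3) by (auto intro!: AE_I2 order_trans[OF _ abs_ge_self])
  qed (use assms(1) in measurable)
qed fact

lemma has_moments_integrable_norm_power: "has_moments P f \<Longrightarrow> integrable P (\<lambda>\<omega>. norm (f \<omega>) ^ p)"
  unfolding has_moments_def by simp

lemma has_moments_integrable_power: "has_moments P f \<Longrightarrow> integrable P (\<lambda>\<omega>. f \<omega> ^ p)"
  by (rule Bochner_Integration.integrable_bound[OF has_moments_integrable_norm_power[of P f p]])
     (auto simp: norm_power)

lemma has_moments_integrable: "has_moments P f \<Longrightarrow> integrable P f"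
  using has_moments_integrable_power[of P f 1] by simp

lemma (in finite_measure) has_moments_const: "has_moments M (\<lambda>_. c)"
  unfolding has_moments_def by simp

lemma has_moments_add:
  assumes f: "has_moments P f" and g: "has_moments P g"
  shows "has_moments P (\<lambda>\<omega>. f \<omega> + g \<omega>)"
proof (rule has_momentsI)
  fix p \<omega>
  let ?m = "max (norm (f \<omega>)) (norm (g \<omega>))"
  have "norm (f \<omega> + g \<omega>) ^ p \<le> (2 * ?m) ^ p"
    by (intro power_mono order_trans[OF norm_triangle_ineq]) auto
  also have "\<dots> \<le> 2 ^ p * (norm (f \<omega>) ^ p + norm (g \<omega>) ^ p)"
    by (auto simp: power_mult_distrib max_def)
  finally show "norm (f \<omega> + g \<omega>) ^ p \<le> 2 ^ p * (norm (f \<omega>) ^ p + norm (g \<omega>) ^ p)" .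
next
  show "(\<lambda>\<omega>. f \<omega> + g \<omega>) \<in> borel_measurable P"
    using f g by (auto dest!: has_moments_measurable)
qed (use assms in \<open>auto intro!: has_moments_integrable_norm_power\<close>)

text \<open>2ab <= a^2 + b^2 bounds a moment of the product by moments of doubled order, which are
  available because all orders are.\<close>

lemma has_moments_mult:
  assumes f: "has_moments P f" and g: "has_moments P g"
  shows "has_moments P (\<lambda>\<omega>. f \<omega> * g \<omega>)"
proof (rule has_momentsI)
  fix p \<omega>
  have "norm (f \<omega> * g \<omega>) ^ p = norm (f \<omega>) ^ p * norm (g \<omega>) ^ p"
    by (simp add: norm_mult power_mult_distrib)
  also have "\<dots> \<le> 2 * norm (f \<omega>) ^ p * norm (g \<omega>) ^ p"
    by simp
  also have "\<dots> \<le> (norm (f \<omega>) ^ p)\<^sup>2 + (norm (g \<omega>) ^ p)\<^sup>2"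
    by (rule sum_squares_bound)
  finally show "norm (f \<omega> * g \<omega>) ^ p \<le> norm (f \<omega>) ^ (p * 2) + norm (g \<omega>) ^ (p * 2)"
    by (simp add: power_mult)
next
  show "(\<lambda>\<omega>. f \<omega> * g \<omega>) \<in> borel_measurable P"
    using f g by (auto dest!: has_moments_measurable)
qed (use assms in \<open>auto intro!: has_moments_integrable_norm_power\<close>)

lemma (in finite_measure) has_moments_sum:
  "(\<And>i. i \<in> I \<Longrightarrow> has_moments M (f i)) \<Longrightarrow> has_moments M (\<lambda>\<omega>. \<Sum>i\<in>I. f i \<omega>)"
  by (induction I rule: infinite_finite_induct) (auto intro!: has_moments_const has_moments_add)

lemma (in finite_measure) has_moments_prod:
  "(\<And>i. i \<in> I \<Longrightarrow> has_moments M (f i)) \<Longrightarrow> has_moments M (\<lambda>\<omega>. \<Prod>i\<in>I. f i \<omega>)"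
  by (induction I rule: infinite_finite_induct) (auto intro!: has_moments_const has_moments_mult)

lemma (in finite_measure) has_moments_power:
  "has_moments M f \<Longrightarrow> has_moments M (\<lambda>\<omega>. f \<omega> ^ p)"
  by (induction p) (auto intro!: has_moments_const has_moments_mult)

section \<open>Moments of sums of independent centred variables\<close>

context prob_space
begin

text \<open>The sequence \<open>c\<close> bounds the moments of all increments at once and is a
  parameter of its own, so that later constants depend on \<open>c\<close> but not on the
  variables.\<close>

definition bounded_increments :: "(nat \<Rightarrow> real) \<Rightarrow> (nat \<Rightarrow> 'a \<Rightarrow> real) \<Rightarrow> bool" where
  "bounded_increments c Y \<longleftrightarrow> indep_vars (\<lambda>_. borel) Y {1..} \<and>
     (\<forall>k\<ge>1. has_moments M (Y k) \<and> expectation (Y k) = 0 \<and> (\<forall>p. expectation (\<lambda>\<omega>. \<bar>Y k \<omega>\<bar> ^ p) \<le> c p))"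

lemma bounded_increments_sum_has_moments:
  "bounded_increments c Y \<Longrightarrow> has_moments M (\<lambda>\<omega>. \<Sum>k=1..N. Y k \<omega>)"
  unfolding bounded_increments_def by (intro has_moments_sum) auto

lemma expectation_power_add_indep:
  fixes U V :: "'a \<Rightarrow> real"
  assumes ind: "indep_var borel U borel V" and U: "has_moments M U" and V: "has_moments M V"
  shows "expectation (\<lambda>\<omega>. (U \<omega> + V \<omega>) ^ p) =
    (\<Sum>j\<le>p. real (p choose j) * expectation (\<lambda>\<omega>. U \<omega> ^ j) * expectation (\<lambda>\<omega>. V \<omega> ^ (p - j)))"
proof -
  have i: "indep_var borel (\<lambda>\<omega>. U \<omega> ^ j) borel (\<lambda>\<omega>. V \<omega> ^ q)" for j q
    using indep_var_compose[OF ind, of "\<lambda>x. x ^ j" borel "\<lambda>x. x ^ q" borel] by (simp add: o_def)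
  have "expectation (\<lambda>\<omega>. (U \<omega> + V \<omega>) ^ p) = 
      expectation (\<lambda>\<omega>. \<Sum>j\<le>p. real (p choose j) * (U \<omega> ^ j * V \<omega> ^ (p - j)))"
    by (simp add: binomial_ring mult.assoc)
  also have "\<dots> = (\<Sum>j\<le>p. expectation (\<lambda>\<omega>. real (p choose j) * (U \<omega> ^ j * V \<omega> ^ (p - j))))"
    by (intro Bochner_Integration.integral_sum integrable_mult_right has_moments_integrable has_moments_mult
         has_moments_power U V)
  also have "\<dots> = (\<Sum>j\<le>p. real (p choose j) * expectation (\<lambda>\<omega>. U \<omega> ^ j) * expectation (\<lambda>\<omega>. V \<omega> ^ (p - j)))"
    using indep_var_lebesgue_integral[OF i has_moments_integrable_power[OF U] has_moments_integrable_power[OF V]]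
    by (simp add: mult.assoc)
  finally show ?thesis .
qed

lemma bounded_increments_indep:
  assumes "bounded_increments c Y"
  shows "indep_var borel (Y (Suc N)) borel (\<lambda>\<omega>. \<Sum>k=1..N. Y k \<omega>)"
  using assms unfolding bounded_increments_def
  by (intro indep_vars_sum) (auto elim: indep_vars_subset)

lemma bounded_increments_step:
  assumes bi: "bounded_increments c Y"
  shows "expectation (\<lambda>\<omega>. (\<Sum>k=1..Suc N. Y k \<omega>) ^ p) =
    (\<Sum>j\<le>p. real (p choose j) * expectation (\<lambda>\<omega>. Y (Suc N) \<omega> ^ j) * expectation (\<lambda>\<omega>. (\<Sum>k=1..N. Y k \<omega>) ^ (p - j)))"
proof -
  have "has_moments M (Y (Suc N))" using bi unfolding bounded_increments_def by simp
  from expectation_power_add_indep[OF bounded_increments_indep[OF bi] this bounded_increments_sum_has_moments[OF bi], of p]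
  show ?thesis by (simp add: add.commute)
qed

text \<open>The constant is chosen before \<open>Y\<close> and N. When an increment is added, the
  binomial term j = 0 reproduces the old moment, j = 1 vanishes because increments are centred, and
  by induction on p the terms j >= 2 are of order at most N^(p div 2 - 1). Summing over the N steps
  restores the exponent p div 2.\<close>

lemma expectation_sum_power_le:
  "\<exists>C\<ge>0. \<forall>Y N. bounded_increments c Y \<longrightarrow> \<bar>expectation (\<lambda>\<omega>. (\<Sum>k=1..N. Y k \<omega>) ^ p)\<bar> \<le> C * real N ^ (p div 2)"
proof (induction p rule: less_induct)
  case (less p)
  consider "p = 0" | "p = 1" | "p \<ge> 2" by linarith
  then show ?case
  proof cases
    case 1
    then show ?thesis using prob_space by (intro exI[of _ 1]) auto
  next
    case 2
    have "expectation (\<lambda>\<omega>. \<Sum>k=1..N. Y k \<omega>) = 0" if "bounded_increments c Y" for Y N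
      using that unfolding bounded_increments_def
      by (subst Bochner_Integration.integral_sum) (auto intro: has_moments_integrable)
    then show ?thesis using 2 by (intro exI[of _ 0]) auto
  next
    case 3
    have "\<exists>C. \<forall>q<p. C q \<ge> 0 \<and> (\<forall>Y N. bounded_increments c Y \<longrightarrow>
        \<bar>expectation (\<lambda>\<omega>. (\<Sum>k=1..N. Y k \<omega>) ^ q)\<bar> \<le> C q * real N ^ (q div 2))"
      using less.IH by metis
    then obtain C where C: "\<And>q. q < p \<Longrightarrow> C q \<ge> 0"
      "\<And>q Y N. q < p \<Longrightarrow> bounded_increments c Y \<Longrightarrow> \<bar>expectation (\<lambda>\<omega>. (\<Sum>k=1..N. Y k \<omega>) ^ q)\<bar> \<le> C q * real N ^ (q div 2)"
      by blast
    \<comment> \<open>All binomial terms with j >= 2 together. The absolute value is there because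
      \<open>c\<close> is an arbitrary sequence.\<close>
    define D where "D = (\<Sum>j\<in>{2..p}. real (p choose j) * (\<bar>c j\<bar> * C (p - j)))"
    have D: "D \<ge> 0" unfolding D_def using C(1) 3 by (intro sum_nonneg mult_nonneg_nonneg) auto
    have "\<bar>expectation (\<lambda>\<omega>. (\<Sum>k=1..N. Y k \<omega>) ^ p)\<bar> \<le> D * (\<Sum>k<N. real (Suc k) ^ (p div 2 - 1))"
      if bi: "bounded_increments c Y" for Y N
    proof (induction N)
      case 0
      then show ?case using 3 by (simp add: power_0_left)
    next
      case (Suc N)
      let ?m = "\<lambda>j. real (p choose j) * expectation (\<lambda>\<omega>. Y (Suc N) \<omega> ^ j) * expectation (\<lambda>\<omega>. (\<Sum>k=1..N. Y k \<omega>) ^ (p - j))"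
      have split: "{..p} = {0, 1} \<union> {2..p}" using 3 by auto
      have "expectation (\<lambda>\<omega>. (\<Sum>k=1..Suc N. Y k \<omega>) ^ p) = ?m 0 + ?m 1 + (\<Sum>j\<in>{2..p}. ?m j)"
        unfolding bounded_increments_step[OF bi] split by (subst sum.union_disjoint) auto
      moreover have "?m 0 = expectation (\<lambda>\<omega>. (\<Sum>k=1..N. Y k \<omega>) ^ p)" by (simp add: prob_space)
      moreover have "?m 1 = 0" using bi unfolding bounded_increments_def by simp
      ultimately have "\<bar>expectation (\<lambda>\<omega>. (\<Sum>k=1..Suc N. Y k \<omega>) ^ p)\<bar> \<le>
          \<bar>expectation (\<lambda>\<omega>. (\<Sum>k=1..N. Y k \<omega>) ^ p)\<bar> + (\<Sum>j\<in>{2..p}. \<bar>?m j\<bar>)"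
        using sum_abs[of ?m "{2..p}"] by linarith
      also have "(\<Sum>j\<in>{2..p}. \<bar>?m j\<bar>) \<le> (\<Sum>j\<in>{2..p}. real (p choose j) * (\<bar>c j\<bar> * C (p - j)) * real (Suc N) ^ (p div 2 - 1))"
      proof (rule sum_mono)
        fix j assume j: "j \<in> {2..p}"
        have hm: "has_moments M (Y (Suc N))" using bi unfolding bounded_increments_def by simp
        have "\<bar>expectation (\<lambda>\<omega>. Y (Suc N) \<omega> ^ j)\<bar> \<le> expectation (\<lambda>\<omega>. \<bar>Y (Suc N) \<omega>\<bar> ^ j)"
          using integral_abs_bound[of M "\<lambda>\<omega>. Y (Suc N) \<omega> ^ j"] by (simp add: power_abs)
        also have "\<dots> \<le> c j" using bi unfolding bounded_increments_def by simp
        finally have 1: "\<bar>expectation (\<lambda>\<omega>. Y (Suc N) \<omega> ^ j)\<bar> \<le> \<bar>c j\<bar>" by linarith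
        have "\<bar>expectation (\<lambda>\<omega>. (\<Sum>k=1..N. Y k \<omega>) ^ (p - j))\<bar> \<le> C (p - j) * real N ^ ((p - j) div 2)"
          using j 3 by (intro C(2)[OF _ bi]) auto
        also have "\<dots> \<le> C (p - j) * real (Suc N) ^ (p div 2 - 1)"
        proof (rule mult_left_mono)
          \<comment> \<open>At least two factors went to the new increment, which lowers the halved
            exponent by one.\<close>
          have "(p - j) div 2 \<le> p div 2 - 1" using j by auto
          then show "real N ^ ((p - j) div 2) \<le> real (Suc N) ^ (p div 2 - 1)"
            using power_mono[of "real N" "real (Suc N)" "(p - j) div 2"]
              power_increasing[of "(p - j) div 2" "p div 2 - 1" "real (Suc N)"] by simp
        qed (use C(1) j 3 in auto)
        finally have 2: "\<bar>expectation (\<lambda>\<omega>. (\<Sum>k=1..N. Y k \<omega>) ^ (p - j))\<bar> \<le> C (p - j) * real (Suc N) ^ (p div 2 - 1)" .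
        show "\<bar>?m j\<bar> \<le> real (p choose j) * (\<bar>c j\<bar> * C (p - j)) * real (Suc N) ^ (p div 2 - 1)"
          using mult_left_mono[OF mult_mono[OF 1 2 abs_ge_zero abs_ge_zero], of "real (p choose j)"]
          by (simp add: abs_mult mult.assoc)
      qed
      also have "\<dots> = D * real (Suc N) ^ (p div 2 - 1)" by (simp add: D_def sum_distrib_right)
      finally show ?case using Suc.IH by (simp add: distrib_left)
    qed
    moreover have "D * (\<Sum>k<N. real (Suc k) ^ (p div 2 - 1)) \<le> D * real N ^ (p div 2)" for N
    proof (rule mult_left_mono[OF _ D])
      have "(\<Sum>k<N. real (Suc k) ^ (p div 2 - 1)) \<le> (\<Sum>k<N. real N ^ (p div 2 - 1))"
        by (intro sum_mono power_mono) auto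
      also have "\<dots> = real N ^ Suc (p div 2 - 1)" by simp
      also have "Suc (p div 2 - 1) = p div 2" using 3 by auto
      finally show "(\<Sum>k<N. real (Suc k) ^ (p div 2 - 1)) \<le> real N ^ (p div 2)" .
    qed
    ultimately show ?thesis using D
      by (intro exI[of _ D] conjI allI impI) (assumption, rule order_trans)
  qed
qed

lemma expectation_sum_square:
  assumes bi: "bounded_increments c Y" and var: "\<And>k. k \<ge> 1 \<Longrightarrow> expectation (\<lambda>\<omega>. Y k \<omega> ^ 2) = 1"
  shows "expectation (\<lambda>\<omega>. (\<Sum>k=1..N. Y k \<omega>) ^ 2) = real N"
proof (induction N)
  case (Suc N)
  have "{..2::nat} = {0, 1, 2}" by auto
  then have "expectation (\<lambda>\<omega>. (\<Sum>k=1..Suc N. Y k \<omega>) ^ 2) =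
     expectation (\<lambda>\<omega>. (\<Sum>k=1..N. Y k \<omega>) ^ 2) + 2 * expectation (Y (Suc N)) * expectation (\<lambda>\<omega>. \<Sum>k=1..N. Y k \<omega>)
       + expectation (\<lambda>\<omega>. Y (Suc N) \<omega> ^ 2)"
    unfolding bounded_increments_step[OF bi] by (simp add: prob_space eval_nat_numeral)
  then show ?case using Suc bi var[of "Suc N"] unfolding bounded_increments_def by simp
qed simp

end

section \<open>Uniform moment bounds from Assumption I\<close>

lemma power_le_one_plus_power:
  assumes "(x::real) \<ge> 0" "p \<le> q" shows "x ^ p \<le> 1 + x ^ q"
proof (cases "x \<le> 1")
  case True
  then have "x ^ p \<le> 1" using assms by (intro power_le_one)
  then show ?thesis using zero_le_power[OF assms(1), of q] by linarith
next
  case False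
  then have "x ^ p \<le> x ^ q" using assms by (intro power_increasing) auto
  then show ?thesis by simp
qed

text \<open>Assumption I bounds the orders from 3 on, for the sum of a doubly and a singly indexed
  variable. Each variable is one of the two summands, and an order p below 3 is dominated through
  x^p <= 1 + x^3.\<close>

lemma assumption_I_moments:
  assumes P: "prob_space P" and A: "assumption_I P X"
  shows "\<exists>c. \<forall>(r, k) \<in> input_index. has_moments P (X r k) \<and> (\<forall>p. (\<integral>\<omega>. \<bar>X r k \<omega>\<bar> ^ p \<partial>P) \<le> c p)"
proof -
  interpret prob_space P by fact
  define S where "S l = (SUP (i, j, k) \<in> UNIV \<times> UNIV \<times> {1..}.
        \<integral>\<^sup>+ \<omega>. ennreal (\<bar>X [i, j] k \<omega>\<bar> ^ l + \<bar>X [i] k \<omega>\<bar> ^ l) \<partial>P)" for l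
  have S: "S l < \<infinity>" if "l \<ge> 3" for l
    using A that unfolding assumption_I_def S_def by simp
  have meas: "X r k \<in> borel_measurable P" if "(r, k) \<in> input_index" for r k
    using A that unfolding assumption_I_def by auto
  have nn: "(\<integral>\<^sup>+ \<omega>. ennreal (\<bar>X r k \<omega>\<bar> ^ l) \<partial>P) \<le> S l" if rk: "(r, k) \<in> input_index" for r k l
  proof -
    have k: "k \<ge> 1" and "length r = 1 \<or> length r = 2"
      using rk unfolding input_index_def lattice_points_def by auto
    then obtain i j where r: "r = [i] \<or> r = [i, j]" 
      by (auto simp: length_Suc_conv numeral_2_eq_2)
    have "(\<integral>\<^sup>+ \<omega>. ennreal (\<bar>X r k \<omega>\<bar> ^ l) \<partial>P) \<le> (\<integral>\<^sup>+ \<omega>. ennreal (\<bar>X [i, j] k \<omega>\<bar> ^ l + \<bar>X [i] k \<omega>\<bar> ^ l) \<partial>P)"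
      using r by (intro nn_integral_mono ennreal_leI) auto
    also have "\<dots> \<le> S l"
      unfolding S_def by (rule SUP_upper2[of "(i, j, k)"]) (use k in auto)
    finally show ?thesis .
  qed
  \<comment> \<open>The order max 3 p keeps the supremum finite, so \<open>enn2real\<close> loses
    nothing; the 1 comes from comparing order p with that order.\<close>
  define c where "c p = 1 + enn2real (S (max 3 p))" for p
  have key: "integrable P (\<lambda>\<omega>. \<bar>X r k \<omega>\<bar> ^ p) \<and> (\<integral>\<omega>. \<bar>X r k \<omega>\<bar> ^ p \<partial>P) \<le> c p"
    if rk: "(r, k) \<in> input_index" for r k p
  proof -
    let ?q = "max 3 p"
    note [measurable] = meas[OF rk]
    have fin: "(\<integral>\<^sup>+ \<omega>. ennreal (\<bar>X r k \<omega>\<bar> ^ ?q) \<partial>P) < \<infinity>"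
      using nn[OF rk, of ?q] S[of ?q] by (simp add: le_less_trans)
    have iq: "integrable P (\<lambda>\<omega>. \<bar>X r k \<omega>\<bar> ^ ?q)"
      by (rule integrableI_bounded) (use fin in auto)
    have "(\<integral>\<omega>. \<bar>X r k \<omega>\<bar> ^ ?q \<partial>P) = enn2real (\<integral>\<^sup>+ \<omega>. ennreal (\<bar>X r k \<omega>\<bar> ^ ?q) \<partial>P)"
      by (rule integral_eq_nn_integral) auto
    also have "\<dots> \<le> enn2real (S ?q)"
      using nn[OF rk, of ?q] S[of ?q] by (intro enn2real_mono) auto
    finally have eq: "(\<integral>\<omega>. \<bar>X r k \<omega>\<bar> ^ ?q \<partial>P) \<le> enn2real (S ?q)" .
    have le: "\<bar>x\<bar> ^ p \<le> 1 + \<bar>x\<bar> ^ ?q" for x :: real by (rule power_le_one_plus_power) auto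
    have i1: "integrable P (\<lambda>\<omega>. 1 + \<bar>X r k \<omega>\<bar> ^ ?q)" using iq by (intro Bochner_Integration.integrable_add) auto
    have ip: "integrable P (\<lambda>\<omega>. \<bar>X r k \<omega>\<bar> ^ p)"
      by (rule Bochner_Integration.integrable_bound[OF i1]) (use le in \<open>auto intro!: AE_I2\<close>)
    have "(\<integral>\<omega>. \<bar>X r k \<omega>\<bar> ^ p \<partial>P) \<le> (\<integral>\<omega>. 1 + \<bar>X r k \<omega>\<bar> ^ ?q \<partial>P)"
      by (intro integral_mono ip i1 le)
    also have "\<dots> = 1 + (\<integral>\<omega>. \<bar>X r k \<omega>\<bar> ^ ?q \<partial>P)"
      using iq by (subst Bochner_Integration.integral_add) (auto simp: prob_space)
    also have "\<dots> \<le> c p" using eq by (simp add: c_def)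
    finally show ?thesis using ip by simp
  qed
  show ?thesis
    by (rule exI[of _ c]) (use key meas in \<open>auto simp: has_moments_def\<close>)
qed

text \<open>All walks share one sequence \<open>c\<close> of moment bounds. Mean 0 turns variance 1
  into second moment 1.\<close>

lemma assumption_I_walk:
  assumes P: "prob_space P" and A: "assumption_I P X"
  shows "\<exists>c. \<forall>r. length r \<in> {1, 2} \<longrightarrow> prob_space.bounded_increments P c (X r) \<and>
    (\<forall>k\<ge>1. (\<integral>\<omega>. X r k \<omega> ^ 2 \<partial>P) = 1)"
proof -
  interpret prob_space P by fact
  obtain c where c: "\<And>r k. (r, k) \<in> input_index \<Longrightarrow> has_moments P (X r k) \<and> (\<forall>p. (\<integral>\<omega>. \<bar>X r k \<omega>\<bar> ^ p \<partial>P) \<le> c p)"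
    using assumption_I_moments[OF P A] by blast
  have idx: "(r, k) \<in> input_index \<longleftrightarrow> length r \<in> {1, 2} \<and> k \<ge> 1" for r k
    unfolding input_index_def lattice_points_def by auto
  have ind: "indep_vars (\<lambda>_. borel) (\<lambda>(r, k). X r k) input_index"
    using A unfolding assumption_I_def by simp
  have mean: "expectation (X r k) = 0" "variance (X r k) = 1" if "(r, k) \<in> input_index" for r k
    using A that unfolding assumption_I_def by auto
  have "indep_vars (\<lambda>_. borel) (X r) {1..}" if "length r \<in> {1, 2}" for r
  proof -
    \<comment> \<open>Blocks consisting of the single index (r, k) reindex the joint independence by
      k, for the fixed lattice point r.\<close>
    have "indep_vars (\<lambda>k. PiM {(r, k)} (\<lambda>_. borel))
        (\<lambda>k \<omega>. restrict (\<lambda>i. (case i of (r, k) \<Rightarrow> X r k) \<omega>) {(r, k)}) {1..}"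
      using idx that by (intro indep_vars_restrict[OF ind]) (auto simp: disjoint_family_on_def)
    from indep_vars_compose2[OF this, of "\<lambda>k g. g (r, k)" "\<lambda>_. borel"]
    show ?thesis by (auto intro!: measurable_component_singleton)
  qed
  then show ?thesis
    using c mean idx by (intro exI[of _ c]) (auto simp: bounded_increments_def)
qed

text \<open>Distinct lattice points use disjoint blocks of input variables.\<close>

lemma expectation_prod_walk_power:
  fixes X :: "nat list \<Rightarrow> nat \<Rightarrow> 'w \<Rightarrow> real"
  assumes P: "prob_space P" and A: "assumption_I P X" and fin: "finite J" and inj: "inj_on r J"
    and r: "\<And>a. a \<in> J \<Longrightarrow> length (r a) \<in> {1, 2}"
  shows "(\<integral>\<omega>. (\<Prod>a\<in>J. (\<Sum>k=1..N. X (r a) k \<omega>) ^ q a) \<partial>P) = (\<Prod>a\<in>J. \<integral>\<omega>. (\<Sum>k=1..N. X (r a) k \<omega>) ^ q a \<partial>P)"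
proof (cases "J = {}")
  case True
  interpret prob_space P by fact
  show ?thesis unfolding True by (simp add: prob_space)
next
  case False
  interpret prob_space P by fact
  obtain c where c: "\<forall>s. length s \<in> {1, 2} \<longrightarrow> bounded_increments c (X s) \<and>
      (\<forall>k\<ge>1. expectation (\<lambda>\<omega>. X s k \<omega> ^ 2) = 1)"
    using assumption_I_walk[OF P A] by (rule exE)
  define K where "K a = Pair (r a) ` {1..N}" for a
  have ind: "indep_vars (\<lambda>_. borel) (\<lambda>(r, k). X r k) input_index"
    using A unfolding assumption_I_def by simp
  have KI: "K a \<subseteq> input_index" if "a \<in> J" for a
    using r[OF that] unfolding K_def input_index_def lattice_points_def by auto
  have disj: "disjoint_family_on K J"
    using inj unfolding disjoint_family_on_def K_def by (auto simp: inj_on_def)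
  have "indep_vars (\<lambda>a. PiM (K a) (\<lambda>_. borel)) (\<lambda>a \<omega>. restrict (\<lambda>i. (case i of (r, k) \<Rightarrow> X r k) \<omega>) (K a)) J"
    by (rule indep_vars_restrict[OF ind KI disj])
  then have "indep_vars (\<lambda>_. borel) (\<lambda>a \<omega>. (\<Sum>k=1..N. restrict (\<lambda>i. (case i of (r, k) \<Rightarrow> X r k) \<omega>) (K a) (r a, k)) ^ q a) J"
  proof (rule indep_vars_compose2)
    fix a
    have "(\<lambda>g. g (r a, k)) \<in> borel_measurable (PiM (K a) (\<lambda>_. borel :: real measure))" if "k \<in> {1..N}" for k
      using that by (intro measurable_component_singleton) (auto simp: K_def)
    then show "(\<lambda>g. (\<Sum>k=1..N. g (r a, k)) ^ q a) \<in> PiM (K a) (\<lambda>_. borel) \<rightarrow>\<^sub>M (borel :: real measure)"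
      by (intro borel_measurable_power borel_measurable_sum)
  qed
  then have ind': "indep_vars (\<lambda>_. borel) (\<lambda>a \<omega>. (\<Sum>k=1..N. X (r a) k \<omega>) ^ q a) J"
    by (simp add: K_def)
  have "has_moments P (\<lambda>\<omega>. \<Sum>k=1..N. X (r a) k \<omega>)" if "a \<in> J" for a
    by (rule bounded_increments_sum_has_moments[OF conjunct1[OF c[rule_format, OF r[OF that]]]])
  from indep_vars_lebesgue_integral[OF fin ind' has_moments_integrable_power[OF this]]
  show ?thesis by simp
qed

section \<open>Limits of the trace moments\<close>

text \<open>Induction on the length, with the last step split off. Paths live on {1..n} while matrix
  indices start at 0, hence \<open>Suc\<close> at the two ends and the subtraction of 1 in the
  entries.\<close>

lemma pow_mat_index_paths:
  fixes B :: "'a::comm_ring_1 mat"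
  assumes B: "B \<in> carrier_mat n n" and "a < n" "b < n"
  shows "(B ^\<^sub>m l) $$ (a, b) =
    (\<Sum>\<pi> | \<pi> \<in> {0..l} \<rightarrow>\<^sub>E {1..n} \<and> \<pi> 0 = Suc a \<and> \<pi> l = Suc b. \<Prod>i<l. B $$ (\<pi> i - 1, \<pi> (Suc i) - 1))"
  using \<open>b < n\<close>
proof (induction l arbitrary: b)
  case 0
  show ?case
  proof (cases "a = b")
    case True
    have "{\<pi>. \<pi> \<in> {0..0::nat} \<rightarrow>\<^sub>E {1..n} \<and> \<pi> 0 = Suc a \<and> \<pi> 0 = Suc b} = {(\<lambda>i\<in>{0}. Suc a)}"
      using True \<open>a < n\<close> by (auto simp: PiE_iff extensional_def fun_eq_iff)
    then show ?thesis using True \<open>a < n\<close> B by simp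
  next
    case False
    then have "{\<pi>. \<pi> \<in> {0..0::nat} \<rightarrow>\<^sub>E {1..n} \<and> \<pi> 0 = Suc a \<and> \<pi> 0 = Suc b} = {}" by auto
    then show ?thesis using False 0 \<open>a < n\<close> B by (simp only: sum.empty) simp
  qed
next
  case (Suc l)
  define Q where "Q k l = {\<pi>. \<pi> \<in> {0..l::nat} \<rightarrow>\<^sub>E {1..n} \<and> \<pi> 0 = Suc a \<and> \<pi> l = Suc k}" for k l
  have fin: "finite (Q k l)" for k l
    unfolding Q_def by (rule finite_subset[of _ "{0..l} \<rightarrow>\<^sub>E {1..n}"]) (auto intro: finite_PiE)
  have Bl: "B ^\<^sub>m l \<in> carrier_mat n n" using B by simp
  let ?w = "\<lambda>l \<pi>. \<Prod>i<l. B $$ (\<pi> i - 1, \<pi> (Suc i) - 1)"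
  have "(B ^\<^sub>m Suc l) $$ (a, b) = (\<Sum>k<n. (B ^\<^sub>m l) $$ (a, k) * B $$ (k, b))"
    using Bl B Suc.prems \<open>a < n\<close> by (simp add: scalar_prod_def lessThan_atLeast0)
  also have "\<dots> = (\<Sum>k<n. \<Sum>\<pi>\<in>Q k l. ?w l \<pi> * B $$ (k, b))"
    using Suc.IH by (simp add: Q_def sum_distrib_right)
  also have "\<dots> = (\<Sum>(k, \<pi>)\<in>(SIGMA k:{..<n}. Q k l). ?w l \<pi> * B $$ (k, b))"
    using fin by (intro sum.Sigma) auto
  \<comment> \<open>A path with l + 1 steps corresponds to the index k of its last but one vertex
    together with its first l steps. Paths are extensional functions, so these steps are obtained by
    \<open>restrict\<close>.\<close>
  also have "\<dots> = (\<Sum>\<pi>\<in>Q b (Suc l). ?w (Suc l) \<pi>)"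
  proof (rule sum.reindex_bij_witness[where j = "\<lambda>(k, \<pi>). \<pi>(Suc l := Suc b)"
        and i = "\<lambda>\<sigma>. (\<sigma> l - 1, restrict \<sigma> {0..l})"], goal_cases)
    case (1 x)
    then obtain k \<pi> where x: "x = (k, \<pi>)" "k < n" "\<pi> \<in> Q k l" by auto
    have "restrict (\<pi>(Suc l := Suc b)) {0..l} = \<pi>"
      using x(3) unfolding Q_def by (auto simp: fun_eq_iff PiE_iff extensional_def)
    then show ?case using x unfolding Q_def by simp
  next
    case (2 x)
    then obtain k \<pi> where x: "x = (k, \<pi>)" "k < n" "\<pi> \<in> Q k l" by auto
    have "\<pi>(Suc l := Suc b) \<in> {0..Suc l} \<rightarrow>\<^sub>E {1..n}"
      using x(3) Suc.prems unfolding Q_def by (auto simp: PiE_iff extensional_def)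
    then show ?case using x unfolding Q_def by simp
  next
    case (3 \<sigma>)
    then have \<sigma>: "\<sigma> \<in> {0..Suc l} \<rightarrow>\<^sub>E {1..n}" "\<sigma> (Suc l) = Suc b" unfolding Q_def by auto
    show ?case
    proof
      fix i show "(case (\<sigma> l - 1, restrict \<sigma> {0..l}) of (k, \<pi>) \<Rightarrow> \<pi>(Suc l := Suc b)) i = \<sigma> i"
        using \<sigma> by (cases "i \<le> l"; cases "i = Suc l") (auto simp: PiE_iff extensional_def)
    qed
  next
    case (4 \<sigma>)
    then have \<sigma>: "\<sigma> \<in> {0..Suc l} \<rightarrow>\<^sub>E {1..n}" "\<sigma> (Suc l) = Suc b" "\<sigma> 0 = Suc a" unfolding Q_def by auto
    then have "\<sigma> l \<in> {1..n}" by (simp add: PiE_iff)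
    moreover have "restrict \<sigma> {0..l} \<in> {0..l} \<rightarrow>\<^sub>E {1..n}" using \<sigma>(1) by (auto simp: PiE_iff)
    ultimately show ?case using \<sigma> unfolding Q_def by auto
  next
    case (5 x)
    then obtain k \<pi> where x: "x = (k, \<pi>)" "k < n" "\<pi> \<in> Q k l" by auto
    have "?w l (\<pi>(Suc l := Suc b)) = ?w l \<pi>" by (intro prod.cong) auto
    then show ?case using x unfolding Q_def by simp
  qed
  finally show ?case by (simp add: Q_def)
qed

lemma mat_trace_pow_circuits:
  fixes B :: "'a::comm_ring_1 mat"
  assumes B: "B \<in> carrier_mat n n"
  shows "mat_trace (B ^\<^sub>m l) = (\<Sum>\<pi>\<in>circuits n l. \<Prod>i<l. B $$ (\<pi> i - 1, \<pi> (Suc i) - 1))"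
proof -
  define Q where "Q a = {\<pi>. \<pi> \<in> {0..l} \<rightarrow>\<^sub>E {1..n} \<and> \<pi> 0 = Suc a \<and> \<pi> l = Suc a}" for a
  have "mat_trace (B ^\<^sub>m l) = (\<Sum>a<n. \<Sum>\<pi>\<in>Q a. \<Prod>i<l. B $$ (\<pi> i - 1, \<pi> (Suc i) - 1))"
    unfolding mat_trace_def Q_def using pow_mat_index_paths[OF B] B
    by (intro sum.cong) (auto simp: pow_mat_dim_square)
  also have "\<dots> = (\<Sum>\<pi>\<in>(\<Union>a<n. Q a). \<Prod>i<l. B $$ (\<pi> i - 1, \<pi> (Suc i) - 1))"
  proof (rule sum.UNION_disjoint[symmetric])
    have "finite (Q a)" for a
      unfolding Q_def by (rule finite_subset[of _ "{0..l} \<rightarrow>\<^sub>E {1..n}"]) (auto intro: finite_PiE)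
    then show "\<forall>a\<in>{..<n}. finite (Q a)" by simp
  qed (auto simp: Q_def)
  also have "(\<Union>a<n. Q a) = circuits n l"
  proof (rule Set.set_eqI, rule iffI)
    fix \<pi> assume \<pi>: "\<pi> \<in> circuits n l"
    then have "\<pi> 0 \<in> {1..n}" "\<pi> 0 = \<pi> l" "\<pi> \<in> {0..l} \<rightarrow>\<^sub>E {1..n}" unfolding circuits_def by (auto simp: PiE_iff)
    then show "\<pi> \<in> (\<Union>a<n. Q a)" unfolding Q_def by (intro UN_I[of "\<pi> 0 - 1"]) auto
  qed (auto simp: Q_def circuits_def)
  finally show ?thesis .
qed

text \<open>The relabelling reads \<open>v\<close> at any position of the letter: equal letters give
  equal entries, so the choice is immaterial, and distinct letters give distinct entries, which is
  injectivity.\<close>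

lemma same_pattern_map:
  assumes "same_pattern w v"
  obtains r where "inj_on r (set w)" "v = map r w"
proof -
  define r where "r a = v ! (SOME i. i < length w \<and> w ! i = a)" for a
  have len: "length v = length w" using assms unfolding same_pattern_def by simp
  have sp: "w ! i = w ! j \<longleftrightarrow> v ! i = v ! j" if "i < length w" "j < length w" for i j
    using assms that unfolding same_pattern_def by (elim conjE) simp
  have r: "r (w ! i) = v ! i" if "i < length w" for i
  proof -
    define j where "j = (SOME j. j < length w \<and> w ! j = w ! i)"
    have "j < length w \<and> w ! j = w ! i"
      unfolding j_def by (rule someI[of _ i]) (use that in blast)
    then have "v ! j = v ! i" using sp[of j i] that by blast
    then show ?thesis unfolding r_def j_def .
  qed
  show thesis
  proof
    show "v = map r w" by (rule nth_equalityI) (use len r in auto)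
    show "inj_on r (set w)"
    proof (rule inj_onI)
      fix x y assume "x \<in> set w" "y \<in> set w" "r x = r y"
      moreover then obtain i j where ij: "i < length w" "j < length w" "x = w ! i" "y = w ! j"
        by (metis in_set_conv_nth)
      ultimately have "v ! i = v ! j" using r[of i] r[of j] by argo
      then show "x = y" using ij sp[of i j] by blast
    qed
  qed
qed

lemma prod_nth_map_count:
  fixes f :: "'b \<Rightarrow> 'c::comm_monoid_mult"
  shows "(\<Prod>i<length w. f (map r w ! i)) = (\<Prod>a\<in>set w. f (r a) ^ count_list w a)"
proof -
  have "(\<Prod>i<length w. f (map r w ! i)) = (\<Prod>i<length w. f (r (w ! i)))" by (intro prod.cong) auto
  also have "\<dots> = prod_list (map (\<lambda>i. f (r (w ! i))) [0..<length w])"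
    by (subst prod.distinct_set_conv_list[symmetric]) (auto simp: lessThan_atLeast0)
  also have "map (\<lambda>i. f (r (w ! i))) [0..<length w] = map (\<lambda>a. f (r a)) w"
    by (rule nth_equalityI) auto
  also have "prod_list (map (\<lambda>a. f (r a)) w) = prod_mset (image_mset (\<lambda>a. f (r a)) (mset w))"
    by (simp flip: prod_mset_prod_list mset_map)
  also have "\<dots> = (\<Prod>a\<in>set w. f (r a) ^ count_list w a)"
    by (simp add: image_prod_mset_multiplicity count_mset)
  finally show ?thesis .
qed

text \<open>The walks enter without scaling; all powers of n are collected in one denominator n^(1 +
  l).\<close>

definition circuit_moment ::
  "'w measure \<Rightarrow> (nat list \<Rightarrow> nat \<Rightarrow> 'w \<Rightarrow> real) \<Rightarrow> (nat \<Rightarrow> nat \<Rightarrow> nat \<Rightarrow> nat list) \<Rightarrow> nat \<Rightarrow> nat \<Rightarrow> real \<Rightarrow> (nat \<Rightarrow> nat) \<Rightarrow> real"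
where
  "circuit_moment P X L n l t \<pi> = (\<integral>\<omega>. (\<Prod>i<l. walk X n (L n (\<pi> i) (\<pi> (Suc i))) t \<omega>) \<partial>P)"

section \<open>Expectations along a circuit\<close>

context
  fixes P :: "'w measure" and X :: "nat list \<Rightarrow> nat \<Rightarrow> 'w \<Rightarrow> real"
    and L :: "nat \<Rightarrow> nat \<Rightarrow> nat \<Rightarrow> nat list" and d :: nat
  assumes P: "prob_space P" and d: "d \<in> {1, 2}" and link: "link_function d L" and A: "assumption_I P X"
begin

interpretation prob_space P by (rule P)

lemma walk_has_moments: "length r \<in> {1, 2} \<Longrightarrow> has_moments P (walk X n r t)"
proof -
  assume r: "length r \<in> {1, 2}"
  obtain c where c: "\<forall>s. length s \<in> {1, 2} \<longrightarrow> bounded_increments c (X s) \<and>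
      (\<forall>k\<ge>1. expectation (\<lambda>\<omega>. X s k \<omega> ^ 2) = 1)"
    using assumption_I_walk[OF P A] by (rule exE)
  show ?thesis
    unfolding walk_def[abs_def]
    by (rule bounded_increments_sum_has_moments[OF conjunct1[OF c[rule_format, OF r]]])
qed

lemma link_length: "i \<in> {1..n} \<Longrightarrow> j \<in> {1..n} \<Longrightarrow> length (L n i j) \<in> {1, 2}"
  using link d unfolding link_function_def lattice_points_def by auto

lemma circuit_step_length:
  assumes "\<pi> \<in> circuits n l" "i < l"
  shows "length (L n (\<pi> i) (\<pi> (Suc i))) \<in> {1, 2}"
  using assms unfolding circuits_def by (intro link_length) (auto simp: PiE_iff)

lemma trace_A_mat:
  "mat_trace (A_mat X L n t \<omega> ^\<^sub>m l) =
    (1 / sqrt (real n)) ^ l * (\<Sum>\<pi>\<in>circuits n l. \<Prod>i<l. walk X n (L n (\<pi> i) (\<pi> (Suc i))) t \<omega>)"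
proof -
  have "mat_trace (A_mat X L n t \<omega> ^\<^sub>m l) =
     (\<Sum>\<pi>\<in>circuits n l. \<Prod>i<l. A_mat X L n t \<omega> $$ (\<pi> i - 1, \<pi> (Suc i) - 1))"
    by (rule mat_trace_pow_circuits) (simp add: A_mat_def)
  also have "\<dots> = (\<Sum>\<pi>\<in>circuits n l. \<Prod>i<l. (1 / sqrt (real n)) * walk X n (L n (\<pi> i) (\<pi> (Suc i))) t \<omega>)"
  proof (intro sum.cong prod.cong refl)
    fix \<pi> i assume "\<pi> \<in> circuits n l" "i \<in> {..<l}"
    then have "\<pi> i \<in> {1..n}" "\<pi> (Suc i) \<in> {1..n}" unfolding circuits_def by (auto simp: PiE_iff)
    then obtain a b where ab: "\<pi> i = Suc a" "\<pi> (Suc i) = Suc b" "a < n" "b < n"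
      by (cases "\<pi> i"; cases "\<pi> (Suc i)") auto
    then show "A_mat X L n t \<omega> $$ (\<pi> i - 1, \<pi> (Suc i) - 1) = (1 / sqrt (real n)) * walk X n (L n (\<pi> i) (\<pi> (Suc i))) t \<omega>"
      unfolding ab A_mat_def by (subst index_smult_mat) auto
  qed
  also have "\<dots> = (\<Sum>\<pi>\<in>circuits n l. (1 / sqrt (real n)) ^ l * (\<Prod>i<l. walk X n (L n (\<pi> i) (\<pi> (Suc i))) t \<omega>))"
    by (simp only: prod.distrib prod_constant card_lessThan)
  finally show ?thesis by (simp only: sum_distrib_left)
qed

text \<open>The entries contribute n^(-l/2) and the normalisation n^(-(1 + l/2)), together n^(-(1 +
  l)).\<close>

lemma scaled_trace_moment_circuits:
  assumes n: "n \<ge> 1"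
  shows "scaled_trace_moment P X L l t n = (\<Sum>\<pi>\<in>circuits n l. circuit_moment P X L n l t \<pi>) / real n ^ (1 + l)"
proof -
  have "expectation (\<lambda>\<omega>. mat_trace (A_mat X L n t \<omega> ^\<^sub>m l)) =
     (1 / sqrt (real n)) ^ l * (\<Sum>\<pi>\<in>circuits n l. circuit_moment P X L n l t \<pi>)"
  proof -
    have "integrable P (\<lambda>\<omega>. \<Prod>i<l. walk X n (L n (\<pi> i) (\<pi> (Suc i))) t \<omega>)" if "\<pi> \<in> circuits n l" for \<pi>
      by (rule has_moments_integrable[OF has_moments_prod[OF walk_has_moments[OF circuit_step_length[OF that]]]]) simp
    then show ?thesis
      unfolding trace_A_mat circuit_moment_def
      by (subst integral_mult_right_zero, subst Bochner_Integration.integral_sum) auto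
  qed
  moreover have "(1 / sqrt (real n)) ^ l / real n powr (1 + real l / 2) = 1 / real n ^ (1 + l)"
  proof -
    have "sqrt (real n) ^ l = real n powr (real l / 2)"
      using n by (simp add: powr_half_sqrt[symmetric] powr_powr flip: powr_realpow)
    moreover have "real n powr (real l / 2) * real n powr (1 + real l / 2) = real n powr (real (1 + l))"
      by (simp flip: powr_add add: add.commute)
    moreover have "\<dots> = real n ^ (1 + l)" using n by (intro powr_realpow) auto
    ultimately show ?thesis by (simp add: power_divide)
  qed
  ultimately show ?thesis unfolding scaled_trace_moment_def by (simp add: field_simps)
qed

text \<open>The condition that defines the circuits of a word is an equivalence: equal letters share
  a lattice point, so their walks coincide, and different letters have different lattice points, so
  their walks are independent.\<close>

lemma circuit_moment_factor:
  assumes \<pi>: "\<pi> \<in> word_circuits L n w"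
  shows "\<exists>r. (\<forall>a\<in>set w. length (r a) \<in> {1, 2}) \<and>
    circuit_moment P X L n (length w) t \<pi> = (\<Prod>a\<in>set w. expectation (\<lambda>\<omega>. walk X n (r a) t \<omega> ^ count_list w a))"
proof -
  have circ: "\<pi> \<in> circuits n (length w)" and "same_pattern w (link_seq L n (length w) \<pi>)"
    using \<pi> unfolding word_circuits_altdef by auto
  then obtain r where r: "inj_on r (set w)" "link_seq L n (length w) \<pi> = map r w"
    using same_pattern_map by metis
  have len: "length (r a) \<in> {1, 2}" if a: "a \<in> set w" for a
  proof -
    obtain i where i: "i < length w" "a = w ! i" using a by (metis in_set_conv_nth)
    then have "r a = link_seq L n (length w) \<pi> ! i" using r(2) by simp
    also have "\<dots> = L n (\<pi> i) (\<pi> (Suc i))" using i(1) by (simp add: link_seq_def)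
    finally show ?thesis using circuit_step_length[OF circ i(1)] by simp
  qed
  have "(\<Prod>i<length w. walk X n (L n (\<pi> i) (\<pi> (Suc i))) t \<omega>) = (\<Prod>a\<in>set w. walk X n (r a) t \<omega> ^ count_list w a)" for \<omega>
  proof -
    have "(\<Prod>i<length w. walk X n (L n (\<pi> i) (\<pi> (Suc i))) t \<omega>)
        = (\<Prod>i<length w. walk X n (link_seq L n (length w) \<pi> ! i) t \<omega>)"
      by (intro prod.cong) (auto simp: link_seq_def)
    also have "\<dots> = (\<Prod>i<length w. (\<lambda>s. walk X n s t \<omega>) (map r w ! i))" by (simp only: r(2))
    also have "\<dots> = (\<Prod>a\<in>set w. walk X n (r a) t \<omega> ^ count_list w a)" by (rule prod_nth_map_count)
    finally show ?thesis .
  qed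
  then have "circuit_moment P X L n (length w) t \<pi> = expectation (\<lambda>\<omega>. \<Prod>a\<in>set w. walk X n (r a) t \<omega> ^ count_list w a)"
    by (simp only: circuit_moment_def)
  also have "\<dots> = (\<Prod>a\<in>set w. expectation (\<lambda>\<omega>. walk X n (r a) t \<omega> ^ count_list w a))"
    unfolding walk_def by (rule expectation_prod_walk_power[OF P A _ r(1) len]) auto
  finally show ?thesis using len by blast
qed

text \<open>The constant stems from the common bounds \<open>c\<close>, hence is the same for all
  lattice points and all n. This uniformity is what allows summation over circuits.\<close>

lemma walk_moment_bound:
  "\<exists>C\<ge>0. \<forall>r n. length r \<in> {1, 2} \<longrightarrow>
     \<bar>expectation (\<lambda>\<omega>. walk X n r t \<omega> ^ p)\<bar> \<le> C * real (nat \<lfloor>real n * t\<rfloor>) ^ (p div 2)"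
proof -
  obtain c where c: "\<forall>s. length s \<in> {1, 2} \<longrightarrow> bounded_increments c (X s) \<and>
      (\<forall>k\<ge>1. expectation (\<lambda>\<omega>. X s k \<omega> ^ 2) = 1)"
    using assumption_I_walk[OF P A] by (rule exE)
  obtain C where C: "C \<ge> 0" "\<forall>Y N. bounded_increments c Y \<longrightarrow>
      \<bar>expectation (\<lambda>\<omega>. (\<Sum>k=1..N. Y k \<omega>) ^ p)\<bar> \<le> C * real N ^ (p div 2)"
    using expectation_sum_power_le[of c p] by (elim exE conjE)
  show ?thesis
    unfolding walk_def
    by (intro exI[of _ C] conjI allI impI C(1) C(2)[rule_format] conjunct1[OF c[rule_format]])
qed

lemma walk_first_moment:
  assumes r: "length r \<in> {1, 2}"
  shows "expectation (walk X n r t) = 0"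
proof -
  obtain c where c: "\<forall>s. length s \<in> {1, 2} \<longrightarrow> bounded_increments c (X s) \<and>
      (\<forall>k\<ge>1. expectation (\<lambda>\<omega>. X s k \<omega> ^ 2) = 1)"
    using assumption_I_walk[OF P A] by (rule exE)
  have "has_moments P (X r k) \<and> expectation (X r k) = 0" if "k \<ge> 1" for k
    using conjunct1[OF c[rule_format, OF r]] that unfolding bounded_increments_def by blast
  then show ?thesis
    unfolding walk_def[abs_def]
    by (subst Bochner_Integration.integral_sum) (auto intro!: has_moments_integrable)
qed

lemma walk_second_moment:
  assumes r: "length r \<in> {1, 2}"
  shows "expectation (\<lambda>\<omega>. walk X n r t \<omega> ^ 2) = real (nat \<lfloor>real n * t\<rfloor>)"
proof -
  obtain c where c: "\<forall>s. length s \<in> {1, 2} \<longrightarrow> bounded_increments c (X s) \<and>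
      (\<forall>k\<ge>1. expectation (\<lambda>\<omega>. X s k \<omega> ^ 2) = 1)"
    using assumption_I_walk[OF P A] by (rule exE)
  show ?thesis
    unfolding walk_def
    by (rule expectation_sum_square[OF conjunct1[OF c[rule_format, OF r]] conjunct2[OF c[rule_format, OF r], rule_format]])
qed

text \<open>Each letter contributes a second moment, so all circuits of the word have the same value
  and their sum reduces to a count.\<close>

lemma pair_circuit_moment:
  assumes \<pi>: "\<pi> \<in> word_circuits L n w" and w: "pair_matched w"
  shows "circuit_moment P X L n (length w) t \<pi> = real (nat \<lfloor>real n * t\<rfloor>) ^ card (set w)"
proof -
  obtain r where r: "\<forall>a\<in>set w. length (r a) \<in> {1, 2}"
    "circuit_moment P X L n (length w) t \<pi> = (\<Prod>a\<in>set w. expectation (\<lambda>\<omega>. walk X n (r a) t \<omega> ^ count_list w a))"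
    using circuit_moment_factor[OF \<pi>, of t] by (elim exE conjE)
  have "\<dots> = (\<Prod>a\<in>set w. real (nat \<lfloor>real n * t\<rfloor>))"
    using w walk_second_moment[OF r(1)[rule_format]] unfolding pair_matched_def by (intro prod.cong) auto
  then show ?thesis using r(2) by simp
qed

lemma circuit_moment_single_letter:
  assumes \<pi>: "\<pi> \<in> word_circuits L n w" and a: "a \<in> set w" "count_list w a = 1"
  shows "circuit_moment P X L n (length w) t \<pi> = 0"
proof -
  obtain r where r: "\<forall>a\<in>set w. length (r a) \<in> {1, 2}"
    "circuit_moment P X L n (length w) t \<pi> = (\<Prod>a\<in>set w. expectation (\<lambda>\<omega>. walk X n (r a) t \<omega> ^ count_list w a))"
    using circuit_moment_factor[OF \<pi>, of t] by (elim exE conjE)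
  have "expectation (\<lambda>\<omega>. walk X n (r a) t \<omega> ^ count_list w a) = 0"
    using walk_first_moment[OF r(1)[rule_format, OF a(1)]] a(2) by simp
  then show ?thesis unfolding r(2) by (rule prod_zero[OF finite_set bexI[OF _ a(1)]])
qed

lemma circuit_moment_bound:
  "\<exists>C\<ge>0. \<forall>n. \<forall>\<pi>\<in>word_circuits L n w. \<bar>circuit_moment P X L n (length w) t \<pi>\<bar> \<le>
      C * real (nat \<lfloor>real n * t\<rfloor>) ^ (\<Sum>a\<in>set w. count_list w a div 2)"
proof -
  have "\<forall>p. \<exists>C\<ge>0. \<forall>r n. length r \<in> {1, 2} \<longrightarrow>
     \<bar>expectation (\<lambda>\<omega>. walk X n r t \<omega> ^ p)\<bar> \<le> C * real (nat \<lfloor>real n * t\<rfloor>) ^ (p div 2)"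
    using walk_moment_bound by blast
  then obtain C where C: "\<And>p. C p \<ge> 0" "\<And>p r n. length r \<in> {1, 2} \<Longrightarrow>
     \<bar>expectation (\<lambda>\<omega>. walk X n r t \<omega> ^ p)\<bar> \<le> C p * real (nat \<lfloor>real n * t\<rfloor>) ^ (p div 2)"
    by metis
  show ?thesis
  proof (intro exI[of _ "\<Prod>a\<in>set w. C (count_list w a)"] conjI allI ballI prod_nonneg C(1))
    fix n \<pi> assume \<pi>: "\<pi> \<in> word_circuits L n w"
    obtain r where r: "\<forall>a\<in>set w. length (r a) \<in> {1, 2}"
      "circuit_moment P X L n (length w) t \<pi> = (\<Prod>a\<in>set w. expectation (\<lambda>\<omega>. walk X n (r a) t \<omega> ^ count_list w a))"
      using circuit_moment_factor[OF \<pi>, of t] by (elim exE conjE)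
    have "\<bar>circuit_moment P X L n (length w) t \<pi>\<bar> = (\<Prod>a\<in>set w. \<bar>expectation (\<lambda>\<omega>. walk X n (r a) t \<omega> ^ count_list w a)\<bar>)"
      unfolding r(2) by (rule abs_prod)
    also have "\<dots> \<le> (\<Prod>a\<in>set w. C (count_list w a) * real (nat \<lfloor>real n * t\<rfloor>) ^ (count_list w a div 2))"
      by (intro prod_mono conjI abs_ge_zero C(2) r(1)[rule_format])
    finally show "\<bar>circuit_moment P X L n (length w) t \<pi>\<bar> \<le>
      (\<Prod>a\<in>set w. C (count_list w a)) * real (nat \<lfloor>real n * t\<rfloor>) ^ (\<Sum>a\<in>set w. count_list w a div 2)"
      by (simp only: prod.distrib power_sum)
  qed
qed

text \<open>Letterwise comparison of multiplicities q: 1 + q div 2 <= q from q = 2 on, strictly from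
  q = 3 on. Some letter has q >= 3, and the multiplicities add up to the length.\<close>

lemma unmatched_exponent:
  assumes nosingle: "\<And>a. a \<in> set w \<Longrightarrow> count_list w a \<noteq> 1" and np: "\<not> pair_matched w"
  shows "card (set w) + (\<Sum>a\<in>set w. count_list w a div 2) < length w"
proof -
  have ge: "count_list w a \<ge> 2" if "a \<in> set w" for a
  proof -
    have "count_list w a \<noteq> 0" using that by (simp add: count_list_0_iff)
    then show ?thesis using nosingle[OF that] by linarith
  qed
  obtain b where b: "b \<in> set w" "count_list w b \<noteq> 2" using np unfolding pair_matched_def by auto
  have "card (set w) + (\<Sum>a\<in>set w. count_list w a div 2) = (\<Sum>a\<in>set w. 1 + count_list w a div 2)"
    by (simp only: sum.distrib) simp
  also have "\<dots> < (\<Sum>a\<in>set w. count_list w a)"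
  proof (rule sum_strict_mono_ex1)
    show "\<forall>a\<in>set w. 1 + count_list w a div 2 \<le> count_list w a"
    proof
      fix a assume "a \<in> set w" then show "1 + count_list w a div 2 \<le> count_list w a" using ge[of a] by linarith
    qed
    show "\<exists>a\<in>set w. 1 + count_list w a div 2 < count_list w a"
      by (intro bexI[of _ b]) (use ge[OF b(1)] b in linarith)+
  qed simp
  also have "\<dots> = length w" by (rule sum_count_set) auto
  finally show ?thesis .
qed

section \<open>The contribution of each word in the limit\<close>

context
  fixes K :: nat and t :: real
  assumes K: "\<And>n r i. r \<in> lattice_points d \<Longrightarrow> i \<in> {1..n} \<Longrightarrow> card {j\<in>{1..n}. L n i j = r} \<le> K" and K1: "K \<ge> 1"
    and t: "t \<ge> 0"
begin

lemma unmatched_term_tendsto: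
  assumes np: "\<not> pair_matched w"
  shows "(\<lambda>n. (\<Sum>\<pi>\<in>word_circuits L n w. circuit_moment P X L n (length w) t \<pi>) / real n ^ (1 + length w)) \<longlonglongrightarrow> 0"
proof (cases "\<exists>a\<in>set w. count_list w a = 1")
  case True
  then have "(\<Sum>\<pi>\<in>word_circuits L n w. circuit_moment P X L n (length w) t \<pi>) = 0" for n
    using circuit_moment_single_letter by (intro sum.neutral) blast
  then show ?thesis by simp
next
  case False
  define e where "e = (\<Sum>a\<in>set w. count_list w a div 2)"
  define b where "b = card (set w)"
  have be: "b + e < length w" unfolding b_def e_def by (rule unmatched_exponent) (use False np in auto)
  obtain C where C: "C \<ge> 0" "\<forall>n. \<forall>\<pi>\<in>word_circuits L n w. \<bar>circuit_moment P X L n (length w) t \<pi>\<bar> \<le>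
      C * real (nat \<lfloor>real n * t\<rfloor>) ^ e"
    using circuit_moment_bound[of w t] unfolding e_def by (elim exE conjE)
  \<comment> \<open>The part of the estimate free of n: K^l from the path count and C t^e from the
    walks. The remaining power n^(1 + b + e) is at most n^l, one below the denominator.\<close>
  define D where "D = real K ^ length w * (C * t ^ e)"
  have bound: "\<bar>(\<Sum>\<pi>\<in>word_circuits L n w. circuit_moment P X L n (length w) t \<pi>) / real n ^ (1 + length w)\<bar> \<le> D / real n"
    if n: "n \<ge> 1" for n
  proof -
    have "\<bar>\<Sum>\<pi>\<in>word_circuits L n w. circuit_moment P X L n (length w) t \<pi>\<bar> \<le>
        (\<Sum>\<pi>\<in>word_circuits L n w. \<bar>circuit_moment P X L n (length w) t \<pi>\<bar>)" by (rule sum_abs)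
    also have "\<dots> \<le> (\<Sum>\<pi>\<in>word_circuits L n w. C * (real n * t) ^ e)"
    proof (rule sum_mono)
      fix \<pi> assume "\<pi> \<in> word_circuits L n w"
      then have "\<bar>circuit_moment P X L n (length w) t \<pi>\<bar> \<le> C * real (nat \<lfloor>real n * t\<rfloor>) ^ e" using C(2) by blast
      also have "\<dots> \<le> C * (real n * t) ^ e"
        using C(1) t by (intro mult_left_mono power_mono) (auto simp: of_nat_floor)
      finally show "\<bar>circuit_moment P X L n (length w) t \<pi>\<bar> \<le> C * (real n * t) ^ e" .
    qed
    also have "\<dots> = real (card (word_circuits L n w)) * (C * (real n * t) ^ e)" by simp
    also have "\<dots> \<le> real (n ^ (1 + b) * K ^ length w) * (C * (real n * t) ^ e)"
      unfolding b_def using C(1) t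
      by (intro mult_right_mono of_nat_mono card_word_circuits_le[OF link K K1]) auto
    also have "\<dots> = D * real n ^ (1 + b + e)" unfolding D_def by (simp add: power_mult_distrib power_add)
    also have "\<dots> \<le> D * real n ^ length w"
      unfolding D_def using n be C(1) t by (intro mult_left_mono power_increasing) auto
    finally show ?thesis using n by (simp add: field_simps abs_divide)
  qed
  have "(\<lambda>n. D * inverse (real n)) \<longlonglongrightarrow> D * 0" by (intro tendsto_mult tendsto_const LIMSEQ_inverse_real_of_nat[THEN LIMSEQ_imp_Suc])
  then have "(\<lambda>n. D / real n) \<longlonglongrightarrow> 0" by (simp add: divide_inverse)
  then show ?thesis
    by (rule Lim_null_comparison[rotated]) (use bound in \<open>auto simp: eventually_sequentially\<close>)
qed

lemma floor_ratio_tendsto: "(\<lambda>n. real (nat \<lfloor>real n * t\<rfloor>) / real n) \<longlonglongrightarrow> t"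
proof (rule tendsto_sandwich)
  show "\<forall>\<^sub>F n in sequentially. t - inverse (real n) \<le> real (nat \<lfloor>real n * t\<rfloor>) / real n"
  proof (rule eventually_sequentiallyI[of 1])
    fix n :: nat assume n: "n \<ge> 1"
    have "real n * t - 1 \<le> real (nat \<lfloor>real n * t\<rfloor>)" by linarith
    then have "(real n * t - 1) / real n \<le> real (nat \<lfloor>real n * t\<rfloor>) / real n" by (intro divide_right_mono) auto
    then show "t - inverse (real n) \<le> real (nat \<lfloor>real n * t\<rfloor>) / real n" using n by (simp add: field_simps)
  qed
  show "\<forall>\<^sub>F n in sequentially. real (nat \<lfloor>real n * t\<rfloor>) / real n \<le> t"
  proof (rule eventually_sequentiallyI[of 1])
    fix n :: nat assume n: "n \<ge> 1"
    have "real (nat \<lfloor>real n * t\<rfloor>) \<le> real n * t" using t by (intro of_nat_floor) auto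
    then show "real (nat \<lfloor>real n * t\<rfloor>) / real n \<le> t" using n by (simp add: field_simps)
  qed
  have "(\<lambda>n. t - inverse (real n)) \<longlonglongrightarrow> t - 0"
    by (intro tendsto_diff tendsto_const LIMSEQ_inverse_real_of_nat[THEN LIMSEQ_imp_Suc])
  then show "(\<lambda>n. t - inverse (real n)) \<longlonglongrightarrow> t" by simp
qed simp

text \<open>The denominator n^(1 + 2m) splits into n^m for the m variances and n^(1 + m) for the
  number of circuits; the first quotient tends to t^m, the second to the assumed limit.\<close>

lemma matched_term_tendsto:
  assumes w: "w \<in> pair_words (2 * m)"
    and conv: "convergent (\<lambda>n. real (card (word_circuits L n w)) / real n ^ (1 + m))"
  shows "(\<lambda>n. (\<Sum>\<pi>\<in>word_circuits L n w. circuit_moment P X L n (length w) t \<pi>) / real n ^ (1 + length w))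
     \<longlonglongrightarrow> t ^ m * lim (\<lambda>n. real (card (word_circuits L n w)) / real n ^ (1 + m))"
proof -
  have pm: "pair_matched w" and len: "length w = 2 * m" using w unfolding pair_words_def by auto
  then have card: "card (set w) = m" using pair_matched_length[OF pm] by simp
  have eq: "(\<Sum>\<pi>\<in>word_circuits L n w. circuit_moment P X L n (length w) t \<pi>) / real n ^ (1 + length w) =
      (real (nat \<lfloor>real n * t\<rfloor>) / real n) ^ m * (real (card (word_circuits L n w)) / real n ^ (1 + m))" for n
  proof -
    have "(\<Sum>\<pi>\<in>word_circuits L n w. circuit_moment P X L n (length w) t \<pi>) =
       real (card (word_circuits L n w)) * real (nat \<lfloor>real n * t\<rfloor>) ^ m"
      using pair_circuit_moment[OF _ pm, of _ n t] card by simp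
    moreover have "real n ^ (1 + length w) = real n ^ m * real n ^ (1 + m)"
      unfolding len power_add[symmetric] by (simp only: mult_2 add_ac)
    ultimately show ?thesis
      by (metis power_divide times_divide_times_eq mult.commute)
  qed
  show ?thesis unfolding eq
    by (intro tendsto_mult tendsto_power floor_ratio_tendsto) (use conv in \<open>simp add: convergent_LIMSEQ_iff\<close>)
qed

text \<open>\<open>l div 2\<close> lets one formula serve both parities: for odd l there are no
  pair-matched words and the sum is empty.\<close>

lemma scaled_trace_moment_tendsto:
  assumes conv: "\<forall>m\<ge>1. \<forall>w\<in>pair_words (2 * m).
           convergent (\<lambda>n. real (card (word_circuits L n w)) / real n ^ (1 + m))"
    and l: "l \<ge> 1"
  shows "scaled_trace_moment P X L l t \<longlonglongrightarrow>
    t ^ (l div 2) * (\<Sum>w\<in>pair_words l. lim (\<lambda>n. real (card (word_circuits L n w)) / real n ^ (1 + l div 2)))"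
proof -
  let ?T = "\<lambda>w n. (\<Sum>\<pi>\<in>word_circuits L n w. circuit_moment P X L n l t \<pi>) / real n ^ (1 + l)"
  let ?l = "\<lambda>w. t ^ (l div 2) * lim (\<lambda>n. real (card (word_circuits L n w)) / real n ^ (1 + l div 2))"
  have "(\<lambda>n. \<Sum>w\<in>words l. ?T w n) \<longlonglongrightarrow> (\<Sum>w\<in>words l. if w \<in> pair_words l then ?l w else 0)"
  proof (rule tendsto_sum)
    fix w assume w: "w \<in> words l"
    then have len: "length w = l" unfolding words_def by auto
    show "?T w \<longlonglongrightarrow> (if w \<in> pair_words l then ?l w else 0)"
    proof (cases "w \<in> pair_words l")
      case True
      then have "l = 2 * card (set w)" using pair_matched_length[of w] len unfolding pair_words_def by auto
      then obtain m where m: "l = 2 * m" by blast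
      have "(\<lambda>n. (\<Sum>\<pi>\<in>word_circuits L n w. circuit_moment P X L n (length w) t \<pi>) / real n ^ (1 + length w))
         \<longlonglongrightarrow> t ^ m * lim (\<lambda>n. real (card (word_circuits L n w)) / real n ^ (1 + m))"
        using conv l True m by (intro matched_term_tendsto) auto
      then show ?thesis using True len m by simp
    next
      case False
      then have "\<not> pair_matched w" using w unfolding pair_words_eq by auto
      from unmatched_term_tendsto[OF this] show ?thesis using False len by simp
    qed
  qed
  also have "(\<Sum>w\<in>words l. if w \<in> pair_words l then ?l w else 0) = (\<Sum>w\<in>pair_words l. ?l w)"
    using finite_words[of l] by (intro sum.mono_neutral_cong_right) (auto simp: pair_words_eq)
  also have "\<dots> = t ^ (l div 2) * (\<Sum>w\<in>pair_words l. lim (\<lambda>n. real (card (word_circuits L n w)) / real n ^ (1 + l div 2)))"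
    by (simp only: sum_distrib_left)
  finally have main: "(\<lambda>n. \<Sum>w\<in>words l. ?T w n) \<longlonglongrightarrow> \<dots>" .
  have "\<forall>\<^sub>F n in sequentially. (\<Sum>w\<in>words l. ?T w n) = scaled_trace_moment P X L l t n"
    by (rule eventually_sequentiallyI[of 1])
       (simp only: scaled_trace_moment_circuits sum_circuits_by_word[of _ _ l L] sum_divide_distrib)
  then show ?thesis using main by (rule Lim_transform_eventually[rotated])
qed

text \<open>A pair-matched word of length 2m has m letters, so the path count n^(1 + m) K^(2m) has
  exactly the order of the normalisation.\<close>

lemma pair_words_limit_bounds:
  assumes conv: "\<forall>m\<ge>1. \<forall>w\<in>pair_words (2 * m).
           convergent (\<lambda>n. real (card (word_circuits L n w)) / real n ^ (1 + m))"
    and w: "w \<in> pair_words (2 * m)" and m: "m \<ge> 1"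
  shows "lim (\<lambda>n. real (card (word_circuits L n w)) / real n ^ (1 + m)) \<in> {0..real K ^ (2 * m)}"
proof -
  let ?f = "\<lambda>n. real (card (word_circuits L n w)) / real n ^ (1 + m)"
  have lim: "?f \<longlonglongrightarrow> lim ?f" using conv w m by (simp add: convergent_LIMSEQ_iff)
  have pm: "pair_matched w" and len: "length w = 2 * m" using w unfolding pair_words_def by auto
  then have card: "card (set w) = m" using pair_matched_length[OF pm] by simp
  have "?f n \<le> real K ^ (2 * m)" if n: "n \<ge> 1" for n
  proof -
    have "real (card (word_circuits L n w)) \<le> real (n ^ (1 + m) * K ^ (2 * m))"
      using card_word_circuits_le[OF link K K1, of n w] card len by (intro of_nat_mono) auto
    then show ?thesis using n by (simp add: field_simps)
  qed
  then have "lim ?f \<le> real K ^ (2 * m)" by (intro LIMSEQ_le_const2[OF lim]) auto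
  moreover have "0 \<le> lim ?f" by (rule LIMSEQ_le_const[OF lim]) auto
  ultimately show ?thesis by simp
qed

text \<open>At most (2m)! / m! words contribute, each at most K^(2m). The factor (2m)! cancels,
  leaving the terms of the exponential series at t K^2 h^2.\<close>

lemma even_moment_growth:
  assumes conv: "\<forall>m\<ge>1. \<forall>w\<in>pair_words (2 * m).
           convergent (\<lambda>n. real (card (word_circuits L n w)) / real n ^ (1 + m))"
  shows "(\<lambda>m. h ^ (2 * m) / fact (2 * m) * (t ^ m * (\<Sum>w\<in>pair_words (2 * m). 
      lim (\<lambda>n. real (card (word_circuits L n w)) / real n ^ (1 + m))))) \<longlonglongrightarrow> 0"
proof -
  let ?s = "\<lambda>m. \<Sum>w\<in>pair_words (2 * m). lim (\<lambda>n. real (card (word_circuits L n w)) / real n ^ (1 + m))"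
  have "norm (h ^ (2 * m) / fact (2 * m) * (t ^ m * ?s m)) \<le> (t * real K ^ 2 * h ^ 2) ^ m / fact m" if m: "m \<ge> 1" for m
  proof -
    have s0: "0 \<le> ?s m" using pair_words_limit_bounds[OF conv _ m] by (intro sum_nonneg) auto
    have "?s m \<le> real (card (pair_words (2 * m))) * real K ^ (2 * m)"
      using pair_words_limit_bounds[OF conv _ m] by (intro sum_bounded_above) auto
    moreover have "real (card (pair_words (2 * m))) \<le> fact (2 * m) / fact m"
    proof -
      have "real (card (pair_words (2 * m)) * fact m) \<le> real (fact (2 * m))"
        using card_pair_words_le by (intro of_nat_mono)
      then show ?thesis by (simp add: field_simps)
    qed
    ultimately have s: "?s m \<le> fact (2 * m) / fact m * real K ^ (2 * m)"
      by (meson mult_right_mono order_trans of_nat_0_le_iff zero_le_power)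
    have "norm (h ^ (2 * m) / fact (2 * m) * (t ^ m * ?s m)) = h ^ (2 * m) / fact (2 * m) * t ^ m * ?s m"
      using s0 t by (simp add: abs_mult power_mult)
    also have "\<dots> \<le> h ^ (2 * m) / fact (2 * m) * t ^ m * (fact (2 * m) / fact m * real K ^ (2 * m))"
      using s t by (intro mult_left_mono) auto
    also have "\<dots> = (t * real K ^ 2 * h ^ 2) ^ m / fact m"
      by (simp add: power_mult_distrib power_mult)
    finally show ?thesis .
  qed
  then have ev: "\<forall>\<^sub>F m in sequentially.
      norm (h ^ (2 * m) / fact (2 * m) * (t ^ m * ?s m)) \<le> (t * real K ^ 2 * h ^ 2) ^ m / fact m"
    by (rule eventually_sequentiallyI[of 1])
  have "(\<lambda>m. (t * real K ^ 2 * h ^ 2) ^ m / fact m) \<longlonglongrightarrow> 0"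
    using summable_LIMSEQ_zero[OF summable_exp[of "t * real K ^ 2 * h ^ 2"]] by (simp add: divide_inverse mult.commute)
  then show ?thesis by (rule Lim_null_comparison[OF ev])
qed

end

end

section \<open>The expected spectral law\<close>

lemma mat_trace_mult_comm:
  fixes A B :: "'a::comm_semiring_0 mat"
  assumes "A \<in> carrier_mat n n" "B \<in> carrier_mat n n"
  shows "mat_trace (A * B) = mat_trace (B * A)"
proof -
  have "mat_trace (A * B) = (\<Sum>i<n. \<Sum>j<n. A $$ (i, j) * B $$ (j, i))"
    using assms by (simp add: mat_trace_def scalar_prod_def lessThan_atLeast0)
  also have "\<dots> = (\<Sum>j<n. \<Sum>i<n. B $$ (j, i) * A $$ (i, j))"
    by (subst sum.swap) (simp add: mult.commute)
  also have "\<dots> = mat_trace (B * A)"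
    using assms by (simp add: mat_trace_def scalar_prod_def lessThan_atLeast0)
  finally show ?thesis .
qed

lemma upper_triangular_pow:
  fixes B :: "'a::comm_ring_1 mat"
  assumes B: "B \<in> carrier_mat n n" and ut: "upper_triangular B"
  shows "upper_triangular (B ^\<^sub>m l) \<and> (\<forall>i<n. (B ^\<^sub>m l) $$ (i, i) = B $$ (i, i) ^ l)"
proof (induction l)
  case (Suc l)
  have Bl: "B ^\<^sub>m l \<in> carrier_mat n n" using B by simp
  have idx: "(B ^\<^sub>m Suc l) $$ (i, j) = (\<Sum>k<n. (B ^\<^sub>m l) $$ (i, k) * B $$ (k, j))" if "i < n" "j < n" for i j
    using B Bl that by (simp add: scalar_prod_def lessThan_atLeast0)
  have z: "(B ^\<^sub>m l) $$ (i, k) = 0" "B $$ (i, k) = 0" if "k < i" "i < n" for i k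
    using Suc.IH ut that B Bl unfolding upper_triangular_def by auto
  have "(B ^\<^sub>m Suc l) $$ (i, j) = 0" if "j < i" "i < n" for i j
  proof -
    have "(B ^\<^sub>m l) $$ (i, k) * B $$ (k, j) = 0" if "k < n" for k
      using z[of k i] z[of j k] \<open>j < i\<close> \<open>i < n\<close> that by (cases "k < i") auto
    then show ?thesis using idx[of i j] that by simp
  qed
  moreover have "(B ^\<^sub>m Suc l) $$ (i, i) = B $$ (i, i) ^ Suc l" if "i < n" for i
  proof -
    have "(B ^\<^sub>m l) $$ (i, k) * B $$ (k, i) = (if k = i then B $$ (i, i) ^ l * B $$ (i, i) else 0)" if "k < n" for k
      using z[of k i] z[of i k] Suc.IH \<open>i < n\<close> that by (cases k i rule: linorder_cases) auto
    then have "(B ^\<^sub>m Suc l) $$ (i, i) = (\<Sum>k<n. if k = i then B $$ (i, i) ^ l * B $$ (i, i) else 0)"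
      unfolding idx[OF that that] by (intro sum.cong) auto
    also have "\<dots> = B $$ (i, i) ^ Suc l" using that by (simp add: mult.commute)
    finally show ?thesis .
  qed
  ultimately show ?case using B Bl unfolding upper_triangular_def by simp
qed (use B in auto)

lemma complex_eigenvalue_symmetric_real:
  assumes B: "B \<in> carrier_mat n n" and sym: "\<And>i j. i < n \<Longrightarrow> j < n \<Longrightarrow> B $$ (i, j) = B $$ (j, i)"
    and ev: "eigenvalue (map_mat complex_of_real B) a"
  shows "a \<in> \<real>"
proof -
  let ?C = "map_mat complex_of_real B"
  obtain v where v: "v \<in> carrier_vec n" "v \<noteq> 0\<^sub>v n" "?C *\<^sub>v v = a \<cdot>\<^sub>v v"
    using ev B unfolding eigenvalue_def eigenvector_def by auto
  \<comment> \<open>The Hermitian form of B at the eigenvector v: symmetry makes it real, and the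
    eigenvector equation makes it a times the squared norm of v.\<close>
  define s where "s = (\<Sum>i<n. \<Sum>j<n. cnj (v $ i) * (of_real (B $$ (i, j)) * v $ j))"
  have "s = (\<Sum>i<n. cnj (v $ i) * (?C *\<^sub>v v) $ i)"
    unfolding s_def using B v(1)
    by (intro sum.cong) (auto simp: scalar_prod_def lessThan_atLeast0 sum_distrib_left)
  also have "\<dots> = (\<Sum>i<n. a * (cnj (v $ i) * v $ i))"
    unfolding v(3) using v(1) by (intro sum.cong) auto
  also have "\<dots> = a * of_real (\<Sum>i<n. (cmod (v $ i))\<^sup>2)"
    unfolding of_real_sum complex_norm_square sum_distrib_left by (simp add: mult.commute)
  finally have s: "s = a * of_real (\<Sum>i<n. (cmod (v $ i))\<^sup>2)" .
  have "cnj s = (\<Sum>i<n. \<Sum>j<n. v $ i * (of_real (B $$ (i, j)) * cnj (v $ j)))"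
    unfolding s_def by (simp add: cnj_sum)
  also have "\<dots> = (\<Sum>j<n. \<Sum>i<n. v $ i * (of_real (B $$ (i, j)) * cnj (v $ j)))"
    by (rule sum.swap)
  also have "\<dots> = s"
    unfolding s_def using sym by (intro sum.cong refl) (simp add: mult_ac)
  finally have "s \<in> \<real>" by (simp add: Reals_cnj_iff)
  moreover have pos: "(\<Sum>i<n. (cmod (v $ i))\<^sup>2) \<noteq> 0"
  proof
    assume "(\<Sum>i<n. (cmod (v $ i))\<^sup>2) = 0"
    then have "\<forall>i<n. v $ i = 0" by (subst (asm) sum_nonneg_eq_0_iff) auto
    then have "v = 0\<^sub>v n" using v(1) by (intro eq_vecI) auto
    then show False using v(2) by simp
  qed
  ultimately have "s / of_real (\<Sum>i<n. (cmod (v $ i))\<^sup>2) \<in> \<real>" by (intro Reals_divide) auto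
  moreover have "s / of_real (\<Sum>i<n. (cmod (v $ i))\<^sup>2) = a"
    unfolding s using pos by (metis nonzero_mult_div_cancel_right of_real_eq_0_iff)
  ultimately show ?thesis by simp
qed

text \<open>Over the complex numbers the characteristic polynomial splits. Its roots are real, and
  real polynomials embed injectively, so the factorisation descends.\<close>

lemma char_poly_symmetric_splits:
  fixes B :: "real mat"
  assumes B: "B \<in> carrier_mat n n" and sym: "\<And>i j. i < n \<Longrightarrow> j < n \<Longrightarrow> B $$ (i, j) = B $$ (j, i)"
  shows "\<exists>es. char_poly B = (\<Prod>e\<leftarrow>es. [:- e, 1:]) \<and> length es = n"
proof -
  interpret h: map_poly_inj_comm_ring_hom complex_of_real ..
  let ?C = "map_mat complex_of_real B"
  have C: "?C \<in> carrier_mat n n" using B by simp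
  obtain as where as: "char_poly ?C = (\<Prod>a\<leftarrow>as. [:- a, 1:])" "length as = n"
    using char_poly_factorized[OF C] by auto
  have "a \<in> \<real>" if "a \<in> set as" for a
  proof (rule complex_eigenvalue_symmetric_real[OF B sym])
    have "poly (char_poly ?C) a = 0" unfolding as(1) using that by (induction as) auto
    then show "eigenvalue ?C a" using eigenvalue_root_char_poly[OF C] by simp
  qed auto
  then have "as = map complex_of_real (map Re as)"
    by (auto intro!: nth_equalityI simp: of_real_Re)
  then obtain es where es: "as = map complex_of_real es" "length es = n" using as(2) by (metis length_map)
  have "map_poly complex_of_real (char_poly B) = (\<Prod>a\<leftarrow>as. [:- a, 1:])"
    by (subst of_real_hom.char_poly_hom[OF B, symmetric]) (rule as(1))
  also have "\<dots> = map_poly complex_of_real (\<Prod>e\<leftarrow>es. [:- e, 1:])"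
    unfolding es(1) by (induction es) (simp_all add: h.hom_mult del: mult_pCons_left)
  finally have "char_poly B = (\<Prod>e\<leftarrow>es. [:- e, 1:])" by (simp only: h.eq_iff)
  then show ?thesis using es(2) by auto
qed

lemma proots_prod_linear: "proots (\<Prod>e\<leftarrow>es. [:- e, 1:]) = mset es" for es :: "'a::idom list"
proof (induction es)
  case (Cons e es)
  have "(\<Prod>e\<leftarrow>es. [:- e, 1:]) \<noteq> 0" by (auto simp: prod_list_zero_iff)
  then show ?case using Cons by (simp add: proots_mult del: mult_pCons_left)
qed simp

text \<open>As the characteristic polynomial splits over the reals, Schur triangularisation stays
  real and has the roots on the diagonal. Traces of powers are invariant under similarity, and
  powers of a triangular matrix act entrywise on its diagonal.\<close>

lemma symmetric_proots_trace:
  fixes B :: "real mat"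
  assumes B: "B \<in> carrier_mat n n" and sym: "\<And>i j. i < n \<Longrightarrow> j < n \<Longrightarrow> B $$ (i, j) = B $$ (j, i)"
  shows "size (proots (char_poly B)) = n" 
    "(\<Sum>e\<in>#proots (char_poly B). e ^ l) = mat_trace (B ^\<^sub>m l)"
proof -
  obtain es where es: "char_poly B = (\<Prod>e\<leftarrow>es. [:- e, 1:])" "length es = n"
    using char_poly_symmetric_splits[OF B sym] by auto
  obtain U Q R where UQR: "schur_decomposition B es = (U, Q, R)" by (metis prod_cases3)
  have wit: "similar_mat_wit B U Q R" and ut: "upper_triangular U" and diag: "diag_mat U = es"
    using schur_decomposition[OF B es(1) UQR] by auto
  have carr: "U \<in> carrier_mat n n" "Q \<in> carrier_mat n n" "R \<in> carrier_mat n n" and RQ: "R * Q = 1\<^sub>m n"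
    using similar_mat_witD2[OF B wit] by auto
  have roots: "proots (char_poly B) = mset es" unfolding es(1) by (rule proots_prod_linear)
  show "size (proots (char_poly B)) = n" using roots es(2) by simp
  have Ul: "U ^\<^sub>m l \<in> carrier_mat n n" using carr by simp
  have "mat_trace (B ^\<^sub>m l) = mat_trace ((Q * U ^\<^sub>m l) * R)"
    using similar_mat_wit_pow_id[OF wit, of l] by simp
  also have "\<dots> = mat_trace (R * (Q * U ^\<^sub>m l))"
    using carr Ul by (intro mat_trace_mult_comm[of _ n]) auto
  also have "R * (Q * U ^\<^sub>m l) = U ^\<^sub>m l"
    using carr Ul RQ by (simp flip: assoc_mult_mat[OF carr(3) carr(2) Ul])
  also have "mat_trace (U ^\<^sub>m l) = (\<Sum>i<n. U $$ (i, i) ^ l)"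
    using upper_triangular_pow[OF carr(1) ut, of l] Ul unfolding mat_trace_def by (intro sum.cong) auto
  also have "\<dots> = (\<Sum>i<n. es ! i ^ l)"
    using diag carr(1) by (intro sum.cong) (auto simp: diag_mat_def)
  also have "\<dots> = sum_list (map (\<lambda>e. e ^ l) es)"
    using es(2) by (simp add: sum_list_sum_nth lessThan_atLeast0)
  also have "\<dots> = (\<Sum>e\<in>#proots (char_poly B). e ^ l)"
    unfolding roots by (simp flip: sum_mset_sum_list mset_map)
  finally show "(\<Sum>e\<in>#proots (char_poly B). e ^ l) = mat_trace (B ^\<^sub>m l)" by simp
qed

text \<open>Polynomials, because it is the power sums of a random spectrum that are known to be
  measurable. They arise by Weierstrass approximation on [-k, k] of a continuous step of width 1 /
  (k + 1), with error below 1 / (k + 1); each e eventually lies in the window.\<close>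

lemma polynomials_tendsto_indicator_atMost:
  "\<exists>(a :: nat \<Rightarrow> nat \<Rightarrow> real) d. \<forall>e. (\<lambda>k. \<Sum>i\<le>d k. a k i * e ^ i) \<longlonglongrightarrow> (if e \<le> x then 1 else 0)"
proof -
  \<comment> \<open>The ramp falls from 1 to 0 on the right of x, so that the limit at x itself is
    1, as for the closed half-line.\<close>
  define f where "f k = cts_step x (x + inverse (real (Suc k)))" for k
  have "\<exists>g. real_polynomial_function g \<and> (\<forall>e\<in>{- real k..real k}. \<bar>f k e - g e\<bar> < inverse (real (Suc k)))" for k
  proof -
    have "uniformly_continuous_on UNIV (f k)"
      unfolding f_def by (intro cts_step_uniformly_continuous) auto
    then have "continuous_on {- real k..real k} (f k)"
      by (meson continuous_on_subset subset_UNIV uniformly_continuous_imp_continuous)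
    then show ?thesis
      using Stone_Weierstrass_real_polynomial_function[of "{- real k..real k}" "f k" "inverse (real (Suc k))"]
      by (metis compact_Icc inverse_positive_iff_positive of_nat_0_less_iff zero_less_Suc)
  qed
  then obtain g where g: "\<And>k. real_polynomial_function (g k)" 
      "\<And>k e. e \<in> {- real k..real k} \<Longrightarrow> \<bar>f k e - g k e\<bar> < inverse (real (Suc k))"
    by metis
  obtain a d where ad: "\<And>k. g k = (\<lambda>e. \<Sum>i\<le>d k. a k i * e ^ i)"
    using g(1) unfolding real_polynomial_function_iff_sum by metis
  have "(\<lambda>k. g k e) \<longlonglongrightarrow> (if e \<le> x then 1 else 0)" for e
  proof -
    have ev1: "\<forall>\<^sub>F k in sequentially. f k e = (if e \<le> x then 1 else 0)"
    proof (cases "e \<le> x")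
      case True
      then show ?thesis by (simp add: f_def cts_step_def)
    next
      case False
      have "\<forall>\<^sub>F k in sequentially. inverse (real (Suc k)) < e - x"
        using LIMSEQ_inverse_real_of_nat False by (intro order_tendstoD) auto
      then show ?thesis by eventually_elim (use False in \<open>auto simp: f_def cts_step_def\<close>)
    qed
    have ev2: "\<forall>\<^sub>F k in sequentially. e \<in> {- real k..real k}"
      by (rule eventually_sequentiallyI[of "nat \<lceil>\<bar>e\<bar>\<rceil>"]) (auto; linarith)
    have "\<forall>\<^sub>F k in sequentially. norm (g k e - (if e \<le> x then 1 else 0)) \<le> inverse (real (Suc k))"
      using ev1 ev2
    proof eventually_elim
      case (elim k)
      then show ?case using g(2)[OF elim(2)] by (metis abs_minus_commute less_imp_le real_norm_def)
    qed
    then have "(\<lambda>k. g k e - (if e \<le> x then 1 else 0)) \<longlonglongrightarrow> 0"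
      by (rule Lim_null_comparison[OF _ LIMSEQ_inverse_real_of_nat])
    then show ?thesis by (rule LIM_zero_cancel)
  qed
  then show ?thesis unfolding ad by blast
qed

lemma tendsto_sum_mset:
  fixes f :: "'i \<Rightarrow> 'a \<Rightarrow> 'b::real_normed_vector"
  shows "(\<And>e. ((\<lambda>k. f k e) \<longlongrightarrow> g e) F) \<Longrightarrow> ((\<lambda>k. \<Sum>e\<in>#M. f k e) \<longlongrightarrow> (\<Sum>e\<in>#M. g e)) F"
  by (induction M) (auto intro!: tendsto_add)

lemma sum_mset_poly:
  "(\<Sum>e\<in>#M. \<Sum>i\<le>d. a i * (e::real) ^ i) = (\<Sum>i\<le>d. a i * (\<Sum>e\<in>#M. e ^ i))"
  by (induction M) (auto simp: algebra_simps sum.distrib)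

lemma size_filter_mset_eq_sum: "real (size (filter_mset P M)) = (\<Sum>e\<in>#M. if P e then 1 else 0)"
  by (induction M) auto

text \<open>Turns an event about an ordered eigenvalue into one about the counting function.
  Positions start at 0, hence the strict inequality.\<close>

lemma sorted_nth_le_iff:
  "sorted xs \<Longrightarrow> j < length xs \<Longrightarrow> xs ! j \<le> x \<longleftrightarrow> j < length (filter (\<lambda>e. e \<le> x) xs)"
  for xs :: "'a::linorder list"
proof (induction xs arbitrary: j)
  case (Cons y ys)
  show ?case
  proof (cases "y \<le> x")
    case True
    then show ?thesis using Cons by (cases j) auto
  next
    case False
    then have "filter (\<lambda>e. e \<le> x) (y # ys) = []" using Cons.prems(1) by (auto simp: filter_empty_conv)
    moreover have "\<not> (y # ys) ! j \<le> x"
      using False Cons.prems by (cases j) (auto simp: not_le intro: less_le_trans)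
    ultimately show ?thesis by simp
  qed
qed simp

lemma sum_mset_nth_sorted_list:
  "(\<Sum>j<size M. f (sorted_list_of_multiset M ! j)) = (\<Sum>e\<in>#M. f e)" for f :: "'a::linorder \<Rightarrow> 'b::comm_monoid_add"
proof -
  have len: "length (sorted_list_of_multiset M) = size M"
    by (metis mset_sorted_list_of_multiset size_mset)
  have "(\<Sum>j<size M. f (sorted_list_of_multiset M ! j)) = sum_list (map f (sorted_list_of_multiset M))"
    using len by (simp add: sum_list_sum_nth lessThan_atLeast0)
  also have "\<dots> = (\<Sum>e\<in>#M. f e)"
    by (metis mset_map mset_sorted_list_of_multiset sum_mset_sum_list)
  finally show ?thesis .
qed

text \<open>The power sums determine the counting function of the spectrum through polynomial
  approximation of indicators, so it is measurable; hence so are the ordered eigenvalues, and the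
  law of a uniformly chosen one is the expected spectral law.\<close>

lemma (in prob_space) expected_spectral_law:
  fixes E :: "'a \<Rightarrow> real multiset"
  assumes n: "n \<ge> 1" and size: "\<And>\<omega>. size (E \<omega>) = n"
    and int: "\<And>k. integrable M (\<lambda>\<omega>. \<Sum>e\<in>#E \<omega>. e ^ k)"
  shows "\<exists>\<nu>. real_distribution \<nu> \<and> (\<forall>k. integrable \<nu> (\<lambda>x. x ^ k)) \<and>
    (\<forall>k. (\<integral>x. x ^ k \<partial>\<nu>) = expectation (\<lambda>\<omega>. \<Sum>e\<in>#E \<omega>. e ^ k) / real n) \<and>
    (\<forall>x. cdf \<nu> x = expectation (\<lambda>\<omega>. real (size (filter_mset (\<lambda>e. e \<le> x) (E \<omega>))) / real n))"
proof -
  \<comment> \<open>The eigenvalues in increasing order; the value 0 from position n on makes every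
    \<open>ev j\<close> a random variable, over the whole index type.\<close>
  define ev where "ev j \<omega> = (if j < n then sorted_list_of_multiset (E \<omega>) ! j else 0)" for j \<omega>
  have len: "length (sorted_list_of_multiset (E \<omega>)) = n" for \<omega>
    using size[of \<omega>] by (metis mset_sorted_list_of_multiset size_mset)
  have sum_ev: "(\<Sum>j<n. f (ev j \<omega>)) = (\<Sum>e\<in>#E \<omega>. f e)" for f :: "real \<Rightarrow> real" and \<omega>
    using sum_mset_nth_sorted_list[of f "E \<omega>"] size[of \<omega>] by (simp add: ev_def)
  have meas_count: "(\<lambda>\<omega>. real (size (filter_mset (\<lambda>e. e \<le> x) (E \<omega>)))) \<in> borel_measurable M" for x
  proof -
    obtain a :: "nat \<Rightarrow> nat \<Rightarrow> real" and d where
      ad: "\<And>e. (\<lambda>k. \<Sum>i\<le>d k. a k i * e ^ i) \<longlonglongrightarrow> (if e \<le> x then 1 else 0)"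
      using polynomials_tendsto_indicator_atMost[of x] by metis
    show ?thesis
    proof (rule borel_measurable_LIMSEQ_real)
      fix \<omega>
      show "(\<lambda>k. \<Sum>i\<le>d k. a k i * (\<Sum>e\<in>#E \<omega>. e ^ i)) \<longlonglongrightarrow> real (size (filter_mset (\<lambda>e. e \<le> x) (E \<omega>)))"
        unfolding sum_mset_poly[symmetric] size_filter_mset_eq_sum by (rule tendsto_sum_mset) (rule ad)
    next
      fix k
      have "(\<lambda>\<omega>. \<Sum>e\<in>#E \<omega>. e ^ i) \<in> borel_measurable M" for i using int by (rule borel_measurable_integrable)
      then show "(\<lambda>\<omega>. \<Sum>i\<le>d k. a k i * (\<Sum>e\<in>#E \<omega>. e ^ i)) \<in> borel_measurable M" 
        by (intro borel_measurable_sum borel_measurable_times borel_measurable_const)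
    qed
  qed
  have meas_ev: "ev j \<in> borel_measurable M" for j
  proof (cases "j < n")
    case True
    show ?thesis
      unfolding borel_measurable_iff_le
    proof
      fix x
      have "ev j \<omega> \<le> x \<longleftrightarrow> real j < real (size (filter_mset (\<lambda>e. e \<le> x) (E \<omega>)))" for \<omega>
      proof -
        have "ev j \<omega> \<le> x \<longleftrightarrow> j < length (filter (\<lambda>e. e \<le> x) (sorted_list_of_multiset (E \<omega>)))"
          using True len sorted_nth_le_iff[of "sorted_list_of_multiset (E \<omega>)" j x] by (simp add: ev_def)
        also have "length (filter (\<lambda>e. e \<le> x) (sorted_list_of_multiset (E \<omega>))) = size (filter_mset (\<lambda>e. e \<le> x) (E \<omega>))"
          by (metis mset_filter mset_sorted_list_of_multiset size_mset)
        finally show ?thesis by simp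
      qed
      then have "{\<omega> \<in> space M. ev j \<omega> \<le> x} = {\<omega> \<in> space M. real j < real (size (filter_mset (\<lambda>e. e \<le> x) (E \<omega>)))}" by simp
      also have "\<dots> \<in> sets M" using meas_count by (intro borel_measurable_less borel_measurable_const)
      finally show "{\<omega> \<in> space M. ev j \<omega> \<le> x} \<in> sets M" .
    qed
  qed (simp add: ev_def[abs_def])
  \<comment> \<open>A uniformly chosen position: jointly with \<open>M\<close>, the eigenvalue at
    that position has as its law the average of the n eigenvalue laws.\<close>
  define Q where "Q = measure_pmf (pmf_of_set {..<n})"
  have fin: "finite {..<n}" "{..<n} \<noteq> {}" using n by (auto simp: lessThan_empty_iff bot_nat_def)
  interpret Q: prob_space Q unfolding Q_def by (rule measure_pmf.prob_space_axioms)
  interpret QP: pair_prob_space Q M ..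
  \<comment> \<open>Q lives on a countable discrete space, so joint measurability follows from that
    of each \<open>ev j\<close>.\<close>
  have meas_pair: "(\<lambda>(j, \<omega>). f (ev j \<omega>)) \<in> borel_measurable (Q \<Otimes>\<^sub>M M)"
    if [measurable]: "f \<in> borel_measurable borel" for f :: "real \<Rightarrow> real"
  proof -
    have "(\<lambda>(j, \<omega>). f (ev j \<omega>)) \<in> borel_measurable (count_space UNIV \<Otimes>\<^sub>M M)"
      using meas_ev by (intro measurable_pair_measure_countable1) auto
    moreover have "sets (count_space UNIV \<Otimes>\<^sub>M M) = sets (Q \<Otimes>\<^sub>M M)"
      by (intro sets_pair_measure_cong) (auto simp: Q_def)
    ultimately show ?thesis using measurable_cong_sets[OF _ refl] by blast
  qed
  define \<nu> where "\<nu> = distr (Q \<Otimes>\<^sub>M M) borel (\<lambda>(j, \<omega>). ev j \<omega>)"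
  have m1: "(\<lambda>(j, \<omega>). ev j \<omega>) \<in> borel_measurable (Q \<Otimes>\<^sub>M M)" using meas_pair[of "\<lambda>x. x"] by simp
  have rd: "real_distribution \<nu>"
    unfolding \<nu>_def using QP.prob_space_distr[OF m1]
    by (intro real_distribution.intro real_distribution_axioms.intro) auto
  have law: "integrable \<nu> f" "(\<integral>x. f x \<partial>\<nu>) = expectation (\<lambda>\<omega>. \<Sum>e\<in>#E \<omega>. f e) / real n"
    if [measurable]: "f \<in> borel_measurable borel" and i: "\<And>j. integrable M (\<lambda>\<omega>. f (ev j \<omega>))" for f :: "real \<Rightarrow> real"
  proof -
    have ip: "integrable (Q \<Otimes>\<^sub>M M) (\<lambda>(j, \<omega>). f (ev j \<omega>))"
    proof (rule QP.Fubini_integrable)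
      show "integrable Q (\<lambda>j. \<integral>\<omega>. norm (case (j, \<omega>) of (j, \<omega>) \<Rightarrow> f (ev j \<omega>)) \<partial>M)"
        unfolding Q_def using fin by (intro integrable_measure_pmf_finite) auto
    qed (use i meas_pair in auto)
    then show "integrable \<nu> f"
      unfolding \<nu>_def using m1 by (subst integrable_distr_eq) (simp_all add: case_prod_unfold)
    have "(\<integral>x. f x \<partial>\<nu>) = (\<integral>p. (case p of (j, \<omega>) \<Rightarrow> f (ev j \<omega>)) \<partial>(Q \<Otimes>\<^sub>M M))"
      unfolding \<nu>_def using m1 by (subst integral_distr) (simp_all add: case_prod_unfold)
    also have "\<dots> = (\<integral>j. expectation (\<lambda>\<omega>. f (ev j \<omega>)) \<partial>Q)"
      using QP.integral_fst'[OF ip] by simp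
    also have "\<dots> = (\<Sum>j<n. expectation (\<lambda>\<omega>. f (ev j \<omega>))) / real n"
      unfolding Q_def using integral_pmf_of_set[OF fin(2,1)] by simp
    also have "(\<Sum>j<n. expectation (\<lambda>\<omega>. f (ev j \<omega>))) = expectation (\<lambda>\<omega>. \<Sum>j<n. f (ev j \<omega>))"
      using i by (intro Bochner_Integration.integral_sum[symmetric])
    finally show "(\<integral>x. f x \<partial>\<nu>) = expectation (\<lambda>\<omega>. \<Sum>e\<in>#E \<omega>. f e) / real n"
      unfolding sum_ev .
  qed
  \<comment> \<open>All summands of an even power sum are nonnegative, so a single eigenvalue is
    dominated by the whole sum, which is integrable by hypothesis.\<close>
  have pow_int: "integrable M (\<lambda>\<omega>. ev j \<omega> ^ k)" for j k
  proof (rule Bochner_Integration.integrable_bound)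
    show "integrable M (\<lambda>\<omega>. 1 + (\<Sum>e\<in>#E \<omega>. e ^ (2 * k)))" using int by (intro Bochner_Integration.integrable_add) auto
    show "(\<lambda>\<omega>. ev j \<omega> ^ k) \<in> borel_measurable M" using meas_ev by (intro borel_measurable_power)
    have "\<bar>ev j \<omega> ^ k\<bar> \<le> 1 + (\<Sum>e\<in>#E \<omega>. e ^ (2 * k))" for \<omega>
    proof -
      have pos: "0 \<le> (\<Sum>i<n. ev i \<omega> ^ (2 * k))" by (intro sum_nonneg) simp
      have "\<bar>ev j \<omega>\<bar> ^ k \<le> 1 + \<bar>ev j \<omega>\<bar> ^ (2 * k)" by (rule power_le_one_plus_power) auto
      also have "\<bar>ev j \<omega>\<bar> ^ (2 * k) = ev j \<omega> ^ (2 * k)" by (simp add: power_mult)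
      finally have 1: "\<bar>ev j \<omega> ^ k\<bar> \<le> 1 + ev j \<omega> ^ (2 * k)" by (simp add: power_abs)
      have 2: "ev j \<omega> ^ (2 * k) \<le> (\<Sum>i<n. ev i \<omega> ^ (2 * k))" if "j < n"
        using that by (intro member_le_sum) auto
      show ?thesis
      proof (cases "j < n")
        case True
        then show ?thesis using 1 2 unfolding sum_ev[of "\<lambda>x. x ^ (2 * k)", symmetric] by linarith
      next
        case False
        \<comment> \<open>For k = 0 the default value gives 0 ^ 0 = 1, so the bound is 1 and not
          0.\<close>
        then have "\<bar>ev j \<omega> ^ k\<bar> \<le> 1" by (simp add: ev_def power_0_left)
        then show ?thesis using pos unfolding sum_ev[of "\<lambda>x. x ^ (2 * k)", symmetric] by linarith
      qed
    qed
    then show "AE \<omega> in M. norm (ev j \<omega> ^ k) \<le> norm (1 + (\<Sum>e\<in>#E \<omega>. e ^ (2 * k)))"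
      by (intro AE_I2) (simp only: real_norm_def, erule meta_allE, erule order_trans[OF _ abs_ge_self])
  qed
  have cdf: "cdf \<nu> x = expectation (\<lambda>\<omega>. real (size (filter_mset (\<lambda>e. e \<le> x) (E \<omega>))) / real n)" for x
  proof -
    interpret \<nu>: real_distribution \<nu> by (rule rd)
    have "cdf \<nu> x = (\<integral>y. indicator {..x} y \<partial>\<nu>)" by (simp add: cdf_def)
    also have "\<dots> = expectation (\<lambda>\<omega>. \<Sum>e\<in>#E \<omega>. indicator {..x} e) / real n"
      using meas_ev by (intro law(2) integrable_const_bound[where B = 1]) (auto simp: indicator_def)
    also have "(\<lambda>\<omega>. \<Sum>e\<in>#E \<omega>. indicator {..x} e) = (\<lambda>\<omega>. real (size (filter_mset (\<lambda>e. e \<le> x) (E \<omega>))))"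
      unfolding size_filter_mset_eq_sum by (simp add: indicator_def of_bool_def)
    finally show ?thesis by simp
  qed
  show ?thesis
    using rd law[OF _ pow_int] cdf by (intro exI[of _ \<nu>]) auto
qed

section \<open>Non-commutative probability spaces\<close>

lemma fun_sum_apply: "(\<Sum>i\<in>I. f i) \<omega> = (\<Sum>i\<in>I. f i \<omega>)" for f :: "'i \<Rightarrow> 'w \<Rightarrow> 'b::comm_monoid_add"
  by (induction I rule: infinite_finite_induct) (auto simp: zero_fun_def plus_fun_def)

text \<open>Rounding a real exponent up dominates the power, with 1 added for values below 1; the
  constant is integrable over a finite measure. Order 0 is separate, since 0 powr 0 = 0 whereas 0 ^
  0 = 1.\<close>

lemma (in finite_measure) all_moments_eq: "all_moments M = {f. has_moments M f}"
proof (intro Set.set_eqI iffI)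
  fix f :: "'a \<Rightarrow> complex" assume f: "f \<in> all_moments M"
  have "integrable M (\<lambda>\<omega>. norm (f \<omega>) ^ p)" for p :: nat
  proof (cases "p = 0")
    case False
    then have "norm (f \<omega>) powr real p = norm (f \<omega>) ^ p" for \<omega>
      by (cases "f \<omega> = 0") (auto simp: powr_realpow)
    moreover have "integrable M (\<lambda>\<omega>. norm (f \<omega>) powr real p)"
      using f False unfolding all_moments_def by auto
    ultimately show ?thesis by simp
  qed simp
  then show "f \<in> {f. has_moments M f}" using f unfolding all_moments_def has_moments_def by auto
next
  fix f :: "'a \<Rightarrow> complex" assume "f \<in> {f. has_moments M f}"
  then have f: "has_moments M f" by simp
  then have [measurable]: "f \<in> borel_measurable M" by (rule has_moments_measurable)
  have "integrable M (\<lambda>\<omega>. norm (f \<omega>) powr p)" if p: "p \<ge> 1" for p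
  proof (rule Bochner_Integration.integrable_bound)
    show "integrable M (\<lambda>\<omega>. 1 + norm (f \<omega>) ^ nat \<lceil>p\<rceil>)"
      using has_moments_integrable_norm_power[OF f] by (intro Bochner_Integration.integrable_add) auto
    have "norm (f \<omega>) powr p \<le> 1 + norm (f \<omega>) ^ nat \<lceil>p\<rceil>" for \<omega>
    proof (cases "norm (f \<omega>) \<le> 1")
      case True
      then have "norm (f \<omega>) powr p \<le> 1" using p by (intro powr_le1) auto
      then show ?thesis by (simp add: add_increasing2)
    next
      case False
      then have "norm (f \<omega>) powr p \<le> norm (f \<omega>) powr real (nat \<lceil>p\<rceil>)"
        using p by (intro powr_mono) auto
      also have "\<dots> = norm (f \<omega>) ^ nat \<lceil>p\<rceil>" using False by (intro powr_realpow) auto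
      finally show ?thesis by simp
    qed
    then show "AE \<omega> in M. norm (norm (f \<omega>) powr p) \<le> norm (1 + norm (f \<omega>) ^ nat \<lceil>p\<rceil>)" by simp
  qed measurable
  then show "f \<in> all_moments M" unfolding all_moments_def by auto
qed

lemma random_matrix_space_simps:
  "carrier (random_matrix_space P n) = {B \<in> carrier_mat n n. \<forall>i<n. \<forall>j<n. B $$ (i, j) \<in> all_moments P}"
  "x \<otimes>\<^bsub>random_matrix_space P n\<^esub> y = x * y"
  "\<one>\<^bsub>random_matrix_space P n\<^esub> = 1\<^sub>m n"
  "\<zero>\<^bsub>random_matrix_space P n\<^esub> = 0\<^sub>m n n"
  "x \<oplus>\<^bsub>random_matrix_space P n\<^esub> y = x + y"
  "c \<odot>\<^bsub>random_matrix_space P n\<^esub> x = (\<lambda>_. c) \<cdot>\<^sub>m x"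
  "star (random_matrix_space P n) x = Matrix.mat n n (\<lambda>(i, j). \<lambda>\<omega>. cnj ((x $$ (j, i)) \<omega>))"
  "state (random_matrix_space P n) x = (\<integral>\<omega>. mat_trace x \<omega> \<partial>P) / of_nat n"
  by (simp_all add: random_matrix_space_def)

section \<open>The star algebra of random matrices\<close>

context prob_space
begin

lemma all_moments_closed:
  "f \<in> all_moments M \<Longrightarrow> g \<in> all_moments M \<Longrightarrow> f + g \<in> all_moments M"
  "f \<in> all_moments M \<Longrightarrow> g \<in> all_moments M \<Longrightarrow> f * g \<in> all_moments M"
  "(\<lambda>_. c) \<in> all_moments M" "0 \<in> all_moments M" "1 \<in> all_moments M"
  "f \<in> all_moments M \<Longrightarrow> - f \<in> all_moments M"
  "f \<in> all_moments M \<Longrightarrow> (\<lambda>\<omega>. cnj (f \<omega>)) \<in> all_moments M"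
  "(\<And>i. i \<in> I \<Longrightarrow> h i \<in> all_moments M) \<Longrightarrow> (\<Sum>i\<in>I. h i) \<in> all_moments M"
proof -
  show c: "(\<lambda>_. c) \<in> all_moments M" for c by (simp add: all_moments_eq has_moments_const)
  show "0 \<in> all_moments M" "1 \<in> all_moments M" using c by (simp_all add: zero_fun_def one_fun_def)
  show add: "f \<in> all_moments M \<Longrightarrow> g \<in> all_moments M \<Longrightarrow> f + g \<in> all_moments M" for f g
    by (simp add: all_moments_eq plus_fun_def has_moments_add)
  show mult: "f \<in> all_moments M \<Longrightarrow> g \<in> all_moments M \<Longrightarrow> f * g \<in> all_moments M" for f g
    by (simp add: all_moments_eq times_fun_def has_moments_mult)
  show "- f \<in> all_moments M" if "f \<in> all_moments M"
  proof -
    have "- f = (\<lambda>_. -1) * f" by (simp add: times_fun_def fun_Compl_def fun_eq_iff)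
    then show ?thesis using mult[OF c that] by simp
  qed
  show "(\<lambda>\<omega>. cnj (f \<omega>)) \<in> all_moments M" if "f \<in> all_moments M"
  proof -
    have "(\<lambda>\<omega>. cnj (f \<omega>)) \<in> borel_measurable M"
      using that by (intro measurable_compose[of f M borel cnj borel] borel_measurable_continuous_onI)
        (auto simp: all_moments_def intro!: continuous_intros)
    then show ?thesis using that by (auto simp: all_moments_eq has_moments_def)
  qed
  show "(\<Sum>i\<in>I. h i) \<in> all_moments M" if "\<And>i. i \<in> I \<Longrightarrow> h i \<in> all_moments M"
    using that by (induction I rule: infinite_finite_induct) (auto intro: add \<open>0 \<in> all_moments M\<close>)
qed

lemma all_moments_integrable: "f \<in> all_moments M \<Longrightarrow> integrable M f"
  by (simp add: all_moments_eq has_moments_integrable)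

lemma mat_trace_apply: "x \<in> carrier_mat n n \<Longrightarrow> mat_trace x \<omega> = (\<Sum>i<n. (x $$ (i, i)) \<omega>)"
  by (simp add: mat_trace_def fun_sum_apply)

lemma mat_mult_index: "x \<in> carrier_mat n n \<Longrightarrow> y \<in> carrier_mat n n \<Longrightarrow> i < n \<Longrightarrow> j < n \<Longrightarrow>
    (x * y) $$ (i, j) = (\<Sum>k<n. x $$ (i, k) * y $$ (k, j))" for x :: "'b::semiring_0 mat"
  by (simp add: scalar_prod_def lessThan_atLeast0)

lemma random_matrix_ring: "ring (random_matrix_space M n)"
proof (rule ringI)
  let ?R = "random_matrix_space M n"
  show "abelian_group ?R"
  proof (rule abelian_groupI)
    fix x assume x: "x \<in> carrier ?R"
    then show "\<exists>y\<in>carrier ?R. y \<oplus>\<^bsub>?R\<^esub> x = \<zero>\<^bsub>?R\<^esub>"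
      by (intro bexI[of _ "- x"]) (auto simp: random_matrix_space_simps all_moments_closed)
  qed (auto simp: random_matrix_space_simps all_moments_closed intro!: eq_matI simp: add_ac)
  show "Group.monoid ?R"
  proof (rule monoidI)
    fix x y assume x: "x \<in> carrier ?R" and y: "y \<in> carrier ?R"
    then have xc: "x \<in> carrier_mat n n" and yc: "y \<in> carrier_mat n n" by (auto simp: random_matrix_space_simps)
    have "(x * y) $$ (i, j) \<in> all_moments M" if "i < n" "j < n" for i j
      unfolding mat_mult_index[OF xc yc that] using x y that
      by (intro all_moments_closed) (auto simp: random_matrix_space_simps)
    then show "x \<otimes>\<^bsub>?R\<^esub> y \<in> carrier ?R" using xc yc by (simp add: random_matrix_space_simps)
  qed (auto simp: random_matrix_space_simps all_moments_closed one_mat_def[symmetric] intro: assoc_mult_mat)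
qed (auto simp: random_matrix_space_simps add_mult_distrib_mat mult_add_distrib_mat)

lemma random_matrix_module: "module (class_ring :: complex ring) (random_matrix_space M n)"
proof (rule moduleI)
  interpret R: ring "random_matrix_space M n" by (rule random_matrix_ring)
  show "abelian_group (random_matrix_space M n)" by (rule R.abelian_group_axioms)
  show "cring (class_ring :: complex ring)" by (rule class_cring.cring_axioms)
qed (auto simp: random_matrix_space_simps all_moments_closed times_fun_def plus_fun_def algebra_simps fun_eq_iff
    intro!: eq_matI all_moments_closed(2)[of "\<lambda>_. _", unfolded times_fun_def])

text \<open>Positivity holds because the trace of a matrix multiplied from the left by its adjoint
  is pointwise the sum of the squared moduli of its entries. With n >= 1 the state of the unit is n
  / n = 1.\<close>

lemma random_matrix_star_prob_space:
  assumes n: "n \<ge> 1"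
  shows "star_prob_space (random_matrix_space M n)"
proof (intro star_prob_space.intro star_prob_space_axioms.intro random_matrix_ring random_matrix_module)
  let ?R = "random_matrix_space M n"
  have tr_int: "integrable M (mat_trace x)" if "x \<in> carrier ?R" for x
  proof -
    have "mat_trace x \<in> all_moments M"
      unfolding mat_trace_def using that by (intro all_moments_closed) (auto simp: random_matrix_space_simps)
    then show ?thesis by (rule all_moments_integrable)
  qed
  {
    fix x y c assume "x \<in> carrier ?R" "y \<in> carrier ?R"
    then show "(c \<odot>\<^bsub>?R\<^esub> x) \<otimes>\<^bsub>?R\<^esub> y = c \<odot>\<^bsub>?R\<^esub> (x \<otimes>\<^bsub>?R\<^esub> y)"
      "x \<otimes>\<^bsub>?R\<^esub> (c \<odot>\<^bsub>?R\<^esub> y) = c \<odot>\<^bsub>?R\<^esub> (x \<otimes>\<^bsub>?R\<^esub> y)"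
      by (auto simp: random_matrix_space_simps)
  }
  {
    fix x assume x: "x \<in> carrier ?R"
    then show "star ?R x \<in> carrier ?R"
      by (auto simp: random_matrix_space_simps all_moments_closed)
    show "star ?R (star ?R x) = x" "star ?R (c \<odot>\<^bsub>?R\<^esub> x) = cnj c \<odot>\<^bsub>?R\<^esub> star ?R x" for c
      using x by (auto simp: random_matrix_space_simps times_fun_def intro!: eq_matI)
    show "state ?R (c \<odot>\<^bsub>?R\<^esub> x) = c * state ?R x" for c
    proof -
      have "mat_trace ((\<lambda>_. c) \<cdot>\<^sub>m x) \<omega> = c * mat_trace x \<omega>" for \<omega>
      proof -
        have xc: "x \<in> carrier_mat n n" using x by (simp add: random_matrix_space_simps)
        then show ?thesis
          unfolding mat_trace_apply[OF xc] mat_trace_apply[OF smult_carrier_mat[OF xc]] sum_distrib_left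
          by (intro sum.cong) (auto simp: times_fun_def)
      qed
      then show ?thesis by (simp add: random_matrix_space_simps)
    qed
    show "state ?R (star ?R x \<otimes>\<^bsub>?R\<^esub> x) \<in> \<real>\<^sub>\<ge>\<^sub>0"
    proof -
      have xc: "x \<in> carrier_mat n n" using x by (simp add: random_matrix_space_simps)
      have "mat_trace (star ?R x * x) \<omega> = complex_of_real (\<Sum>i<n. \<Sum>k<n. (cmod ((x $$ (k, i)) \<omega>))\<^sup>2)" for \<omega>
      proof -
        have sc: "star ?R x \<in> carrier_mat n n" by (simp add: random_matrix_space_simps)
        then have "mat_trace (star ?R x * x) \<omega> = (\<Sum>i<n. ((star ?R x * x) $$ (i, i)) \<omega>)"
          using xc by (intro mat_trace_apply) auto
        also have "\<dots> = (\<Sum>i<n. \<Sum>k<n. cnj ((x $$ (k, i)) \<omega>) * (x $$ (k, i)) \<omega>)"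
          by (intro sum.cong refl)
             (simp add: mat_mult_index[OF sc xc] fun_sum_apply times_fun_def, simp add: random_matrix_space_simps)
        also have "\<dots> = complex_of_real (\<Sum>i<n. \<Sum>k<n. (cmod ((x $$ (k, i)) \<omega>))\<^sup>2)"
          unfolding of_real_sum complex_norm_square by (simp add: mult.commute)
        finally show ?thesis .
      qed
      then have "state ?R (star ?R x \<otimes>\<^bsub>?R\<^esub> x) =
          complex_of_real ((\<integral>\<omega>. (\<Sum>i<n. \<Sum>k<n. (cmod ((x $$ (k, i)) \<omega>))\<^sup>2) \<partial>M) / real n)"
        by (simp add: random_matrix_space_simps(2,8) del: of_real_sum)
      also have "\<dots> \<in> \<real>\<^sub>\<ge>\<^sub>0"
        unfolding nonneg_Reals_of_real_iff
        by (intro divide_nonneg_nonneg Bochner_Integration.integral_nonneg sum_nonneg) auto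
      finally show ?thesis .
    qed
  }
  {
    fix x y assume x: "x \<in> carrier ?R" and y: "y \<in> carrier ?R"
    then have xc: "x \<in> carrier_mat n n" and yc: "y \<in> carrier_mat n n" by (auto simp: random_matrix_space_simps)
    show "star ?R (x \<oplus>\<^bsub>?R\<^esub> y) = star ?R x \<oplus>\<^bsub>?R\<^esub> star ?R y"
      using xc yc by (auto simp: random_matrix_space_simps plus_fun_def intro!: eq_matI)
    show "star ?R (x \<otimes>\<^bsub>?R\<^esub> y) = star ?R y \<otimes>\<^bsub>?R\<^esub> star ?R x"
    proof (rule eq_matI)
      fix i j assume "i < dim_row (star ?R y \<otimes>\<^bsub>?R\<^esub> star ?R x)" "j < dim_col (star ?R y \<otimes>\<^bsub>?R\<^esub> star ?R x)"
      then have ij: "i < n" "j < n" by (auto simp: random_matrix_space_simps)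
      have sc: "star ?R x \<in> carrier_mat n n" "star ?R y \<in> carrier_mat n n" by (auto simp: random_matrix_space_simps)
      have "(star ?R (x * y) $$ (i, j)) \<omega> = ((star ?R y * star ?R x) $$ (i, j)) \<omega>" for \<omega>
      proof -
        have "(star ?R (x * y) $$ (i, j)) \<omega> = cnj (((x * y) $$ (j, i)) \<omega>)"
          using ij by (simp add: random_matrix_space_simps)
        also have "\<dots> = (\<Sum>k<n. cnj ((y $$ (k, i)) \<omega>) * cnj ((x $$ (j, k)) \<omega>))"
          using ij by (simp add: mat_mult_index[OF xc yc] fun_sum_apply times_fun_def mult.commute)
        also have "\<dots> = ((star ?R y * star ?R x) $$ (i, j)) \<omega>"
          using ij unfolding mat_mult_index[OF sc(2,1) ij]
          by (simp add: fun_sum_apply times_fun_def random_matrix_space_simps)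
        finally show ?thesis .
      qed
      then show "star ?R (x \<otimes>\<^bsub>?R\<^esub> y) $$ (i, j) = (star ?R y \<otimes>\<^bsub>?R\<^esub> star ?R x) $$ (i, j)"
        by (simp add: random_matrix_space_simps(2) fun_eq_iff)
    qed (auto simp: random_matrix_space_simps)
    have "mat_trace (x + y) \<omega> = mat_trace x \<omega> + mat_trace y \<omega>" for \<omega>
      using xc yc by (simp add: mat_trace_apply[of _ n] plus_fun_def sum.distrib)
    then show "state ?R (x \<oplus>\<^bsub>?R\<^esub> y) = state ?R x + state ?R y"
      using tr_int[OF x] tr_int[OF y] by (simp add: random_matrix_space_simps add_divide_distrib)
  }
  have "mat_trace (1\<^sub>m n :: ('a \<Rightarrow> complex) mat) \<omega> = of_nat n" for \<omega>
    by (simp add: mat_trace_apply[of _ n] one_fun_def)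
  then show "state ?R \<one>\<^bsub>?R\<^esub> = 1"
    using n by (simp add: random_matrix_space_simps prob_space)
qed

text \<open>The entries form a ring under pointwise operations, so evaluation at \<omega> commutes
  with matrix multiplication.\<close>

lemma matrix_element_pow:
  assumes B: "\<And>\<omega>. B \<omega> \<in> carrier_mat n n"
  shows "matrix_element n B [^]\<^bsub>random_matrix_space M n\<^esub> (l::nat) = matrix_element n (\<lambda>\<omega>. B \<omega> ^\<^sub>m l)"
proof (induction l)
  case 0
  show ?case
    by (rule eq_matI)
       (auto simp: matrix_element_def nat_pow_def random_matrix_space_simps one_fun_def zero_fun_def carrier_matD(1)[OF B])
next
  case (Suc l)
  let ?R = "random_matrix_space M n"
  have Bl: "B \<omega> ^\<^sub>m l \<in> carrier_mat n n" for \<omega> using B by simp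
  have "matrix_element n B [^]\<^bsub>?R\<^esub> Suc l = matrix_element n (\<lambda>\<omega>. B \<omega> ^\<^sub>m l) * matrix_element n B"
    using Suc by (simp add: nat_pow_def random_matrix_space_simps)
  also have "\<dots> = matrix_element n (\<lambda>\<omega>. B \<omega> ^\<^sub>m Suc l)"
  proof (rule eq_matI)
    fix i j assume "i < dim_row (matrix_element n (\<lambda>\<omega>. B \<omega> ^\<^sub>m Suc l))" "j < dim_col (matrix_element n (\<lambda>\<omega>. B \<omega> ^\<^sub>m Suc l))"
    then have ij: "i < n" "j < n" by (auto simp: matrix_element_def)
    have mc: "matrix_element n C \<in> carrier_mat n n" for C :: "'a \<Rightarrow> real mat" by (simp add: matrix_element_def)
    show "(matrix_element n (\<lambda>\<omega>. B \<omega> ^\<^sub>m l) * matrix_element n B) $$ (i, j) = matrix_element n (\<lambda>\<omega>. B \<omega> ^\<^sub>m Suc l) $$ (i, j)"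
      unfolding mat_mult_index[OF mc mc ij]
      using ij by (auto simp: fun_eq_iff fun_sum_apply times_fun_def matrix_element_def mat_mult_index[OF Bl B ij])
  qed (auto simp: matrix_element_def)
  finally show ?case .
qed

lemma state_matrix_element_pow:
  assumes B: "\<And>\<omega>. B \<omega> \<in> carrier_mat n n"
  shows "state (random_matrix_space M n) (matrix_element n B [^]\<^bsub>random_matrix_space M n\<^esub> (l::nat)) =
    complex_of_real (expectation (\<lambda>\<omega>. mat_trace (B \<omega> ^\<^sub>m l)) / real n)"
proof -
  have "mat_trace (matrix_element n (\<lambda>\<omega>. B \<omega> ^\<^sub>m l)) \<omega> = complex_of_real (mat_trace (B \<omega> ^\<^sub>m l))" for \<omega>
  proof -
    have "dim_row (B \<omega> ^\<^sub>m l) = n" by (rule carrier_matD(1)[OF pow_carrier_mat[OF B]])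
    then show ?thesis
      by (subst mat_trace_apply[of _ n]) (auto simp: matrix_element_def mat_trace_def)
  qed
  then show ?thesis
    unfolding matrix_element_pow[OF B] by (simp add: random_matrix_space_simps)
qed

lemma matrix_element_self_adjoint:
  assumes sym: "\<And>\<omega> i j. i < n \<Longrightarrow> j < n \<Longrightarrow> B \<omega> $$ (i, j) = B \<omega> $$ (j, i)"
    and mom: "\<And>i j. i < n \<Longrightarrow> j < n \<Longrightarrow> has_moments M (\<lambda>\<omega>. B \<omega> $$ (i, j))"
  shows "self_adjoint (random_matrix_space M n) (matrix_element n B)"
proof -
  have "(\<lambda>\<omega>. complex_of_real (B \<omega> $$ (i, j))) \<in> all_moments M" if "i < n" "j < n" for i j
    using mom[OF that] by (auto simp: all_moments_eq has_moments_def)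
  then show ?thesis
    unfolding self_adjoint_def using sym
    by (auto simp: random_matrix_space_simps matrix_element_def fun_eq_iff intro!: eq_matI)
qed

end

text \<open>Complex polynomials in one self-adjoint indeterminate, integrated along the real axis.
  The indeterminate generates the algebra whatever \<nu> is; for finitely supported \<nu> the state
  is positive without being faithful.\<close>

definition polynomial_star_prob :: "real measure \<Rightarrow> complex poly star_prob" where
  "polynomial_star_prob \<nu> =
     \<lparr> carrier = UNIV, mult = (*), one = 1, zero = 0, add = (+), smult = Polynomial.smult,
       star = map_poly cnj, state = (\<lambda>p. \<integral>x. poly p (complex_of_real x) \<partial>\<nu>) \<rparr>"

lemma polynomial_star_prob_simps:
  "carrier (polynomial_star_prob \<nu>) = UNIV"
  "p \<otimes>\<^bsub>polynomial_star_prob \<nu>\<^esub> q = p * q"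
  "\<one>\<^bsub>polynomial_star_prob \<nu>\<^esub> = 1"
  "\<zero>\<^bsub>polynomial_star_prob \<nu>\<^esub> = 0"
  "p \<oplus>\<^bsub>polynomial_star_prob \<nu>\<^esub> q = p + q"
  "c \<odot>\<^bsub>polynomial_star_prob \<nu>\<^esub> p = Polynomial.smult c p"
  "star (polynomial_star_prob \<nu>) p = map_poly cnj p"
  "state (polynomial_star_prob \<nu>) p = (\<integral>x. poly p (complex_of_real x) \<partial>\<nu>)"
  by (simp_all add: polynomial_star_prob_def)

text \<open>Conjugating coefficients conjugates the values at real arguments, so integration over a
  law on the real line respects the star.\<close>

lemma poly_map_cnj_of_real: "poly (map_poly cnj p) (complex_of_real x) = cnj (poly p (complex_of_real x))"
  by (induction p) (auto simp: map_poly_pCons)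

lemma polynomial_star_prob_space:
  assumes rd: "real_distribution \<nu>" and int: "\<And>k. integrable \<nu> (\<lambda>x. x ^ k)"
  shows "star_prob_space (polynomial_star_prob \<nu>)"
proof -
  interpret real_distribution \<nu> by (rule rd)
  let ?A = "polynomial_star_prob \<nu>"
  have intp: "integrable \<nu> (\<lambda>x. poly p (complex_of_real x))" for p
  proof -
    have "integrable \<nu> (\<lambda>x. complex_of_real (x ^ k))" for k using int by (intro integrable_of_real)
    then show ?thesis unfolding poly_altdef
      by (intro Bochner_Integration.integrable_sum integrable_mult_right) (simp flip: of_real_power)
  qed
  have ring: "ring ?A"
  proof (rule ringI)
    show "abelian_group ?A"
    proof (rule abelian_groupI)
      fix p assume "p \<in> carrier ?A"
      show "\<exists>q\<in>carrier ?A. q \<oplus>\<^bsub>?A\<^esub> p = \<zero>\<^bsub>?A\<^esub>"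
        by (intro bexI[of _ "- p"]) (auto simp: polynomial_star_prob_simps)
    qed (auto simp: polynomial_star_prob_simps)
    show "Group.monoid ?A" by (rule monoidI) (auto simp: polynomial_star_prob_simps)
  qed (auto simp: polynomial_star_prob_simps algebra_simps)
  then interpret R: ring ?A .
  have module: "module (class_ring :: complex ring) ?A"
    by (rule moduleI[OF class_cring.cring_axioms R.abelian_group_axioms])
       (auto simp: polynomial_star_prob_simps smult_add_left smult_add_right)
  show ?thesis
  proof (intro star_prob_space.intro star_prob_space_axioms.intro ring module)
    fix p q :: "complex poly" and c :: complex
    show "star ?A (p \<otimes>\<^bsub>?A\<^esub> q) = star ?A q \<otimes>\<^bsub>?A\<^esub> star ?A p"
      by (rule poly_eqI) (simp add: polynomial_star_prob_simps coeff_map_poly coeff_mult mult.commute[of "map_poly cnj q"] cnj_sum)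
    show "state ?A (star ?A p \<otimes>\<^bsub>?A\<^esub> p) \<in> \<real>\<^sub>\<ge>\<^sub>0"
    proof -
      \<comment> \<open>On the real axis the product of p with its adjoint takes the value |p|^2, so
        the state integrates a nonnegative function.\<close>
      have "state ?A (star ?A p \<otimes>\<^bsub>?A\<^esub> p) = (\<integral>x. complex_of_real ((cmod (poly p (complex_of_real x)))\<^sup>2) \<partial>\<nu>)"
        unfolding polynomial_star_prob_simps poly_mult poly_map_cnj_of_real complex_norm_square
        by (simp add: mult.commute)
      also have "\<dots> = complex_of_real (\<integral>x. (cmod (poly p (complex_of_real x)))\<^sup>2 \<partial>\<nu>)"
        by (rule integral_complex_of_real)
      also have "\<dots> \<in> \<real>\<^sub>\<ge>\<^sub>0" unfolding nonneg_Reals_of_real_iff by simp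
      finally show ?thesis .
    qed
    show "state ?A (p \<oplus>\<^bsub>?A\<^esub> q) = state ?A p + state ?A q"
      using intp by (simp add: polynomial_star_prob_simps)
    show "star ?A (star ?A p) = p" "star ?A (p \<oplus>\<^bsub>?A\<^esub> q) = star ?A p \<oplus>\<^bsub>?A\<^esub> star ?A q"
      "star ?A (c \<odot>\<^bsub>?A\<^esub> p) = cnj c \<odot>\<^bsub>?A\<^esub> star ?A p"
      by (auto intro!: poly_eqI simp: polynomial_star_prob_simps coeff_map_poly)
    show "state ?A \<one>\<^bsub>?A\<^esub> = 1"
      using prob_space by (simp add: polynomial_star_prob_simps)
  qed (auto simp: polynomial_star_prob_simps)
qed

text \<open>Horner's scheme: every polynomial arises from multiples of the unit by multiplying with
  the indeterminate and adding.\<close>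

lemma polynomial_star_generated: "star_generated (polynomial_star_prob \<nu>) [:0, 1:] = UNIV"
proof -
  let ?A = "polynomial_star_prob \<nu>"
  have const: "[:c:] \<in> star_generated ?A [:0, 1:]" for c
  proof -
    have "c \<odot>\<^bsub>?A\<^esub> \<one>\<^bsub>?A\<^esub> \<in> star_generated ?A [:0, 1:]"
      by (intro star_generated.smult star_generated.one)
    then show ?thesis by (simp add: polynomial_star_prob_simps one_pCons)
  qed
  have "p \<in> star_generated ?A [:0, 1:]" for p
  proof (induction p)
    case 0
    then show ?case using const[of 0] by simp
  next
    case (pCons c p)
    have "[:c:] \<oplus>\<^bsub>?A\<^esub> ([:0, 1:] \<otimes>\<^bsub>?A\<^esub> p) \<in> star_generated ?A [:0, 1:]"
      by (intro star_generated.add star_generated.mult star_generated.gen const pCons.IH)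
    then show ?case by (simp add: polynomial_star_prob_simps)
  qed
  then show ?thesis by auto
qed

lemma polynomial_self_adjoint: "self_adjoint (polynomial_star_prob \<nu>) [:0, 1:]"
  by (simp add: self_adjoint_def polynomial_star_prob_simps map_poly_pCons)

lemma polynomial_state_pow:
  "state (polynomial_star_prob \<nu>) ([:0, 1:] [^]\<^bsub>polynomial_star_prob \<nu>\<^esub> (l::nat)) = complex_of_real (\<integral>x. x ^ l \<partial>\<nu>)"
proof -
  have "[:0, 1:] [^]\<^bsub>polynomial_star_prob \<nu>\<^esub> (l::nat) = [:0, 1:] ^ l"
    by (induction l) (simp_all add: nat_pow_def polynomial_star_prob_simps mult.commute)
  then show ?thesis
    by (simp add: polynomial_star_prob_simps poly_power flip: of_real_power)
qed

section \<open>The limit theorem\<close>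

lemma pow_mat_smult:
  fixes B :: "'a::comm_ring_1 mat"
  assumes B: "B \<in> carrier_mat n n"
  shows "(c \<cdot>\<^sub>m B) ^\<^sub>m l = c ^ l \<cdot>\<^sub>m (B ^\<^sub>m l)"
proof (induction l)
  case 0
  show ?case using B by (intro eq_matI) auto
next
  case (Suc l)
  have Bl: "B ^\<^sub>m l \<in> carrier_mat n n" using B by simp
  have "(c \<cdot>\<^sub>m B) ^\<^sub>m Suc l = (c ^ l \<cdot>\<^sub>m (B ^\<^sub>m l)) * (c \<cdot>\<^sub>m B)" using Suc by simp
  also have "\<dots> = c ^ l \<cdot>\<^sub>m (c \<cdot>\<^sub>m (B ^\<^sub>m l * B))"
    using B Bl by (simp add: mult_smult_distrib[OF Bl B] mult_smult_assoc_mat[of _ n n _ n])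
  also have "\<dots> = c ^ Suc l \<cdot>\<^sub>m (B ^\<^sub>m Suc l)"
    by (intro eq_matI) (auto simp: mult_ac)
  finally show ?case .
qed

lemma mat_trace_smult:
  fixes c :: "'a::comm_ring_1"
  assumes "B \<in> carrier_mat n n"
  shows "mat_trace (c \<cdot>\<^sub>m B) = c * mat_trace B"
  using assms unfolding mat_trace_def sum_distrib_left by (intro sum.cong) auto

lemma scaled_A_carrier: "scaled_A X L n t \<omega> \<in> carrier_mat n n"
  by (simp add: scaled_A_def A_mat_def)

lemma scaled_A_index:
  assumes "i < n" "j < n"
  shows "scaled_A X L n t \<omega> $$ (i, j) = walk X n (L n (Suc i) (Suc j)) t \<omega> / real n"
  using assms by (simp add: scaled_A_def A_mat_def)

lemma scaled_A_symmetric: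
  assumes "symmetric_link L" "i < n" "j < n"
  shows "scaled_A X L n t \<omega> $$ (i, j) = scaled_A X L n t \<omega> $$ (j, i)"
  using assms by (simp add: scaled_A_index symmetric_link_def)

text \<open>The second factor n^(-1/2) per entry absorbs n^(l/2), so the normalised trace moment is
  the expected trace of the l-th power divided by n, the value of the matrix state.\<close>

lemma scaled_trace_moment_scaled_A:
  assumes P: "prob_space P" and n: "n \<ge> 1"
  shows "scaled_trace_moment P X L l t n = prob_space.expectation P (\<lambda>\<omega>. mat_trace (scaled_A X L n t \<omega> ^\<^sub>m l)) / real n"
proof -
  interpret prob_space P by (rule P)
  have A: "A_mat X L n t \<omega> \<in> carrier_mat n n" for \<omega> by (simp add: A_mat_def)
  have "mat_trace (scaled_A X L n t \<omega> ^\<^sub>m l) = (1 / sqrt (real n)) ^ l * mat_trace (A_mat X L n t \<omega> ^\<^sub>m l)" for \<omega>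
    unfolding scaled_A_def pow_mat_smult[OF A] by (rule mat_trace_smult[OF pow_carrier_mat[OF A]])
  then have tr: "expectation (\<lambda>\<omega>. mat_trace (scaled_A X L n t \<omega> ^\<^sub>m l)) =
      (1 / sqrt (real n)) ^ l * expectation (\<lambda>\<omega>. mat_trace (A_mat X L n t \<omega> ^\<^sub>m l))"
    by (simp only: integral_mult_right_zero)
  have "1 / real n powr (1 + real l / 2) = (1 / sqrt (real n)) ^ l / real n"
  proof -
    have "sqrt (real n) ^ l = real n powr (real l / 2)"
      using n by (simp add: powr_half_sqrt[symmetric] powr_powr flip: powr_realpow)
    then show ?thesis using n by (simp add: powr_add power_divide)
  qed
  then have "x / real n powr (1 + real l / 2) = (1 / sqrt (real n)) ^ l * x / real n" for x
    by (metis mult.commute mult_1 times_divide_eq_right)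
  then show ?thesis unfolding scaled_trace_moment_def tr .
qed

lemma scaled_A_has_moments:
  assumes P: "prob_space P" and d: "d \<in> {1, 2}" and link: "link_function d L" and A: "assumption_I P X"
    and ij: "i < n" "j < n"
  shows "has_moments P (\<lambda>\<omega>. scaled_A X L n t \<omega> $$ (i, j))"
proof -
  interpret prob_space P by (rule P)
  have "length (L n (Suc i) (Suc j)) \<in> {1, 2}"
    using ij by (intro link_length[OF P d link A]) auto
  then have "has_moments P (\<lambda>\<omega>. walk X n (L n (Suc i) (Suc j)) t \<omega> * (1 / real n))"
    by (intro has_moments_mult has_moments_const walk_has_moments[OF P d link A])
  then show ?thesis using ij by (simp add: scaled_A_index)
qed

lemma scaled_A_trace_integrable:
  assumes P: "prob_space P" and d: "d \<in> {1, 2}" and link: "link_function d L" and A: "assumption_I P X"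
  shows "integrable P (\<lambda>\<omega>. mat_trace (scaled_A X L n t \<omega> ^\<^sub>m l))"
proof -
  interpret prob_space P by (rule P)
  have "has_moments P (\<lambda>\<omega>. scaled_A X L n t \<omega> $$ (\<pi> i - 1, \<pi> (Suc i) - 1))" if "\<pi> \<in> circuits n l" "i < l" for \<pi> i
  proof -
    have "\<pi> i \<in> {1..n}" "\<pi> (Suc i) \<in> {1..n}" using that unfolding circuits_def by (auto simp: PiE_iff)
    then show ?thesis by (intro scaled_A_has_moments[OF P d link A]) auto
  qed
  then show ?thesis
    unfolding mat_trace_pow_circuits[OF scaled_A_carrier]
    by (intro Bochner_Integration.integrable_sum has_moments_integrable has_moments_prod) auto
qed

text \<open>The moments of this law equal the normalised trace moments for each n and not merely in
  the limit, so the limits of traces are already limits of moments of laws.\<close>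

lemma expected_ESD_law:
  assumes P: "prob_space P" and d: "d \<in> {1, 2}" and link: "link_function d L" and sym: "symmetric_link L"
    and A: "assumption_I P X" and n: "n \<ge> 1"
  shows "\<exists>\<nu>. real_distribution \<nu> \<and> (\<forall>k. integrable \<nu> (\<lambda>x. x ^ k)) \<and>
    (\<forall>k. (\<integral>x. x ^ k \<partial>\<nu>) = scaled_trace_moment P X L k t n) \<and>
    cdf \<nu> = expected_ESD P (scaled_A X L n t)"
proof -
  interpret prob_space P by (rule P)
  let ?E = "\<lambda>\<omega>. proots (char_poly (scaled_A X L n t \<omega>))"
  have E: "size (?E \<omega>) = n" "(\<Sum>e\<in>#?E \<omega>. e ^ k) = mat_trace (scaled_A X L n t \<omega> ^\<^sub>m k)" for \<omega> k
    by (rule symmetric_proots_trace[OF scaled_A_carrier scaled_A_symmetric[OF sym]]; assumption)+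
  have "integrable P (\<lambda>\<omega>. \<Sum>e\<in>#?E \<omega>. e ^ k)" for k
    unfolding E(2) by (rule scaled_A_trace_integrable[OF P d link A])
  from expected_spectral_law[OF n E(1) this] obtain \<nu> where \<nu>: "real_distribution \<nu>" 
      "\<And>k. integrable \<nu> (\<lambda>x. x ^ k)"
      "\<And>k. (\<integral>x. x ^ k \<partial>\<nu>) = expectation (\<lambda>\<omega>. \<Sum>e\<in>#?E \<omega>. e ^ k) / real n"
      "\<And>x. cdf \<nu> x = expectation (\<lambda>\<omega>. real (size (filter_mset (\<lambda>e. e \<le> x) (?E \<omega>))) / real n)"
    by blast
  have "dim_row (scaled_A X L n t \<omega>) = n" for \<omega> by (rule carrier_matD(1)[OF scaled_A_carrier])
  then have "cdf \<nu> = expected_ESD P (scaled_A X L n t)"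
    using \<nu>(4) by (simp add: expected_ESD_def ESD_def fun_eq_iff)
  moreover have "(\<integral>x. x ^ k \<partial>\<nu>) = scaled_trace_moment P X L k t n" for k
    unfolding \<nu>(3) E(2) scaled_trace_moment_scaled_A[OF P n] ..
  ultimately show ?thesis using \<nu>(1,2) by blast
qed

theorem theorem3p1:
  fixes P :: "'w measure"
    and X :: "nat list \<Rightarrow> nat \<Rightarrow> 'w \<Rightarrow> real"
    and L :: "nat \<Rightarrow> nat \<Rightarrow> nat \<Rightarrow> nat list"
    and d :: nat and t :: real
  assumes "prob_space P"
    and "d \<in> {1, 2}"
    and "link_function d L" and "symmetric_link L" and "property_B d L"
    and "assumption_I P X"
    and "\<forall>m\<ge>1. \<forall>w\<in>pair_words (2 * m).
           convergent (\<lambda>n. real (card (word_circuits L n w)) / real n ^ (1 + m))"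
    and "t \<ge> 0"
  shows
    "(\<forall>l\<ge>1. convergent (scaled_trace_moment P X L l t)) \<and>
     (\<forall>m\<ge>1. mu P X L (2 * m - 1) t = 0) \<and>
     (\<forall>m\<ge>1. mu P X L (2 * m) t =
        t ^ m * (\<Sum>w\<in>pair_words (2 * m).
                  lim (\<lambda>n. real (card (word_circuits L n w)) / real n ^ (1 + m)))) \<and>
     (\<exists>\<nu>. law_with_moments (\<lambda>l. mu P X L l t) \<nu> \<and>
          (\<forall>\<nu>'. law_with_moments (\<lambda>l. mu P X L l t) \<nu>' \<longrightarrow> \<nu>' = \<nu>) \<and>
          weak_conv (\<lambda>n. expected_ESD P (scaled_A X L n t)) (cdf \<nu>)) \<and>
     (\<forall>n\<ge>1. star_prob_space (random_matrix_space P n) \<and>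
            self_adjoint (random_matrix_space P n) (matrix_element n (scaled_A X L n t))) \<and>
     (\<exists>(\<A> :: complex poly star_prob) a.
          star_prob_space \<A> \<and> self_adjoint \<A> a \<and> carrier \<A> = star_generated \<A> a \<and>
          (\<forall>l\<ge>1. state \<A> (a [^]\<^bsub>\<A>\<^esub> l) = complex_of_real (mu P X L l t) \<and>
             (\<lambda>n. state (random_matrix_space P n)
                    (matrix_element n (scaled_A X L n t) [^]\<^bsub>random_matrix_space P n\<^esub> l))
               \<longlonglongrightarrow> state \<A> (a [^]\<^bsub>\<A>\<^esub> l)))"
proof -
  note P = assms(1) and d = assms(2) and link = assms(3) and sym = assms(4) and B = assms(5) and A = assms(6)
    and conv = assms(7) and t = assms(8)
  interpret prob_space P by (rule P)
  let ?S = "\<lambda>l. scaled_trace_moment P X L l t"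
  let ?p = "\<lambda>m. t ^ m * (\<Sum>w\<in>pair_words (2 * m). lim (\<lambda>n. real (card (word_circuits L n w)) / real n ^ (1 + m)))"
  obtain K0 where K0: "\<forall>n. \<forall>r\<in>lattice_points d. \<forall>i\<in>{1..n}. card {j\<in>{1..n}. L n i j = r} \<le> K0"
    using B unfolding property_B_def by blast
  \<comment> \<open>The path count asks for K >= 1, which the constant of Property B need not
    satisfy.\<close>
  define K where "K = max 1 K0"
  have K: "card {j\<in>{1..n}. L n i j = r} \<le> K" if "r \<in> lattice_points d" "i \<in> {1..n}" for n r i
  proof -
    have "card {j\<in>{1..n}. L n i j = r} \<le> K0" using K0 that by blast
    then show ?thesis unfolding K_def by linarith
  qed
  have K1: "K \<ge> 1" unfolding K_def by simp
  have lims: "?S l \<longlonglongrightarrow> t ^ (l div 2) *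
      (\<Sum>w\<in>pair_words l. lim (\<lambda>n. real (card (word_circuits L n w)) / real n ^ (1 + l div 2)))" if "l \<ge> 1" for l
    by (rule scaled_trace_moment_tendsto[OF P d link A _ K1 t conv that]) (rule K)
  have S_conv: "convergent (?S l)" if "l \<ge> 1" for l
    using lims[OF that] by (rule convergentI)
  then have S_mu: "?S l \<longlonglongrightarrow> mu P X L l t" if "l \<ge> 1" for l
    using that unfolding mu_def by (simp add: convergent_LIMSEQ_iff)
  have mu_even: "mu P X L (2 * m) t = ?p m" if "m \<ge> 1" for m
    using LIMSEQ_unique[OF S_mu[of "2 * m"] lims[of "2 * m"]] that by simp
  have mu_odd: "mu P X L (2 * m - 1) t = 0" if "m \<ge> 1" for m
  proof -
    have l1: "2 * m - 1 \<ge> 1" and odd: "odd (2 * m - 1)" using that by auto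
    have "pair_words (2 * m - 1) = {}"
    proof (rule equals0I)
      fix w assume "w \<in> pair_words (2 * m - 1)"
      then have "2 * m - 1 = 2 * card (set w)" using pair_matched_length[of w] unfolding pair_words_def by simp
      then show False using odd by (metis dvd_triv_left)
    qed
    then have "?S (2 * m - 1) \<longlonglongrightarrow> 0" using lims[OF l1] by simp
    then show ?thesis using LIMSEQ_unique[OF S_mu[OF l1]] by blast
  qed
  \<comment> \<open>\<open>law_with_moments\<close> reads \<open>mu\<close> from order 1 on, while
    the method of moments also involves order 0, where the total mass is 1.\<close>
  define c where "c l = (if l = 0 then 1 else mu P X L l t)" for l :: nat
  have law_c: "law_with_moments c \<nu> \<longleftrightarrow> law_with_moments (\<lambda>l. mu P X L l t) \<nu>" for \<nu>
    unfolding law_with_moments_def c_def by auto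
  \<comment> \<open>The empty matrix at n = 0 has no spectral law, so the laws are taken at
    \<open>Suc n\<close>; the shift is undone when weak convergence is concluded.\<close>
  have "\<forall>n. \<exists>\<nu>. real_distribution \<nu> \<and> (\<forall>k. integrable \<nu> (\<lambda>x. x ^ k)) \<and>
    (\<forall>k. (\<integral>x. x ^ k \<partial>\<nu>) = scaled_trace_moment P X L k t (Suc n)) \<and>
    cdf \<nu> = expected_ESD P (scaled_A X L (Suc n) t)"
    using expected_ESD_law[OF P d link sym A] by simp
  then obtain M where M: "\<And>n. real_distribution (M n)" "\<And>n k. integrable (M n) (\<lambda>x. x ^ k)"
    "\<And>n k. (\<integral>x. x ^ k \<partial>M n) = ?S k (Suc n)"
    "\<And>n. cdf (M n) = expected_ESD P (scaled_A X L (Suc n) t)"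
    by metis
  have M_lim: "(\<lambda>n. \<integral>x. x ^ k \<partial>M n) \<longlonglongrightarrow> c k" for k
  proof (cases "k = 0")
    case True
    have "(\<integral>x. x ^ 0 \<partial>M n) = 1" for n
    proof -
      interpret Mn: real_distribution "M n" by (rule M(1))
      show ?thesis using Mn.prob_space by simp
    qed
    then show ?thesis unfolding True c_def by simp
  next
    case False
    then show ?thesis unfolding M(3) c_def using LIMSEQ_Suc[OF S_mu[of k]] by simp
  qed
  \<comment> \<open>The formula for the even moments holds from m = 1 on, hence the passage through
    an eventual equality.\<close>
  have growth: "(\<lambda>m. h ^ (2 * m) / fact (2 * m) * c (2 * m)) \<longlonglongrightarrow> 0" for h
  proof (rule Lim_transform_eventually)
    show "(\<lambda>m. h ^ (2 * m) / fact (2 * m) * ?p m) \<longlonglongrightarrow> 0"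
      by (rule even_moment_growth[OF P d link A _ K1 t conv]) (rule K)
    show "\<forall>\<^sub>F m in sequentially. h ^ (2 * m) / fact (2 * m) * ?p m = h ^ (2 * m) / fact (2 * m) * c (2 * m)"
      by (rule eventually_sequentiallyI[of 1]) (simp add: mu_even c_def)
  qed
  obtain \<nu> where \<nu>: "law_with_moments c \<nu>" "\<And>\<nu>'. law_with_moments c \<nu>' \<Longrightarrow> \<nu>' = \<nu>" "weak_conv_m M \<nu>"
    using method_of_moments[OF M(1,2) M_lim growth] by metis
  have wc: "weak_conv (\<lambda>n. expected_ESD P (scaled_A X L n t)) (cdf \<nu>)"
    unfolding weak_conv_def
  proof (intro allI impI)
    fix x assume "isCont (cdf \<nu>) x"
    then have "(\<lambda>n. expected_ESD P (scaled_A X L (Suc n) t) x) \<longlonglongrightarrow> cdf \<nu> x"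
      using \<nu>(3) unfolding weak_conv_m_def weak_conv_def M(4) by blast
    then show "(\<lambda>n. expected_ESD P (scaled_A X L n t) x) \<longlonglongrightarrow> cdf \<nu> x" by (rule LIMSEQ_imp_Suc)
  qed
  have \<nu>_rd: "real_distribution \<nu>" using \<nu>(1) unfolding law_with_moments_def by blast
  then interpret \<nu>: real_distribution \<nu> .
  have \<nu>_int: "integrable \<nu> (\<lambda>x. x ^ k)" for k
    using \<nu>(1) unfolding law_with_moments_def by (cases "k = 0") auto
  have \<nu>_mom: "(\<integral>x. x ^ l \<partial>\<nu>) = mu P X L l t" if "l \<ge> 1" for l
    using \<nu>(1) that unfolding law_with_moments_def c_def by auto
  let ?A = "polynomial_star_prob \<nu>"
  have state_lim: "(\<lambda>n. state (random_matrix_space P n)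
          (matrix_element n (scaled_A X L n t) [^]\<^bsub>random_matrix_space P n\<^esub> l)) \<longlonglongrightarrow> complex_of_real (mu P X L l t)"
    if l: "l \<ge> 1" for l :: nat
  proof (rule Lim_transform_eventually[OF tendsto_of_real[OF S_mu[OF l]]])
    show "\<forall>\<^sub>F n in sequentially. complex_of_real (?S l n) = state (random_matrix_space P n)
          (matrix_element n (scaled_A X L n t) [^]\<^bsub>random_matrix_space P n\<^esub> l)"
      unfolding state_matrix_element_pow[OF scaled_A_carrier]
      by (rule eventually_sequentiallyI[of 1]) (simp only: scaled_trace_moment_scaled_A[OF P])
  qed
  have "star_prob_space ?A \<and> self_adjoint ?A [:0, 1:] \<and> carrier ?A = star_generated ?A [:0, 1:] \<and>
      (\<forall>l\<ge>1. state ?A ([:0, 1:] [^]\<^bsub>?A\<^esub> l) = complex_of_real (mu P X L l t) \<and>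
        (\<lambda>n. state (random_matrix_space P n)
               (matrix_element n (scaled_A X L n t) [^]\<^bsub>random_matrix_space P n\<^esub> l))
          \<longlonglongrightarrow> state ?A ([:0, 1:] [^]\<^bsub>?A\<^esub> l))"
    using polynomial_star_prob_space[OF \<nu>_rd \<nu>_int] polynomial_self_adjoint state_lim
    by (simp add: polynomial_star_generated polynomial_star_prob_simps(1) polynomial_state_pow \<nu>_mom)
  then have algebra: "\<exists>(\<A> :: complex poly star_prob) a.
          star_prob_space \<A> \<and> self_adjoint \<A> a \<and> carrier \<A> = star_generated \<A> a \<and>
          (\<forall>l\<ge>1. state \<A> (a [^]\<^bsub>\<A>\<^esub> l) = complex_of_real (mu P X L l t) \<and>
             (\<lambda>n. state (random_matrix_space P n)
                    (matrix_element n (scaled_A X L n t) [^]\<^bsub>random_matrix_space P n\<^esub> l))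
               \<longlonglongrightarrow> state \<A> (a [^]\<^bsub>\<A>\<^esub> l))"
    by (intro exI)
  have matrices: "star_prob_space (random_matrix_space P n) \<and>
      self_adjoint (random_matrix_space P n) (matrix_element n (scaled_A X L n t))" if "n \<ge> 1" for n
    using random_matrix_star_prob_space[OF that] scaled_A_symmetric[OF sym] scaled_A_has_moments[OF P d link A]
    by (intro conjI matrix_element_self_adjoint)
  show ?thesis
  proof (intro conjI allI impI)
    show "\<exists>\<nu>. law_with_moments (\<lambda>l. mu P X L l t) \<nu> \<and>
          (\<forall>\<nu>'. law_with_moments (\<lambda>l. mu P X L l t) \<nu>' \<longrightarrow> \<nu>' = \<nu>) \<and>
          weak_conv (\<lambda>n. expected_ESD P (scaled_A X L n t)) (cdf \<nu>)"
      using \<nu>(1,2) wc unfolding law_c by (intro exI[of _ \<nu>] conjI allI impI)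
  qed (fact S_conv mu_odd mu_even algebra | rule conjunct1[OF matrices] conjunct2[OF matrices], assumption)+
qed

end
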